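(* Let $\Theta,\Lambda$ be ordinals with $\Lambda>0$. The following are equivalent: 1. $\mathsf{GLP}^0_\Lambda$ is complete for $\mathfrak I^\Theta_\Lambda$ (every formula of the language of $\mathsf{GLP}^0_\Lambda$ true at all points of $\mathfrak I^\Theta_\Lambda$ is derivable in $\mathsf{GLP}^0_\Lambda$); 2. $\mathsf{GLP}^0_\Lambda$ is complete for $\mathfrak T^\Theta_\Lambda$ (every formula of the language of $\mathsf{GLP}^0_\Lambda$ true at all points of $\mathfrak T^\Theta_\Lambda$ is derivable in $\mathsf{GLP}^0_\Lambda$); 3. $\Theta\ge e^\Lambda 1$.
   Context: **Logic.** Formulas of $\mathsf{GLP}^0_\Lambda$ are built from $\bot$ (there are no propositional variables) using $\neg,\wedge$ and a unary modality $[\xi]$ for each ordinal $\xi<\Lambda$; $\langle\xi\rangle$ abbreviates $\neg[\xi]\neg$, and other Booleans are defined as usual. $\mathsf{GLP}^0_\Lambda$ has as axioms: all propositional tautologies; $[\xi](\phi\to\psi)\to([\xi]\phi\to[\xi]\psi)$ for $\xi<\Lambda$; $[\xi]([\xi]\phi\to\phi)\to[\xi]\phi$ for $\xi<\Lambda$; $\langle\zeta\rangle\phi\to\langle\xi\rangle\phi$ for $\xi<\zeta<\Lambda$; $\langle\xi\rangle\phi\to[\zeta]\langle\xi\rangle\phi$ for $\xi<\zeta<\Lambda$; the rules are modus ponens and necessitation (from $\phi$ infer $[\xi]\phi$). **Ordinal functions.** For $\xi\le\zeta$, $-\xi+\zeta$ is the unique $\eta$ with $\xi+\eta=\zeta$.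 Let $e(\xi)=-1+\omega^\xi$. The hyperexponentials $e^\zeta$ are: $e^0\xi=\xi$; $e^\xi 0=0$; $e^1=e$; $e^{\omega^\rho+\xi}=e^{\omega^\rho}e^\xi$ (composition) if $\xi<\omega^\rho+\xi$; $e^{\omega^\rho}(\xi+1)=\lim_{\zeta\to\omega^\rho}e^\zeta(e^{\omega^\rho}(\xi)+1)$ for $\rho>0$; $e^{\omega^\rho}\xi=\lim_{\zeta\to\xi}e^{\omega^\rho}\zeta$ for $\xi$ a limit ordinal, $\rho>0$. The hyperlogarithms $\ell^\xi$ are: $\ell^0\alpha=\alpha$; $\ell^\xi0=0$; $\ell^\xi(\alpha+\beta)=\ell^\xi\beta$ if $\xi,\beta>0$; $\ell^\xi1=0$ for $\xi>0$; $\ell^{\omega^\rho+\xi}=\ell^\xi\ell^{\omega^\rho}$ if $\xi<\omega^\rho+\xi$; and $\ell^{\omega^\rho}e^{\omega^\delta}\xi$ equals $\ell^{\omega^\rho}\xi$ if $\delta<\rho$, $\xi$ if $\delta=\rho$, and $e^{\omega^\delta}\xi$ if $\delta>\rho$. Write $\ell=\ell^1$; in particular $\ell(\zeta+\omega^\rho)=\rho$. **Kripke frame.** An ordinal is identified with the set of smaller ordinals. An $\ell$-sequence of depth $\Theta$ and length $\Lambda$ is a function $f:\Lambda\to\Theta$ such that for every $\zeta\in(0,\Lambda)$ there is $\vartheta<\zeta$ with $f(\zeta)\le\ell^{-\xi+\zeta}f(\xi)$ for all $\xi\in[\vartheta,\zeta)$. $D^\Theta_\Lambda$ is the set of these. $\mathfrak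 I^\Theta_\Lambda=\langle D^\Theta_\Lambda,\langle<_\xi\rangle_{\xi<\Lambda}\rangle$, where $f<_\xi g$ iff $f(\zeta)=g(\zeta)$ for all $\zeta<\xi$ and $f(\xi)<g(\xi)$. Truth: Booleans as usual, and $\langle\mathfrak I^\Theta_\Lambda,g\rangle\models\langle\xi\rangle\phi$ iff there is $f<_\xi g$ with $\langle\mathfrak I^\Theta_\Lambda,f\rangle\models\phi$. **Polytopological space.** $\mathfrak T^\Theta_\Lambda=\langle\Theta,\langle\mathcal T_\lambda\rangle_{\lambda<\Lambda}\rangle$, where $\mathcal T_\lambda$ is the topology on $\Theta$ with subbasis the sets $\{\zeta<\Theta:\alpha<\ell^\xi\zeta\le\beta\}$ for $\xi<\lambda$, $\alpha<\beta\le\Theta$, and $\{\zeta<\Theta:\ell^\xi\zeta\le\beta\}$ for $\xi\le\lambda$, $\beta\le\Theta$ (equivalently, $\mathcal T_\lambda$ is induced via $\zeta\mapsto\langle\ell^\xi\zeta\rangle_{\xi<\Lambda}$ from the product topology on functions $\Lambda\to\Theta$ with the order topology on coordinates below $\lambda$, the initial segment topology on coordinate $\lambda$, and the trivial topology on coordinates above $\lambda$). Truth: Booleans as usual, and $\langle\mathfrak T^\Theta_\Lambda,\xi\rangle\models\langle\lambda\rangle\phi$ iff every $U\in\mathcal T_\lambda$ containing $\xi$ contains some $\zeta\ne\xi$ with $\langle\mathfrak T^\Theta_\Lambda,\zeta\rangle\models\phi$ (derived-set semantics). *)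

theory Defs
  imports "HOL-Analysis.Analysis" "HOL-Library.FuncSet"
begin

section \<open>Ordinals\<close>

text \<open>
  There is no type of all ordinals. The type \<open>'a ordinal\<close> consists of the ordinals
  below the successor cardinal of \<open>nat + 'a\<close>, i.e. of all ordinals of cardinality at
  most that of \<open>nat + 'a\<close>. That cardinal is regular and uncountable, hence the type is closed under
  suprema of families indexed by its initial segments (\<open>ordinal_image_bounded\<close>) and under all the
  functions below. The type \<open>'a\<close> being arbitrary, every pair of ordinals lives in some
  \<open>'a ordinal\<close>.
\<close>

typedef 'a ordinal = "Field (cardSuc (card_of (UNIV :: (nat + 'a) set)))"
proof -
  have "infinite (Field (cardSuc (card_of (UNIV :: (nat + 'a) set))))"
    by (simp add: card_of_cardSuc_finite)
  then show ?thesis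
    by (metis ex_in_conv finite.emptyI)
qed

instantiation ordinal :: (type) linorder
begin

definition less_eq_ordinal :: "'a ordinal \<Rightarrow> 'a ordinal \<Rightarrow> bool"
  where "x \<le> y \<longleftrightarrow>
    (Rep_ordinal x, Rep_ordinal y) \<in> cardSuc (card_of (UNIV :: (nat + 'a) set))"

definition less_ordinal :: "'a ordinal \<Rightarrow> 'a ordinal \<Rightarrow> bool"
  where "less_ordinal x y \<longleftrightarrow> x \<le> y \<and> \<not> y \<le> x"

lemma Card_order_ordinal: "Card_order (cardSuc (card_of (UNIV :: (nat + 'a) set)))"
  by (simp add: cardSuc_Card_order card_of_Card_order)

lemma Well_order_ordinal: "Well_order (cardSuc (card_of (UNIV :: (nat + 'a) set)))"
  using Card_order_ordinal card_order_on_well_order_on by blast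

instance
proof
  have lin: "Linear_order (cardSuc (card_of (UNIV :: (nat + 'a) set)))"
    using Well_order_ordinal well_order_on_def by blast
  then have r: "refl_on (Field (cardSuc (card_of (UNIV :: (nat + 'a) set)))) (cardSuc (card_of (UNIV :: (nat + 'a) set)))"
    and t: "trans (cardSuc (card_of (UNIV :: (nat + 'a) set)))"
    and a: "antisym (cardSuc (card_of (UNIV :: (nat + 'a) set)))"
    and tot: "total_on (Field (cardSuc (card_of (UNIV :: (nat + 'a) set)))) (cardSuc (card_of (UNIV :: (nat + 'a) set)))"
    by (auto simp: linear_order_on_def partial_order_on_def preorder_on_def)
  fix x y z :: "'a ordinal"
  show "(x < y) = (x \<le> y \<and> \<not> y \<le> x)"
    by (fact less_ordinal_def)
  show "x \<le> x"
    unfolding less_eq_ordinal_def using r Rep_ordinal[of x] by (rule refl_onD)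
  show "x \<le> y \<Longrightarrow> y \<le> z \<Longrightarrow> x \<le> z"
    unfolding less_eq_ordinal_def using t by (blast dest: transD)
  show "x \<le> y \<Longrightarrow> y \<le> x \<Longrightarrow> x = y"
    unfolding less_eq_ordinal_def using a by (metis antisymD Rep_ordinal_inject)
  show "x \<le> y \<or> y \<le> x"
    unfolding less_eq_ordinal_def using tot r Rep_ordinal[of x] Rep_ordinal[of y] by (metis total_on_def refl_onD)
qed

end

instance ordinal :: (type) wellorder
proof
  fix P :: "'a ordinal \<Rightarrow> bool" and a :: "'a ordinal"
  assume step: "\<And>x. (\<And>y. y < x \<Longrightarrow> P y) \<Longrightarrow> P x"
  let ?r = "cardSuc (card_of (UNIV :: (nat + 'a) set))"
  have "wf (?r - Id)"
    using Well_order_ordinal well_order_on_def by blast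
  then have "wf (inv_image (?r - Id) Rep_ordinal)"
    by (rule wf_inv_image)
  moreover have "inv_image (?r - Id) Rep_ordinal = {(x, y). x < y}"
    by (auto simp: inv_image_def less_eq_ordinal_def less_le Rep_ordinal_inject)
  ultimately have "wf {(x :: 'a ordinal, y). x < y}" by simp
  then show "P a"
    by (induction a rule: wf_induct_rule) (use step in auto)
qed

lemma ordinal_bounded:
  fixes A :: "'a ordinal set"
  assumes "(card_of A, card_of (UNIV :: (nat + 'a) set)) \<in> ordLeq"
  shows "\<exists>b. \<forall>a\<in>A. a < b"
proof -
  let ?u = "card_of (UNIV :: (nat + 'a) set)"
  let ?r = "cardSuc ?u"
  have inf: "infinite (Field ?r)"
    by (simp add: card_of_cardSuc_finite)
  have reg: "regularCard ?r"
    by (rule infinite_cardSuc_regularCard) (use card_of_Card_order in \<open>auto simp: Field_card_of\<close>)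
  have sub: "Rep_ordinal ` A \<subseteq> Field ?r"
    using Rep_ordinal by auto
  have "(card_of (Rep_ordinal ` A), ?r) \<in> ordLess"
    using card_of_image[of Rep_ordinal A] assms
    by (meson cardSuc_greater card_of_Card_order ordLeq_ordLess_trans ordLeq_transitive)
  then have "\<not> cofinal (Rep_ordinal ` A) ?r"
    using reg sub unfolding regularCard_def by (blast dest: not_ordLess_ordIso)
  then obtain x where x: "x \<in> Field ?r" "\<And>b. b \<in> Rep_ordinal ` A \<Longrightarrow> x = b \<or> (x, b) \<notin> ?r"
    unfolding cofinal_def by blast
  obtain y where y: "y \<in> Field ?r" "x \<noteq> y" "(x, y) \<in> ?r"
    using infinite_Card_order_limit[OF Card_order_ordinal inf x(1)] by blast
  have "a < Abs_ordinal y" if "a \<in> A" for a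
  proof -
    have "\<not> Abs_ordinal x < a"
      using x(2)[of "Rep_ordinal a"] that x(1)
      by (auto simp: less_le less_eq_ordinal_def Abs_ordinal_inverse Rep_ordinal_inverse)
    moreover have "Abs_ordinal x < Abs_ordinal y"
      using x(1) y by (auto simp: less_le less_eq_ordinal_def Abs_ordinal_inverse Abs_ordinal_inject)
    ultimately show ?thesis by simp
  qed
  then show ?thesis by blast
qed

lemma card_of_lessThan_ordinal:
  fixes b :: "'a ordinal"
  shows "(card_of {..<b}, card_of (UNIV :: (nat + 'a) set)) \<in> ordLeq"
proof -
  let ?u = "card_of (UNIV :: (nat + 'a) set)"
  let ?r = "cardSuc ?u"
  have "Rep_ordinal ` {..<b} \<subseteq> underS ?r (Rep_ordinal b)"
    by (auto simp: underS_def less_le less_eq_ordinal_def Rep_ordinal_inject)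
  moreover have "inj_on Rep_ordinal {..<b}"
    by (auto simp: inj_on_def Rep_ordinal_inject)
  ultimately have "(card_of {..<b}, card_of (underS ?r (Rep_ordinal b))) \<in> ordLeq"
    using card_of_ordLeq by blast
  moreover have "(card_of (underS ?r (Rep_ordinal b)), ?r) \<in> ordLess"
    by (rule card_of_underS[OF Card_order_ordinal Rep_ordinal])
  ultimately have "(card_of {..<b}, ?r) \<in> ordLess"
    by (rule ordLeq_ordLess_trans)
  then show ?thesis
    using cardSuc_ordLeq_ordLess[of "card_of (UNIV :: (nat + 'a) set)" "card_of {..<b}"]
    by (simp add: card_of_Card_order)
qed

lemma ordinal_image_bounded:
  fixes f :: "'a ordinal \<Rightarrow> 'a ordinal"
  shows "\<exists>b. \<forall>x<c. f x < b"
proof -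
  have "(card_of (f ` {..<c}), card_of (UNIV :: (nat + 'a) set)) \<in> ordLeq"
    by (rule ordLeq_transitive[OF card_of_image card_of_lessThan_ordinal])
  from ordinal_bounded[OF this] show ?thesis by auto
qed

lemma ordinal_range_nat_bounded:
  fixes f :: "nat \<Rightarrow> 'a ordinal"
  shows "\<exists>b. \<forall>n. f n < b"
proof -
  have "(card_of (range f), card_of (UNIV :: (nat + 'a) set)) \<in> ordLeq"
  proof -
    have "(card_of (UNIV :: nat set), card_of (UNIV :: (nat + 'a) set)) \<in> ordLeq"
      by (rule card_of_ordLeqI[of Inl]) auto
    then show ?thesis
      by (rule ordLeq_transitive[OF card_of_image])
  qed
  from ordinal_bounded[OF this] show ?thesis by auto
qed

lemma ordinal_no_top: "\<exists>b :: 'a ordinal. a < b"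
  using ordinal_range_nat_bounded[of "\<lambda>_. a"] by auto

definition osuc :: "'a ordinal \<Rightarrow> 'a ordinal"
  where "osuc a = (LEAST b. a < b)"

text \<open>Least upper bound of a bounded set; \<open>osup {} = 0\<close>.\<close>

definition osup :: "'a ordinal set \<Rightarrow> 'a ordinal"
  where "osup A = (LEAST b. \<forall>a\<in>A. a \<le> b)"

lemma less_osuc [simp]: "a < osuc a"
  unfolding osuc_def using ordinal_no_top by (rule LeastI_ex)

lemma osuc_le_iff: "osuc a \<le> b \<longleftrightarrow> a < b"
  by (metis Least_le less_le_trans less_osuc osuc_def)

lemma less_osuc_iff: "a < osuc b \<longleftrightarrow> a \<le> b"
  by (metis linorder_not_le osuc_le_iff)

lemma osuc_less_iff [simp]: "osuc a < osuc b \<longleftrightarrow> a < b"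
  by (metis less_osuc_iff osuc_le_iff)

lemma osuc_le_osuc_iff [simp]: "osuc a \<le> osuc b \<longleftrightarrow> a \<le> b"
  by (metis linorder_not_le osuc_less_iff)

lemma osuc_inject [simp]: "osuc a = osuc b \<longleftrightarrow> a = b"
  by (metis linorder_neq_iff osuc_less_iff)

instantiation ordinal :: (type) "{zero, one}"
begin
definition zero_ordinal :: "'a ordinal" where "zero_ordinal = (LEAST b. True)"
definition one_ordinal :: "'a ordinal" where "one_ordinal = osuc 0"
instance ..
end

lemma ordinal_zero_le [simp]: "(0 :: 'a ordinal) \<le> a"
  unfolding zero_ordinal_def by (rule Least_le) simp

lemma ordinal_not_less_zero [simp]: "\<not> a < (0 :: 'a ordinal)"
  by (simp add: linorder_not_less)

lemma ordinal_le_zero [simp]: "a \<le> (0 :: 'a ordinal) \<longleftrightarrow> a = 0"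
  by (simp add: order.eq_iff)

lemma osuc_neq_zero [simp]: "osuc a \<noteq> 0" "0 \<noteq> osuc a"
  by (metis less_osuc ordinal_not_less_zero)+

lemma ordinal_pos_iff: "0 < (a :: 'a ordinal) \<longleftrightarrow> a \<noteq> 0"
  by (metis linorder_neq_iff ordinal_not_less_zero)

definition olimit :: "'a ordinal \<Rightarrow> bool"
  where "olimit b \<longleftrightarrow> b \<noteq> 0 \<and> (\<nexists>a. b = osuc a)"

lemma osup_upper:
  "\<forall>x\<in>A. x \<le> b \<Longrightarrow> a \<in> A \<Longrightarrow> a \<le> osup A"
  unfolding osup_def using LeastI[of "\<lambda>b. \<forall>x\<in>A. x \<le> b" b] by blast

lemma osup_least: "\<forall>x\<in>A. x \<le> b \<Longrightarrow> osup A \<le> b"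
  unfolding osup_def by (rule Least_le) simp

lemma osup_image_upper: "x < c \<Longrightarrow> f x \<le> osup (f ` {..<c})" for f :: "'a ordinal \<Rightarrow> 'a ordinal"
proof -
  assume "x < c"
  obtain b where b: "\<forall>x<c. f x < b" using ordinal_image_bounded by blast
  show ?thesis
    by (rule osup_upper[where b = b]) (use b \<open>x < c\<close> in \<open>auto intro: less_imp_le\<close>)
qed

lemma osup_image_le_iff: "osup (f ` {..<c}) \<le> b \<longleftrightarrow> (\<forall>x<c. f x \<le> b)" for f :: "'a ordinal \<Rightarrow> 'a ordinal"
proof
  assume "osup (f ` {..<c}) \<le> b"
  then show "\<forall>x<c. f x \<le> b"
    using osup_image_upper[of _ c f] order_trans by blast
next
  assume "\<forall>x<c. f x \<le> b"
  then show "osup (f ` {..<c}) \<le> b"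
    by (intro osup_least) auto
qed

text \<open>
  Transfinite iteration: \<open>orec z s 0 = z\<close>, \<open>orec z s (b + 1) = s (orec z s b)\<close>,
  and suprema at limits.
\<close>

function orec :: "'a ordinal \<Rightarrow> ('a ordinal \<Rightarrow> 'a ordinal) \<Rightarrow> 'a ordinal \<Rightarrow> 'a ordinal" where
  "orec z s b = (if b = 0 then z else if \<exists>a. b = osuc a then s (orec z s (THE a. b = osuc a))
     else osup (orec z s ` {..<b}))"
  by auto
termination
  proof (relation "inv_image {(x :: 'a ordinal, y). x < y} (\<lambda>(z, s, b). b)")
  show "wf (inv_image {(x :: 'a ordinal, y). x < y} (\<lambda>(z :: 'a ordinal, s :: 'a ordinal \<Rightarrow> 'a ordinal, b). b))"
    by (rule wf_inv_image) (rule wf)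
qed auto

declare orec.simps [simp del]

lemma orec_zero [simp]: "orec z s 0 = z"
  and orec_osuc [simp]: "orec z s (osuc a) = s (orec z s a)"
  and orec_limit: "olimit b \<Longrightarrow> orec z s b = osup (orec z s ` {..<b})"
  by (subst orec.simps; auto simp: olimit_def)+

section \<open>Ordinal arithmetic\<close>

lemma ordinal_cases:
  fixes b :: "'a ordinal"
  obtains "b = 0" | a where "b = osuc a" | "olimit b"
  unfolding olimit_def by blast

lemma ordinal_induct [case_names zero osuc limit]:
  fixes b :: "'a ordinal"
  assumes z: "P 0" and s: "\<And>a. P a \<Longrightarrow> P (osuc a)"
    and l: "\<And>b. olimit b \<Longrightarrow> (\<And>a. a < b \<Longrightarrow> P a) \<Longrightarrow> P b"
  shows "P b"
proof (induction b rule: less_induct)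
  case (less b)
  show ?case
  proof (cases b rule: ordinal_cases)
    case (2 a)
    then show ?thesis using less s by simp
  qed (use z l less in auto)
qed

lemma olimit_osuc_less: "olimit b \<Longrightarrow> a < b \<Longrightarrow> osuc a < b"
  by (metis olimit_def osuc_le_iff less_le)

lemma olimit_pos: "olimit b \<Longrightarrow> 0 < b"
  by (simp add: olimit_def ordinal_pos_iff)

lemma not_olimit [simp]: "\<not> olimit 0" "\<not> olimit (osuc a)"
  by (auto simp: olimit_def)

definition normal :: "('a ordinal \<Rightarrow> 'a ordinal) \<Rightarrow> bool"
  where "normal f \<longleftrightarrow> strict_mono f \<and> (\<forall>b. olimit b \<longrightarrow> f b = osup (f ` {..<b}))"

lemma normalI:
  assumes s: "\<And>x. f x < f (osuc x)" and l: "\<And>b. olimit b \<Longrightarrow> f b = osup (f ` {..<b})"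
  shows "normal f"
proof -
  have "a < b \<longrightarrow> f a < f b" for a b
  proof (induction b rule: ordinal_induct)
    case (osuc b)
    then show ?case using s[of b] by (auto simp: less_osuc_iff le_less)
  next
    case (limit b)
    show ?case
    proof
      assume "a < b"
      then have "f (osuc a) \<le> f b"
        using limit olimit_osuc_less osup_image_upper l by metis
      then show "f a < f b" using s[of a] by simp
    qed
  qed simp
  then show ?thesis
    unfolding normal_def strict_mono_def using l by blast
qed

lemma normal_less_iff: "normal f \<Longrightarrow> f a < f b \<longleftrightarrow> a < b"
  unfolding normal_def by (simp add: strict_mono_less)

lemma normal_le_iff: "normal f \<Longrightarrow> f a \<le> f b \<longleftrightarrow> a \<le> b"
  unfolding normal_def by (simp add: strict_mono_less_eq)

lemma normal_eq_iff: "normal f \<Longrightarrow> f a = f b \<longleftrightarrow> a = b"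
  unfolding normal_def by (simp add: strict_mono_eq)

lemma normal_limit: "normal f \<Longrightarrow> olimit b \<Longrightarrow> f b = osup (f ` {..<b})"
  unfolding normal_def by blast

lemma normal_limit_le_iff: "normal f \<Longrightarrow> olimit b \<Longrightarrow> f b \<le> c \<longleftrightarrow> (\<forall>a<b. f a \<le> c)"
  by (simp add: normal_limit osup_image_le_iff)

lemma normal_limit_greater: "normal f \<Longrightarrow> olimit b \<Longrightarrow> c < f b \<Longrightarrow> \<exists>a<b. c < f a"
  using normal_limit_le_iff by (meson linorder_not_le)

lemma normal_ge: "normal f \<Longrightarrow> x \<le> f x"
proof (induction x rule: less_induct)
  case (less x)
  show ?case
  proof (rule ccontr)
    assume "\<not> x \<le> f x"
    then have *: "f x < x" by simp
    then have "f x \<le> f (f x)" using less by blast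
    then show False using * less.prems by (simp add: normal_le_iff)
  qed
qed

lemma normal_comp: "normal f \<Longrightarrow> normal g \<Longrightarrow> normal (\<lambda>x. f (g x))"
proof -
  assume f: "normal f" and g: "normal g"
  show ?thesis
  proof (rule normalI)
    show "f (g x) < f (g (osuc x))" for x
      using f g by (simp add: normal_less_iff)
  next
    fix b :: "'a ordinal" assume b: "olimit b"
    have gb: "olimit (g b)"
    proof (cases "g b" rule: ordinal_cases)
      case 1
      then have "g 0 < 0" using normal_less_iff[OF g] olimit_pos[OF b] by metis
      then show ?thesis by simp
    next
      case (2 a)
      then have "\<exists>x<b. a < g x" using normal_limit_greater[OF g b] by simp
      then obtain x where x: "x < b" "a < g x" by blast
      then have "g b \<le> g x" using 2 by (simp add: osuc_le_iff)
      then show ?thesis using x normal_le_iff[OF g] by simp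
    qed
    have "f (g b) \<le> osup ((\<lambda>x. f (g x)) ` {..<b})"
      unfolding normal_limit_le_iff[OF f gb]
    proof (intro allI impI)
      fix a assume "a < g b"
      then obtain x where x: "x < b" "a < g x"
        using normal_limit_greater[OF g b] by blast
      then have "f a \<le> f (g x)" using normal_less_iff[OF f] less_imp_le by blast
      also have "\<dots> \<le> osup ((\<lambda>x. f (g x)) ` {..<b})"
        using osup_image_upper[OF x(1), of "\<lambda>x. f (g x)"] .
      finally show "f a \<le> osup ((\<lambda>x. f (g x)) ` {..<b})" .
    qed
    moreover have "osup ((\<lambda>x. f (g x)) ` {..<b}) \<le> f (g b)"
      unfolding osup_image_le_iff using normal_le_iff[OF f] normal_le_iff[OF g] less_imp_le by blast
    ultimately show "f (g b) = osup ((\<lambda>x. f (g x)) ` {..<b})" by simp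
  qed
qed

lemma normal_osup_image_le:
  fixes f g :: "'a ordinal \<Rightarrow> 'a ordinal" and c :: "'a ordinal"
  assumes f: "normal f" and c: "0 < c" and le: "\<And>x. x < c \<Longrightarrow> f (g x) \<le> d"
  shows "f (osup (g ` {..<c})) \<le> d"
proof (cases "\<exists>x<c. osup (g ` {..<c}) = g x")
  case True
  then show ?thesis using le by auto
next
  case False
  let ?s = "osup (g ` {..<c})"
  have less: "g x < ?s" if "x < c" for x
    using osup_image_upper[OF that, of g] False that by force
  have cof: "\<exists>x<c. a < g x" if "a < ?s" for a
    using that osup_image_le_iff[of g c a] by (meson linorder_not_le)
  have "olimit ?s"
  proof (cases ?s rule: ordinal_cases)
    case 1
    then show ?thesis using less[OF c] by simp
  next
    case (2 a)
    then obtain x where "x < c" "a < g x" using cof[of a] by auto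
    then show ?thesis using less[of x] 2 by (simp add: less_osuc_iff)
  qed
  show ?thesis
    unfolding normal_limit_le_iff[OF f \<open>olimit ?s\<close>]
  proof (intro allI impI)
    fix a assume "a < ?s"
    then obtain x where x: "x < c" "a < g x" using cof by blast
    have "f a \<le> f (g x)" using x by (simp add: normal_le_iff[OF f])
    then show "f a \<le> d" using le[OF x(1)] by simp
  qed
qed

lemma orec_ge:
  assumes "\<And>x. z \<le> x \<Longrightarrow> x < s x"
  shows "z \<le> orec z s b"
proof (induction b rule: ordinal_induct)
  case (osuc a)
  then show ?case using assms[of "orec z s a"] by simp
next
  case (limit b)
  then show ?case using osup_image_upper[OF olimit_pos[OF limit(1)], of "orec z s"] by (simp add: orec_limit)
qed simp

lemma normal_orec: "(\<And>x. z \<le> x \<Longrightarrow> x < s x) \<Longrightarrow> normal (orec z s)"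
  by (rule normalI) (use orec_ge[of z s] in \<open>auto simp: orec_limit\<close>)

instantiation ordinal :: (type) "{plus, times}"
begin
definition plus_ordinal :: "'a ordinal \<Rightarrow> 'a ordinal \<Rightarrow> 'a ordinal"
  where "a + b = orec a osuc b"
definition times_ordinal :: "'a ordinal \<Rightarrow> 'a ordinal \<Rightarrow> 'a ordinal"
  where "a * b = orec 0 (\<lambda>c. c + a) b"
instance ..
end

definition omega :: "'a ordinal"
  where "omega = (LEAST b. olimit b)"

text \<open>\<open>wpow a\<close> is $\omega^a$.\<close>

definition wpow :: "'a ordinal \<Rightarrow> 'a ordinal"
  where "wpow a = orec 1 (\<lambda>c. c * omega) a"

text \<open>\<open>osub a b\<close> is the left subtraction $-a+b$; meaningful for \<open>a \<le> b\<close> only.\<close>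

definition osub :: "'a ordinal \<Rightarrow> 'a ordinal \<Rightarrow> 'a ordinal"
  where "osub a b = (THE c. a + c = b)"

text \<open>\<open>oexp a\<close> is $e(a) = -1 + \omega^a$.\<close>

definition oexp :: "'a ordinal \<Rightarrow> 'a ordinal"
  where "oexp a = osub 1 (wpow a)"

lemma normal_add: "normal (\<lambda>b. a + b)"
  unfolding plus_ordinal_def by (rule normal_orec) simp

lemma ord_add_zero [simp]: "a + 0 = (a :: 'a ordinal)"
  and ord_add_osuc [simp]: "a + osuc b = osuc (a + b)"
  by (simp_all add: plus_ordinal_def)

lemma ord_add_one: "a + 1 = osuc a"
  by (simp add: one_ordinal_def)

lemma ord_zero_add [simp]: "0 + a = (a :: 'a ordinal)"
proof (induction a rule: ordinal_induct)
  case (limit b)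
  have "0 + b \<le> b"
    using normal_limit_le_iff[OF normal_add limit(1), of 0 b] limit(2) less_imp_le by force
  moreover have "b \<le> 0 + b" by (rule normal_ge[OF normal_add])
  ultimately show ?case by simp
qed simp_all

lemma ord_add_assoc: "(a + b) + c = a + (b + c :: 'a ordinal)"
proof (induction c rule: ordinal_induct)
  case (limit c)
  have n: "normal (\<lambda>c. a + (b + c))"
    by (rule normal_comp[OF normal_add normal_add])
  have "(+) (a + b) ` {..<c} = (\<lambda>c. a + (b + c)) ` {..<c}"
    using limit(2) by auto
  then show ?case
    using normal_limit[OF normal_add limit(1), of "a + b"] normal_limit[OF n limit(1)] by simp
qed simp_all

lemma ord_le_add1: "a \<le> a + (b :: 'a ordinal)"
  by (metis normal_add normal_le_iff ord_add_zero ordinal_zero_le)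

lemma ord_le_add2: "b \<le> a + (b :: 'a ordinal)"
  by (rule normal_ge[OF normal_add])

lemma ord_add_less_iff [simp]: "a + b < a + c \<longleftrightarrow> b < (c :: 'a ordinal)"
  and ord_add_le_iff [simp]: "a + b \<le> a + c \<longleftrightarrow> b \<le> (c :: 'a ordinal)"
  and ord_add_eq_iff [simp]: "a + b = a + c \<longleftrightarrow> b = (c :: 'a ordinal)"
  by (auto simp: normal_less_iff[OF normal_add] normal_le_iff[OF normal_add] normal_eq_iff[OF normal_add])

lemma ord_add_mono1: "a \<le> b \<Longrightarrow> a + c \<le> b + (c :: 'a ordinal)"
proof (induction c rule: ordinal_induct)
  case (limit c)
  have "a + x \<le> b + c" if "x < c" for x
  proof -
    have "a + x \<le> b + x" using limit that by blast
    also have "\<dots> \<le> b + c" using that by simp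
    finally show ?thesis .
  qed
  then show ?case using normal_limit_le_iff[OF normal_add limit(1)] by blast
qed simp_all

lemma ord_le_ex_add:
  assumes "a \<le> (b :: 'a ordinal)"
  shows "\<exists>c. b = a + c"
proof -
  define c where "c = (LEAST c. b \<le> a + c)"
  have c: "b \<le> a + c"
    unfolding c_def by (rule LeastI[of _ b]) (rule ord_le_add2)
  have l: "a + d < b" if "d < c" for d
    using not_less_Least[of d "\<lambda>c. b \<le> a + c"] that c_def by auto
  have "a + c \<le> b"
  proof (cases c rule: ordinal_cases)
    case (2 d)
    then show ?thesis using l[of d] by (simp add: osuc_le_iff)
  next
    case 3
    then show ?thesis using l normal_limit_le_iff[OF normal_add 3] less_imp_le by blast
  qed (use assms in simp)
  then show ?thesis using c by auto
qed

lemma osub_add [simp]: "osub a (a + c) = c"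
  unfolding osub_def by (rule the_equality) auto

lemma ord_add_osub: "a \<le> b \<Longrightarrow> a + osub a b = b"
  using ord_le_ex_add by fastforce

lemma ex_olimit: "\<exists>b :: 'a ordinal. olimit b"
proof -
  let ?P = "\<lambda>b :: 'a ordinal. \<forall>n. (osuc ^^ n) 0 < b"
  have ex: "\<exists>b. ?P b" by (rule ordinal_range_nat_bounded)
  define b where "b = (LEAST b. ?P b)"
  have b: "?P b" unfolding b_def using ex by (rule LeastI_ex)
  have "olimit b"
  proof (cases b rule: ordinal_cases)
    case 1
    then show ?thesis using b by simp
  next
    case (2 a)
    have "?P a"
    proof
      fix n
      have "(osuc ^^ Suc n) 0 < b" using b by blast
      then show "(osuc ^^ n) 0 < a" using 2 by simp
    qed
    then have "b \<le> a" unfolding b_def by (rule Least_le)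
    then show ?thesis using 2 by (simp add: osuc_le_iff)
  qed
  then show ?thesis ..
qed

lemma olimit_omega: "olimit omega"
  unfolding omega_def using ex_olimit by (rule LeastI_ex)

lemma omega_induct [consumes 1, case_names zero osuc]:
  assumes "n < omega" "P 0" "\<And>m. m < omega \<Longrightarrow> P m \<Longrightarrow> P (osuc m)"
  shows "P n"
  using assms(1)
proof (induction n rule: less_induct)
  case (less n)
  show ?case
  proof (cases n rule: ordinal_cases)
    case (2 m)
    then show ?thesis using less assms(3) less_osuc less_trans by blast
  next
    case 3
    then have "omega \<le> n" unfolding omega_def by (rule Least_le)
    then show ?thesis using less by simp
  qed (use assms in simp)
qed

lemma normal_mult: "0 < a \<Longrightarrow> normal (\<lambda>b. a * b)"
  unfolding times_ordinal_def
  by (rule normal_orec) (metis ord_add_less_iff ord_add_zero)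

lemma ord_mult_zero [simp]: "a * 0 = (0 :: 'a ordinal)"
  and ord_mult_osuc [simp]: "a * osuc b = a * b + a"
  by (simp_all add: times_ordinal_def)

lemma ord_one_le_iff: "1 \<le> a \<longleftrightarrow> 0 < (a :: 'a ordinal)"
  by (simp add: one_ordinal_def osuc_le_iff)

lemma ord_less_one_iff [simp]: "a < 1 \<longleftrightarrow> a = (0 :: 'a ordinal)"
  by (simp add: one_ordinal_def less_osuc_iff)

lemma ord_zero_neq_one [simp]: "(0 :: 'a ordinal) \<noteq> 1" "(1 :: 'a ordinal) \<noteq> 0"
  by (simp_all add: one_ordinal_def)

lemma less_mult_omega: "0 < a \<Longrightarrow> a < a * omega"
proof -
  assume a: "0 < a"
  have "osuc 0 < omega"
    by (intro olimit_osuc_less olimit_omega olimit_pos)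
  then have "a * osuc 0 < a * omega" using a by (simp only: normal_less_iff[OF normal_mult])
  then show ?thesis by simp
qed

lemma normal_wpow: "normal wpow"
  unfolding wpow_def by (rule normal_orec) (simp add: less_mult_omega ord_one_le_iff)

lemma wpow_zero [simp]: "wpow 0 = 1"
  and wpow_osuc: "wpow (osuc a) = wpow a * omega"
  by (simp_all add: wpow_def)

lemma wpow_pos [simp]: "0 < wpow a"
  by (metis normal_le_iff normal_wpow ord_one_le_iff ordinal_zero_le wpow_zero)

lemma wpow_less_iff [simp]: "wpow a < wpow b \<longleftrightarrow> a < b"
  and wpow_le_iff [simp]: "wpow a \<le> wpow b \<longleftrightarrow> a \<le> b"
  and wpow_eq_iff [simp]: "wpow a = wpow b \<longleftrightarrow> a = b"
  by (simp_all add: normal_less_iff normal_le_iff normal_eq_iff normal_wpow)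

lemma wpow_neq_zero [simp]: "wpow a \<noteq> 0" "0 \<noteq> wpow a"
  by (metis ordinal_pos_iff wpow_pos)+

lemma wpow_eq_one_iff [simp]: "wpow a = 1 \<longleftrightarrow> a = 0"
  by (metis wpow_eq_iff wpow_zero)

lemma add_wpow: "a < wpow r \<Longrightarrow> a + wpow r = wpow r"
proof (induction r arbitrary: a rule: ordinal_induct)
  case (osuc r)
  let ?w = "wpow r"
  have n: "normal (\<lambda>b. ?w * b)" by (simp add: normal_mult)
  have step: "c + ?w < ?w * omega" if c: "c < ?w * omega" for c
  proof -
    obtain k where k: "k < omega" "c < ?w * k"
      using normal_limit_greater[OF n olimit_omega c] by blast
    have "c + ?w \<le> ?w * k + ?w" using k by (intro ord_add_mono1) simp
    also have "\<dots> = ?w * osuc k" by simp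
    also have "\<dots> < ?w * omega"
      using olimit_osuc_less[OF olimit_omega k(1)] by (simp only: normal_less_iff[OF n])
    finally show ?thesis .
  qed
  have "a + ?w * m < ?w * omega" if "m < omega" for m
    using that by (induction rule: omega_induct)
      (use step osuc.prems in \<open>simp_all add: wpow_osuc flip: ord_add_assoc\<close>)
  then have "a + ?w * omega \<le> ?w * omega"
    using normal_limit_le_iff[OF normal_comp[OF normal_add n] olimit_omega] less_imp_le by blast
  then show ?case by (simp add: wpow_osuc ord_le_add2 order.eq_iff)
next
  case (limit r)
  obtain s where s: "s < r" "a < wpow s"
    using normal_limit_greater[OF normal_wpow limit(1,3)] by blast
  have "a + wpow t \<le> wpow r" if t: "t < r" for t
  proof -
    have "a + wpow t \<le> a + wpow (max s t)" by simp
    also have "\<dots> = wpow (max s t)"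
      using s t limit(2) by (metis max_def less_le_trans max.cobounded1 wpow_le_iff)
    also have "\<dots> \<le> wpow r" using s t by (simp add: less_imp_le)
    finally show ?thesis .
  qed
  then have "a + wpow r \<le> wpow r"
    using normal_limit_le_iff[OF normal_comp[OF normal_add normal_wpow] limit(1)] by blast
  then show ?case by (simp add: ord_le_add2 order.eq_iff)
qed simp

lemma ex_leading:
  assumes "0 < a"
  shows "\<exists>r x. a = wpow r + x \<and> x < a \<and> a < wpow (osuc r)"
proof -
  define s where "s = (LEAST s. a < wpow s)"
  have "a < wpow (osuc a)"
    using normal_ge[OF normal_wpow, of "osuc a"] less_osuc less_le_trans by blast
  then have s: "a < wpow s" unfolding s_def by (rule LeastI)
  have l: "wpow t \<le> a" if "t < s" for t
    using not_less_Least[of t "\<lambda>s. a < wpow s"] that s_def by auto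
  consider r where "s = osuc r"
  proof (cases s rule: ordinal_cases)
    case 1
    then show ?thesis using s assms by simp
  next
    case 3
    then show ?thesis using normal_limit_greater[OF normal_wpow 3 s] l by (meson linorder_not_le)
  qed
  then obtain r where r: "s = osuc r" by blast
  obtain x where x: "a = wpow r + x"
    using ord_le_ex_add[OF l[of r]] r by auto
  have "x \<noteq> a"
  proof
    assume xa: "x = a"
    have wa: "wpow r + a = a" using x xa by simp
    have "wpow r * n + a = a" if "n < omega" for n
      using that by (induction rule: omega_induct) (simp_all add: ord_add_assoc wa)
    then have "wpow r * n \<le> a" if "n < omega" for n
      using that ord_le_add1[of "wpow r * n" a] by simp
    then have "wpow r * omega \<le> a"
      using normal_limit_le_iff[OF normal_mult olimit_omega] wpow_pos by blast
    then show False using s r by (simp add: wpow_osuc)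
  qed
  then have "x < a" using x ord_le_add2[of x "wpow r"] by simp
  then show ?thesis using x s r by blast
qed

lemma leading_unique_aux:
  assumes "wpow r + x = wpow r' + x'" "x < wpow r + x" "r < r'"
  shows False
proof -
  have "wpow r + (wpow r' + x') = wpow r' + x'"
    using assms(3) by (simp add: add_wpow flip: ord_add_assoc)
  then show False using assms by (metis less_irrefl ord_add_eq_iff)
qed

lemma leading_unique:
  assumes "wpow r + x = wpow r' + x'" "x < wpow r + x" "x' < wpow r' + x'"
  shows "r = r'" "x = x'"
proof -
  show "r = r'"
    using leading_unique_aux[OF assms(1,2)] leading_unique_aux[OF assms(1)[symmetric] assms(3)]
    by (meson linorder_neqE)
  then show "x = x'" using assms(1) by simp
qed

lemma ex_last:
  assumes "0 < a"
  shows "\<exists>b g. a = b + wpow g"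
proof -
  let ?P = "\<lambda>c. 0 < c \<and> (\<exists>b. a = b + c)"
  have "?P a" using assms by (metis ord_zero_add)
  define c where "c = (LEAST c. ?P c)"
  have c: "?P c" unfolding c_def by (rule LeastI[of ?P, OF \<open>?P a\<close>])
  obtain r x where rx: "c = wpow r + x" "x < c" using ex_leading c by blast
  have "x = 0"
  proof (rule ccontr)
    assume "x \<noteq> 0"
    then have "?P x" using c rx by (metis ord_add_assoc ordinal_pos_iff)
    then have "c \<le> x" unfolding c_def by (rule Least_le)
    then show False using rx by simp
  qed
  then show ?thesis using c rx by auto
qed

lemma last_unique_aux:
  assumes "b + wpow g = b' + wpow g'" "b \<le> b'"
  shows "g = g'"
proof -
  obtain d where d: "b' = b + d" using ord_le_ex_add assms(2) by blast
  then have e: "wpow g = d + wpow g'" using assms(1) by (simp add: ord_add_assoc)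
  have "d < wpow g" using e by (metis ord_add_less_iff ord_add_zero wpow_pos)
  then show ?thesis using e by (metis add_wpow ord_add_eq_iff wpow_eq_iff)
qed

lemma last_unique: "b + wpow g = b' + wpow g' \<Longrightarrow> g = g'"
  by (metis last_unique_aux linorder_linear)

lemma oexp_zero [simp]: "oexp 0 = 0"
  using osub_add[of "1" "0"] by (simp add: oexp_def)

lemma oexp_pos: "0 < a \<Longrightarrow> oexp a = wpow a"
  using osub_add[of "1" "wpow a"] add_wpow[of 1 a]
  by (metis oexp_def wpow_less_iff wpow_zero)

lemma normal_oexp: "normal oexp"
proof (rule normalI)
  show "oexp x < oexp (osuc x)" for x :: "'a ordinal"
    by (cases "x = 0") (simp_all add: oexp_pos ordinal_pos_iff)
next
  fix b :: "'a ordinal" assume b: "olimit b"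
  have "wpow b \<le> osup (oexp ` {..<b})"
    unfolding normal_limit_le_iff[OF normal_wpow b]
  proof (intro allI impI)
    fix a assume "a < b"
    then have "osuc a < b" using b olimit_osuc_less by blast
    have "wpow a \<le> oexp (osuc a)" by (simp add: oexp_pos ordinal_pos_iff less_imp_le)
    also have "\<dots> \<le> osup (oexp ` {..<b})" by (rule osup_image_upper) fact
    finally show "wpow a \<le> osup (oexp ` {..<b})" .
  qed
  moreover have "osup (oexp ` {..<b}) \<le> wpow b"
    unfolding osup_image_le_iff
  proof (intro allI impI)
    fix a assume "a < b"
    then show "oexp a \<le> wpow b"
      by (cases "a = 0") (simp_all add: oexp_pos ordinal_pos_iff)
  qed
  ultimately show "oexp b = osup (oexp ` {..<b})"
    using b by (simp add: oexp_pos olimit_pos)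
qed

section \<open>Hyperexponentials\<close>

text \<open>
  $\lim_{z \to c} f(z)$. It is applied to nondecreasing families only, for which the limit is
  the supremum.
\<close>

definition olim :: "'a ordinal \<Rightarrow> ('a ordinal \<Rightarrow> 'a ordinal) \<Rightarrow> 'a ordinal"
  where "olim c f = osup (f ` {..<c})"

definition is_hyperexp :: "('a ordinal \<Rightarrow> 'a ordinal \<Rightarrow> 'a ordinal) \<Rightarrow> bool"
  where "is_hyperexp E \<longleftrightarrow>
    (\<forall>x. E 0 x = x) \<and>
    (\<forall>a. E a 0 = 0) \<and>
    E 1 = oexp \<and>
    (\<forall>r a. a < wpow r + a \<longrightarrow> E (wpow r + a) = E (wpow r) \<circ> E a) \<and>
    (\<forall>r x. 0 < r \<longrightarrow> E (wpow r) (x + 1) = olim (wpow r) (\<lambda>z. E z (E (wpow r) x + 1))) \<and>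
    (\<forall>r x. 0 < r \<and> olimit x \<longrightarrow> E (wpow r) x = olim x (\<lambda>z. E (wpow r) z))"

text \<open>Existence and uniqueness of the hyperexponentials.\<close>

definition lead :: "'a ordinal \<Rightarrow> 'a ordinal \<times> 'a ordinal"
  where "lead a = (SOME p. a = wpow (fst p) + snd p \<and> snd p < a)"

lemma lead: "0 < a \<Longrightarrow> a = wpow (fst (lead a)) + snd (lead a)" "0 < a \<Longrightarrow> snd (lead a) < a"
proof -
  assume "0 < a"
  then obtain r x where "a = wpow r + x" "x < a" using ex_leading by blast
  then have "\<exists>p. a = wpow (fst p) + snd p \<and> snd p < a"
    by (intro exI[of _ "(r, x)"]) simp
  from someI_ex[OF this] show "a = wpow (fst (lead a)) + snd (lead a)" "snd (lead a) < a"
    unfolding lead_def by blast+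
qed

lemma lead_eq:
  assumes "x < wpow r + x"
  shows "lead (wpow r + x) = (r, x)"
proof -
  let ?a = "wpow r + x"
  have p: "0 < ?a" using assms by (auto simp: ordinal_pos_iff)
  show ?thesis
    using leading_unique[OF lead(1)[OF p] assms] lead[OF p] by (metis prod.collapse)
qed

lemma lead_wpow [simp]: "lead (wpow r) = (r, 0)"
  using lead_eq[of 0 r] by simp

function hexp_rec :: "'a ordinal \<Rightarrow> 'a ordinal \<Rightarrow> 'a ordinal" where
  "hexp_rec a x =
    (if a = 0 then x else if x = 0 then 0 else if a = 1 then oexp x
     else if 0 < snd (lead a) then hexp_rec (wpow (fst (lead a))) (hexp_rec (snd (lead a)) x)
     else if \<exists>y. x = osuc y then
       osup ((\<lambda>z. hexp_rec z (osuc (hexp_rec a (THE y. x = osuc y)))) ` {..<a})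
     else osup (hexp_rec a ` {..<x}))"
  by auto
termination
proof (relation "{(u :: 'a ordinal, v). u < v} <*lex*> {(u :: 'a ordinal, v). u < v}")
  show "wf ({(u :: 'a ordinal, v). u < v} <*lex*> {(u :: 'a ordinal, v). u < v})"
    by (intro wf_lex_prod wf)
next
  fix a x :: "'a ordinal"
  assume a: "a \<noteq> 0" "0 < snd (lead a)"
  then have "wpow (fst (lead a)) < wpow (fst (lead a)) + snd (lead a)"
    by (metis ord_add_less_iff ord_add_zero)
  then have "wpow (fst (lead a)) < a"
    using lead(1)[of a] a(1) by (metis ordinal_pos_iff)
  then show "\<And>u. ((wpow (fst (lead a)), u), a, x)
      \<in> {(u, v). u < v} <*lex*> {(u, v). u < v}" by simp
qed (auto simp: ordinal_pos_iff lead(2))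

declare hexp_rec.simps [simp del]

lemma hexp_rec_is_hyperexp: "is_hyperexp hexp_rec"
proof -
  have z: "hexp_rec 0 x = x" for x by (simp add: hexp_rec.simps)
  have z': "hexp_rec a 0 = 0" for a by (simp add: hexp_rec.simps)
  have one: "hexp_rec 1 = oexp" by (rule ext) (simp add: hexp_rec.simps[of 1])
  have comp: "hexp_rec (wpow r + a) = hexp_rec (wpow r) \<circ> hexp_rec a" if "a < wpow r + a" for r a
  proof (cases "a = 0")
    case True
    then show ?thesis by (simp add: fun_eq_iff z)
  next
    case False
    have n0: "wpow r + a \<noteq> 0" using that by auto
    have n1: "wpow r + a \<noteq> 1"
    proof
      assume "wpow r + a = 1"
      then have "a < 1" using that by simp
      then show False using False by simp
    qed
    have "hexp_rec (wpow r + a) x = hexp_rec (wpow r) (hexp_rec a x)" for x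
    proof (cases "x = 0")
      case False
      then show ?thesis
        using \<open>a \<noteq> 0\<close> n0 n1 by (subst hexp_rec.simps) (simp add: lead_eq[OF that] ordinal_pos_iff)
    qed (simp add: z')
    then show ?thesis by (simp add: fun_eq_iff)
  qed
  have suc: "hexp_rec (wpow r) (x + 1) = olim (wpow r) (\<lambda>z. hexp_rec z (hexp_rec (wpow r) x + 1))"
    if "0 < r" for r x
    using that by (subst hexp_rec.simps) (auto simp: olim_def ord_add_one ordinal_pos_iff)
  have lim: "hexp_rec (wpow r) x = olim x (\<lambda>z. hexp_rec (wpow r) z)"
    if "0 < r" "olimit x" for r x
    using that by (subst hexp_rec.simps) (auto simp: olim_def ordinal_pos_iff olimit_def)
  show ?thesis
    unfolding is_hyperexp_def using z z' one comp suc lim by blast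
qed

context
  fixes E :: "'a ordinal \<Rightarrow> 'a ordinal \<Rightarrow> 'a ordinal"
  assumes E: "is_hyperexp E"
begin

lemma E0 [simp]: "E 0 x = x" and Ez [simp]: "E a 0 = 0" and E1: "E 1 = oexp"
  and Ecomp: "a < wpow r + a \<Longrightarrow> E (wpow r + a) x = E (wpow r) (E a x)"
  and Esuc: "0 < r \<Longrightarrow> E (wpow r) (osuc x) = osup ((\<lambda>z. E z (osuc (E (wpow r) x))) ` {..<wpow r})"
  and Elim: "0 < r \<Longrightarrow> olimit x \<Longrightarrow> E (wpow r) x = osup (E (wpow r) ` {..<x})"
  using E unfolding is_hyperexp_def olim_def ord_add_one by auto

lemma E_lead: "0 < a \<Longrightarrow> E a x = E (wpow (fst (lead a))) (E (snd (lead a)) x)"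
  using Ecomp[of "snd (lead a)" "fst (lead a)" x] lead[of a] by metis

lemma normal_E_wpow: "normal (E (wpow r))"
proof (cases "r = 0")
  case True
  then show ?thesis by (simp add: E1 normal_oexp)
next
  case False
  then have r: "0 < r" by (simp add: ordinal_pos_iff)
  show ?thesis
  proof (rule normalI)
    fix x
    have "E 0 (osuc (E (wpow r) x)) \<le> E (wpow r) (osuc x)"
      unfolding Esuc[OF r] by (rule osup_image_upper) simp
    then show "E (wpow r) x < E (wpow r) (osuc x)"
      by (simp add: osuc_le_iff)
  qed (rule Elim[OF r])
qed

lemma normal_E: "normal (E a)"
proof (induction a rule: less_induct)
  case (less a)
  show ?case
  proof (cases "a = 0")
    case True
    have "normal (\<lambda>x :: 'a ordinal. 0 + x)" by (rule normal_add)
    moreover have "E a = (\<lambda>x. 0 + x)" by (rule ext) (simp add: True)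
    ultimately show ?thesis by simp
  next
    case False
    then have a: "0 < a" by (simp add: ordinal_pos_iff)
    obtain r b where rb: "fst (lead a) = r" "snd (lead a) = b" by blast
    have "E a = (\<lambda>x. E (wpow r) (E b x))"
      by (rule ext) (rule E_lead[OF a, unfolded rb])
    then show ?thesis
      using normal_comp[OF normal_E_wpow less(1)[OF lead(2)[OF a]]] by (simp only: rb)
  qed
qed

lemma E_pos [simp]: "0 < E a x \<longleftrightarrow> 0 < x"
  using normal_less_iff[OF normal_E, of a 0 x] by simp

lemma E_add_aux:
  assumes "\<And>s x. s < r \<Longrightarrow> d < s \<Longrightarrow> E (wpow d) (E (wpow s) x) = E (wpow s) x" "z < wpow r"
  shows "E (wpow d + z) x = E (wpow d) (E z x)"
proof (cases "z < wpow d + z")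
  case True
  then show ?thesis by (rule Ecomp)
next
  case False
  then have eq: "wpow d + z = z" using ord_le_add2[of z "wpow d"] by simp
  then have "0 < z" using False by (metis ordinal_pos_iff ord_add_zero wpow_pos)
  then obtain s y where sy: "z = wpow s + y" "y < z" "z < wpow (osuc s)"
    using ex_leading by blast
  have "d < s"
  proof (rule ccontr)
    assume "\<not> d < s"
    then consider "s < d" | "s = d" by fastforce
    then show False
    proof cases
      case 1
      then have "wpow (osuc s) \<le> wpow d" by (simp add: osuc_le_iff)
      also have "\<dots> \<le> z" using eq ord_le_add1 by metis
      finally show False using sy by simp
    next
      case 2
      then have "y = z" using eq sy(1) by (metis ord_add_eq_iff)
      then show False using sy by simp
    qed
  qed
  have "wpow s \<le> z" using sy(1) ord_le_add1 by metis
  then have "wpow s < wpow r" using assms(2) by (rule order.strict_trans1)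
  then have "E (wpow d) (E (wpow s) (E y x)) = E (wpow s) (E y x)"
    using \<open>d < s\<close> by (intro assms(1)) simp_all
  moreover have "E z x = E (wpow s) (E y x)" using Ecomp[of y s x] sy by simp
  ultimately show ?thesis using eq by simp
qed

lemma E_absorb: "d < r \<Longrightarrow> E (wpow d) (E (wpow r) x) = E (wpow r) x"
proof (induction r arbitrary: x rule: less_induct)
  case (less r)
  have r: "0 < r" using less.prems by (auto simp: ordinal_pos_iff)
  note n = normal_E[of "wpow d"]
  show ?case
  proof (induction x rule: ordinal_induct)
    case (osuc x)
    let ?g = "\<lambda>z. E z (osuc (E (wpow r) x))"
    have "E (wpow d) (osup (?g ` {..<wpow r})) \<le> osup (?g ` {..<wpow r})"
    proof (rule normal_osup_image_le[OF n])
      fix z assume z: "z < wpow r"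
      have "E (wpow d) (?g z) = ?g (wpow d + z)"
        by (rule E_add_aux[symmetric, where r = r]) (use less.IH z in auto)
      moreover have "wpow d + z < wpow r"
        using z less.prems add_wpow[of "wpow d" r] by (metis ord_add_less_iff wpow_less_iff)
      ultimately show "E (wpow d) (?g z) \<le> osup (?g ` {..<wpow r})"
        using osup_image_upper[of "wpow d + z" "wpow r" ?g] by simp
    qed simp
    then show ?case
      using normal_ge[OF n] by (simp add: Esuc[OF r] order.eq_iff)
  next
    case (limit b)
    have "E (wpow d) (E (wpow r) b) \<le> E (wpow r) b"
      unfolding normal_limit_le_iff[OF normal_comp[OF n normal_E] limit(1)]
      using limit(2) by (simp add: normal_le_iff[OF normal_E] less_imp_le)
    then show ?case using normal_ge[OF n] by (simp add: order.eq_iff)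
  qed simp
qed

lemma E_fixed:
  assumes "\<And>d. d < r \<Longrightarrow> E (wpow d) y = y" "z < wpow r"
  shows "E z y = y"
  using assms(2)
proof (induction z rule: less_induct)
  case (less z)
  show ?case
  proof (cases "z = 0")
    case False
    then have z: "0 < z" by (simp add: ordinal_pos_iff)
    have "wpow (fst (lead z)) < wpow r"
      using lead(1)[OF z] ord_le_add1 less.prems by (metis order.strict_trans1)
    then have "E (wpow (fst (lead z))) y = y" by (intro assms(1)) simp
    moreover have "E (snd (lead z)) y = y"
      using less lead(2)[OF z] by auto
    ultimately show ?thesis using E_lead[OF z, of y] by metis
  qed simp
qed

lemma E_range:
  assumes "0 < r" and fx: "\<And>d. d < r \<Longrightarrow> E (wpow d) y = y"
  shows "\<exists>x. y = E (wpow r) x"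
proof -
  note n = normal_E[of "wpow r"]
  define x where "x = (LEAST x. y \<le> E (wpow r) x)"
  have x: "y \<le> E (wpow r) x"
    unfolding x_def by (rule LeastI[of _ y]) (rule normal_ge[OF n])
  have l: "E (wpow r) u < y" if "u < x" for u
    using not_less_Least[of u "\<lambda>x. y \<le> E (wpow r) x"] that x_def by auto
  have "E (wpow r) x \<le> y"
  proof (cases x rule: ordinal_cases)
    case (2 u)
    have "E z (osuc (E (wpow r) u)) \<le> y" if "z < wpow r" for z
    proof -
      have "E z (osuc (E (wpow r) u)) \<le> E z y"
        using l[of u] 2 by (simp add: normal_le_iff[OF normal_E] osuc_le_iff)
      also have "E z y = y" by (rule E_fixed[OF fx that])
      finally show ?thesis .
    qed
    then show ?thesis using 2 by (simp add: Esuc[OF assms(1)] osup_image_le_iff)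
  next
    case 3
    then show ?thesis using l normal_limit_le_iff[OF n 3] less_imp_le by blast
  qed (use x in simp)
  then show ?thesis using x by auto
qed

lemma E_wpow_cases:
  assumes "0 < g"
  shows "(\<exists>x. wpow g = E (wpow r) x) \<or> (\<exists>x<wpow g. \<exists>d<r. wpow g = E (wpow d) x)"
proof -
  have rng: "\<exists>x. wpow g = E (wpow s) x" if "\<And>d. d < s \<Longrightarrow> E (wpow d) (wpow g) = wpow g" for s
  proof (cases "s = 0")
    case True
    then show ?thesis using assms by (metis E1 oexp_pos wpow_zero)
  next
    case False
    then show ?thesis using E_range that by (simp add: ordinal_pos_iff)
  qed
  show ?thesis
  proof (cases "\<exists>d<r. E (wpow d) (wpow g) \<noteq> wpow g")
    case True
    define d where "d = (LEAST d. E (wpow d) (wpow g) \<noteq> wpow g)"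
    have d: "E (wpow d) (wpow g) \<noteq> wpow g"
      using True unfolding d_def by (metis (mono_tags, lifting) LeastI)
    have "d < r"
      using True unfolding d_def by (metis (mono_tags, lifting) Least_le order.strict_trans1)
    have "E (wpow c) (wpow g) = wpow g" if "c < d" for c
      using not_less_Least[of c "\<lambda>d. E (wpow d) (wpow g) \<noteq> wpow g"] that d_def by auto
    then obtain x where x: "wpow g = E (wpow d) x" using rng by blast
    then have "x < wpow g"
      using normal_ge[OF normal_E, of x "wpow d"] d by (metis le_less)
    then show ?thesis using x \<open>d < r\<close> by blast
  next
    case False
    then show ?thesis using rng by blast
  qed
qed

lemma E_wpow_is_wpow:
  assumes "0 < x"
  shows "\<exists>g>0. E (wpow d) x = wpow g"
proof (cases "d = 0")
  case True
  then show ?thesis using assms by (auto simp: E1 oexp_pos)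
next
  case False
  then have "E (wpow d) x = E (wpow 0) (E (wpow d) x)"
    by (intro E_absorb[symmetric]) (simp add: ordinal_pos_iff)
  also have "\<dots> = wpow (E (wpow d) x)" using assms by (simp add: E1 oexp_pos)
  finally show ?thesis using assms by (metis E_pos)
qed

end

lemma is_hyperexp_unique:
  assumes E: "is_hyperexp E" and F: "is_hyperexp F"
  shows "E = F"
proof -
  have "E a x = F a x" for a x
  proof (induction a arbitrary: x rule: less_induct)
    case (less a)
    note IHa = less
    show ?case
    proof (cases "a = 0")
      case True
      then show ?thesis by (simp add: E0[OF E] E0[OF F])
    next
      case False
      then have a: "0 < a" by (simp add: ordinal_pos_iff)
      obtain r b where rb: "fst (lead a) = r" "snd (lead a) = b" by blast
      have arb: "a = wpow r + b" "b < a" using lead[OF a] rb by auto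
      show ?thesis
      proof (cases "b = 0")
        case False
        have "wpow r < wpow r + b" using False by (metis ord_add_less_iff ord_add_zero ordinal_pos_iff)
        then have "wpow r < a" using arb by simp
        then show ?thesis
          using E_lead[OF E a, of x] E_lead[OF F a, of x] IHa arb(2) by (simp add: rb)
      next
        case True
        then have ar: "a = wpow r" using arb by simp
        show ?thesis
        proof (cases "r = 0")
          case True
          then show ?thesis using ar by (simp add: E1[OF E] E1[OF F])
        next
          case False
          then have r: "0 < r" by (simp add: ordinal_pos_iff)
          show ?thesis
          proof (induction x rule: ordinal_induct)
            case zero
            then show ?case by (simp add: Ez[OF E] Ez[OF F])
          next
            case (osuc y)
            have "(\<lambda>z. E z (osuc (E a y))) ` {..<a} = (\<lambda>z. F z (osuc (F a y))) ` {..<a}"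
              using IHa osuc by (intro image_cong) auto
            then show ?case by (simp add: ar Esuc[OF E r] Esuc[OF F r])
          next
            case (limit y)
            then have "E a ` {..<y} = F a ` {..<y}" by (intro image_cong) auto
            then show ?case by (simp add: ar Elim[OF E r limit(1)] Elim[OF F r limit(1)])
          qed
        qed
      qed
    qed
  qed
  then show ?thesis by (simp add: fun_eq_iff)
qed

lemma ex1_hyperexp: "\<exists>!E. is_hyperexp E"
  using hexp_rec_is_hyperexp is_hyperexp_unique by blast

definition hyperexp :: "'a ordinal \<Rightarrow> 'a ordinal \<Rightarrow> 'a ordinal"
  where "hyperexp = (THE E. is_hyperexp E)"

lemma is_hyperexp_hyperexp: "is_hyperexp hyperexp"
  unfolding hyperexp_def using ex1_hyperexp by (rule theI')

section \<open>Hyperlogarithms\<close>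

definition is_hyperlog :: "('a ordinal \<Rightarrow> 'a ordinal \<Rightarrow> 'a ordinal) \<Rightarrow> bool"
  where "is_hyperlog L \<longleftrightarrow>
    (\<forall>a. L 0 a = a) \<and>
    (\<forall>x. L x 0 = 0) \<and>
    (\<forall>x a b. 0 < x \<and> 0 < b \<longrightarrow> L x (a + b) = L x b) \<and>
    (\<forall>x. 0 < x \<longrightarrow> L x 1 = 0) \<and>
    (\<forall>r x. x < wpow r + x \<longrightarrow> L (wpow r + x) = L x \<circ> L (wpow r)) \<and>
    (\<forall>r d x. L (wpow r) (hyperexp (wpow d) x) =
      (if d < r then L (wpow r) x else if d = r then x else hyperexp (wpow d) x))"

text \<open>
  Existence and uniqueness of the hyperlogarithms; \<open>olast a\<close> is the last term of the Cantor
  normal form of \<open>a\<close>.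
\<close>

definition olast :: "'a ordinal \<Rightarrow> 'a ordinal"
  where "olast a = (THE w. \<exists>b g. w = wpow g \<and> a = b + w)"

lemma olast_eq: "olast (b + wpow g) = wpow g"
  unfolding olast_def by (rule the_equality) (auto dest: last_unique)

lemma olast_wpow [simp]: "olast (wpow g) = wpow g"
  using olast_eq[of 0 g] by simp

lemma olast_le: "0 < a \<Longrightarrow> olast a \<le> a"
  using ex_last[of a] by (auto simp: olast_eq ord_le_add2)

lemma olast_add: "0 < b \<Longrightarrow> olast (a + b) = olast b"
  using ex_last[of b] by (auto simp: olast_eq simp flip: ord_add_assoc)

function hlog_rec :: "'a ordinal \<Rightarrow> 'a ordinal \<Rightarrow> 'a ordinal" where
  "hlog_rec r a =
    (if a = 0 \<or> olast a = 1 then 0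
     else if \<exists>x. olast a = hyperexp (wpow r) x then (THE x. olast a = hyperexp (wpow r) x)
     else if \<exists>x<olast a. \<exists>d<r. olast a = hyperexp (wpow d) x
       then hlog_rec r (SOME x. x < olast a \<and> (\<exists>d<r. olast a = hyperexp (wpow d) x))
     else 0)"
  by auto
termination
proof (relation "inv_image {(u :: 'a ordinal, v). u < v} snd")
  show "wf (inv_image {(u :: 'a ordinal, v). u < v} (snd :: 'a ordinal \<times> 'a ordinal \<Rightarrow> 'a ordinal))"
    by (rule wf_inv_image) (rule wf)
next
  fix r a :: "'a ordinal"
  let ?P = "\<lambda>x. x < olast a \<and> (\<exists>d<r. olast a = hyperexp (wpow d) x)"
  assume a: "\<not> (a = 0 \<or> olast a = 1)" and ex: "\<exists>x<olast a. \<exists>d<r. olast a = hyperexp (wpow d) x"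
  have "?P (SOME x. ?P x)" using ex by (rule someI_ex)
  moreover have "olast a \<le> a" using a by (simp add: olast_le ordinal_pos_iff)
  ultimately have "(SOME x. ?P x) < a" by (blast intro: order.strict_trans2)
  then show "((r, SOME x. ?P x), r, a) \<in> inv_image {(u, v). u < v} snd"
    by simp
qed

declare hlog_rec.simps [simp del]

lemma hlog_rec_zero [simp]: "hlog_rec r 0 = 0"
  by (subst hlog_rec.simps) simp

lemma hlog_rec_one [simp]: fixes r :: "'a ordinal" shows "hlog_rec r 1 = 0"
  using olast_wpow[of "0 :: 'a ordinal"] by (subst hlog_rec.simps) simp

lemma hlog_rec_add: "0 < b \<Longrightarrow> hlog_rec r (a + b) = hlog_rec r b"
proof -
  assume b: "0 < b"
  then have "a + b \<noteq> 0" "b \<noteq> 0" using ord_le_add2[of b a] by (auto simp: ordinal_pos_iff)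
  then show ?thesis
    by (auto simp: hlog_rec.simps[of r "a + b"] hlog_rec.simps[of r b] olast_add[OF b])
qed

lemmas hx_absorb = E_absorb[OF is_hyperexp_hyperexp]
  and hx_inj = normal_eq_iff[OF normal_E[OF is_hyperexp_hyperexp]]

lemma hlog_rec_same: "hlog_rec r (hyperexp (wpow r) x) = x"
proof (cases "x = 0")
  case True
  then show ?thesis by (simp add: Ez[OF is_hyperexp_hyperexp])
next
  case False
  then obtain g where g: "0 < g" "hyperexp (wpow r) x = wpow g"
    using E_wpow_is_wpow[OF is_hyperexp_hyperexp, of x r] by (auto simp: ordinal_pos_iff)
  have "\<exists>x'. wpow g = hyperexp (wpow r) x'" using g(2)[symmetric] by blast
  then have "hlog_rec r (wpow g) = (THE x'. wpow g = hyperexp (wpow r) x')"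
    using g(1) by (subst hlog_rec.simps) (simp add: ordinal_pos_iff)
  also have "\<dots> = x" by (simp add: hx_inj flip: g(2))
  finally show ?thesis using g by simp
qed

lemma hlog_rec_greater: "r < d \<Longrightarrow> hlog_rec r (hyperexp (wpow d) x) = hyperexp (wpow d) x"
  using hlog_rec_same[of r "hyperexp (wpow d) x"] by (simp add: hx_absorb)

lemma hlog_rec_less:
  assumes "d < r"
  shows "hlog_rec r (hyperexp (wpow d) x) = hlog_rec r x"
proof (cases "x = 0")
  case True
  then show ?thesis by (simp add: Ez[OF is_hyperexp_hyperexp])
next
  case False
  then obtain g where g: "0 < g" "hyperexp (wpow d) x = wpow g"
    using E_wpow_is_wpow[OF is_hyperexp_hyperexp, of x d] by (auto simp: ordinal_pos_iff)
  show ?thesis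
  proof (cases "\<exists>y. wpow g = hyperexp (wpow r) y")
    case True
    then obtain y where "wpow g = hyperexp (wpow r) y" by blast
    then have "hyperexp (wpow d) x = hyperexp (wpow d) (hyperexp (wpow r) y)"
      using g assms by (simp add: hx_absorb)
    then have "x = hyperexp (wpow r) y" by (simp add: hx_inj)
    then show ?thesis using assms by (simp add: hx_absorb)
  next
    case nr: False
    let ?P = "\<lambda>y. y < wpow g \<and> (\<exists>d<r. wpow g = hyperexp (wpow d) y)"
    have ex: "\<exists>y. ?P y" using E_wpow_cases[OF is_hyperexp_hyperexp g(1), of r] nr by blast
    define y where "y = (SOME y. ?P y)"
    have "?P y" unfolding y_def using ex by (rule someI_ex)
    then obtain c where y: "y < wpow g" "c < r" "wpow g = hyperexp (wpow c) y" by blast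
    have e: "hlog_rec r (wpow g) = hlog_rec r y"
      using g(1) nr ex by (subst hlog_rec.simps) (simp add: ordinal_pos_iff y_def)
    consider "c = d" | "d < c" | "c < d" by fastforce
    then have "x = y \<or> x = wpow g"
    proof cases
      case 1
      then show ?thesis using y g by (metis hx_inj)
    next
      case 2
      then have "hyperexp (wpow d) x = hyperexp (wpow d) (wpow g)"
        using y g by (simp add: hx_absorb)
      then show ?thesis by (simp add: hx_inj)
    next
      case 3
      then have "hyperexp (wpow c) y = hyperexp (wpow c) (wpow g)"
        using y g by (metis hx_absorb)
      then show ?thesis using y(1) by (simp add: hx_inj)
    qed
    then show ?thesis using e g by auto
  qed
qed

function hlog :: "'a ordinal \<Rightarrow> 'a ordinal \<Rightarrow> 'a ordinal" where
  "hlog x a = (if x = 0 then a else hlog (snd (lead x)) (hlog_rec (fst (lead x)) a))"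
  by auto
termination
proof (relation "inv_image {(u :: 'a ordinal, v). u < v} fst")
  show "wf (inv_image {(u :: 'a ordinal, v). u < v} (fst :: 'a ordinal \<times> 'a ordinal \<Rightarrow> 'a ordinal))"
    by (rule wf_inv_image) (rule wf)
qed (simp add: lead(2) ordinal_pos_iff)

declare hlog.simps [simp del]

lemma hlog_zero [simp]: "hlog 0 a = a"
  by (subst hlog.simps) simp

lemma hlog_wpow [simp]: "hlog (wpow r) a = hlog_rec r a"
  by (subst hlog.simps) simp

lemma hlog_is_hyperlog: "is_hyperlog hlog"
proof -
  have z: "hlog x 0 = 0" for x :: "'a ordinal"
    by (induction x rule: less_induct) (subst hlog.simps, simp add: lead(2) ordinal_pos_iff)
  have add: "hlog x (a + b) = hlog x b" if "0 < x" "0 < b" for x a b :: "'a ordinal"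
    using that by (auto simp: hlog.simps[of x] hlog_rec_add)
  have one: "hlog x 1 = 0" if "0 < x" for x :: "'a ordinal"
    using that z by (auto simp: hlog.simps[of x])
  have comp: "hlog (wpow r + x) = hlog x \<circ> hlog (wpow r)" if "x < wpow r + x" for r x :: "'a ordinal"
  proof -
    have "wpow r + x \<noteq> 0" using that by auto
    then show ?thesis by (auto simp: fun_eq_iff hlog.simps[of "wpow r + x"] lead_eq[OF that])
  qed
  show ?thesis
    unfolding is_hyperlog_def
    using z add one comp by (auto simp: hlog_rec_less hlog_rec_same hlog_rec_greater)
qed

lemma is_hyperlog_unique:
  assumes L: "is_hyperlog L" and M: "is_hyperlog M"
  shows "L = M"
proof -
  have w: "L (wpow r) a = M (wpow r) a" for r a
  proof (induction a rule: less_induct)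
    case (less a)
    show ?case
    proof (cases "a = 0")
      case True
      then show ?thesis using L M by (simp add: is_hyperlog_def)
    next
      case False
      then obtain b g where bg: "a = b + wpow g" using ex_last[of a] ordinal_pos_iff by blast
      have L1: "L (wpow r) a = L (wpow r) (wpow g)" and M1: "M (wpow r) a = M (wpow r) (wpow g)"
        using L M by (simp_all add: is_hyperlog_def bg)
      show ?thesis
      proof (cases "g = 0")
        case True
        then show ?thesis using L M L1 M1 by (simp add: is_hyperlog_def)
      next
        case False
        then consider x where "wpow g = hyperexp (wpow r) x"
          | x d where "x < wpow g" "d < r" "wpow g = hyperexp (wpow d) x"
          using E_wpow_cases[OF is_hyperexp_hyperexp, of g r] by (auto simp: ordinal_pos_iff)
        then show ?thesis
        proof cases
          case 1
          then show ?thesis using L M L1 M1 by (simp add: is_hyperlog_def)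
        next
          case 2
          have "x < a" using 2(1) bg ord_le_add2 by (metis order.strict_trans2)
          then show ?thesis using 2 L M L1 M1 less by (simp add: is_hyperlog_def)
        qed
      qed
    qed
  qed
  have "L x a = M x a" for x a
  proof (induction x arbitrary: a rule: less_induct)
    case (less x)
    show ?case
    proof (cases "x = 0")
      case True
      then show ?thesis using L M by (simp add: is_hyperlog_def)
    next
      case False
      then obtain r y where ry: "x = wpow r + y" "y < x" using ex_leading[of x] ordinal_pos_iff by blast
      then have "L x = L y \<circ> L (wpow r)" "M x = M y \<circ> M (wpow r)"
        using L M by (auto simp: is_hyperlog_def)
      then show ?thesis using w less ry(2) by simp
    qed
  qed
  then show ?thesis by (simp add: fun_eq_iff)
qed

lemma ex1_hyperlog: "\<exists>!L. is_hyperlog L"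
  using hlog_is_hyperlog is_hyperlog_unique by blast

definition hyperlog :: "'a ordinal \<Rightarrow> 'a ordinal \<Rightarrow> 'a ordinal"
  where "hyperlog = (THE L. is_hyperlog L)"

lemma is_hyperlog_hyperlog: "is_hyperlog hyperlog"
  unfolding hyperlog_def using ex1_hyperlog by (rule theI')

section \<open>The closed fragment of transfinite provability logic\<close>

datatype 'a form = Falsum | Neg "'a form" | Conj "'a form" "'a form" | Box "'a ordinal" "'a form"

abbreviation Imp :: "'a form \<Rightarrow> 'a form \<Rightarrow> 'a form"
  where "Imp p q \<equiv> Neg (Conj p (Neg q))"

abbreviation Dia :: "'a ordinal \<Rightarrow> 'a form \<Rightarrow> 'a form"
  where "Dia x p \<equiv> Neg (Box x (Neg p))"

primrec in_lang :: "'a ordinal \<Rightarrow> 'a form \<Rightarrow> bool" where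
  "in_lang \<Lambda> Falsum \<longleftrightarrow> True"
| "in_lang \<Lambda> (Neg p) \<longleftrightarrow> in_lang \<Lambda> p"
| "in_lang \<Lambda> (Conj p q) \<longleftrightarrow> in_lang \<Lambda> p \<and> in_lang \<Lambda> q"
| "in_lang \<Lambda> (Box x p) \<longleftrightarrow> x < \<Lambda> \<and> in_lang \<Lambda> p"

text \<open>Propositional evaluation: formulas starting with a modality are treated as atoms.\<close>

primrec prop_eval :: "('a ordinal \<Rightarrow> 'a form \<Rightarrow> bool) \<Rightarrow> 'a form \<Rightarrow> bool" where
  "prop_eval v Falsum \<longleftrightarrow> False"
| "prop_eval v (Neg p) \<longleftrightarrow> \<not> prop_eval v p"
| "prop_eval v (Conj p q) \<longleftrightarrow> prop_eval v p \<and> prop_eval v q"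
| "prop_eval v (Box x p) \<longleftrightarrow> v x p"

definition tautology :: "'a form \<Rightarrow> bool"
  where "tautology p \<longleftrightarrow> (\<forall>v. prop_eval v p)"

inductive GLP0 :: "'a ordinal \<Rightarrow> 'a form \<Rightarrow> bool" for \<Lambda> :: "'a ordinal" where
  Taut: "in_lang \<Lambda> p \<Longrightarrow> tautology p \<Longrightarrow> GLP0 \<Lambda> p"
| K: "x < \<Lambda> \<Longrightarrow> in_lang \<Lambda> p \<Longrightarrow> in_lang \<Lambda> q \<Longrightarrow>
    GLP0 \<Lambda> (Imp (Box x (Imp p q)) (Imp (Box x p) (Box x q)))"
| Loeb: "x < \<Lambda> \<Longrightarrow> in_lang \<Lambda> p \<Longrightarrow>
    GLP0 \<Lambda> (Imp (Box x (Imp (Box x p) p)) (Box x p))"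
| Mono: "x < z \<Longrightarrow> z < \<Lambda> \<Longrightarrow> in_lang \<Lambda> p \<Longrightarrow>
    GLP0 \<Lambda> (Imp (Dia z p) (Dia x p))"
| Neg_Intro: "x < z \<Longrightarrow> z < \<Lambda> \<Longrightarrow> in_lang \<Lambda> p \<Longrightarrow>
    GLP0 \<Lambda> (Imp (Dia x p) (Box z (Dia x p)))"
| MP: "GLP0 \<Lambda> (Imp p q) \<Longrightarrow> GLP0 \<Lambda> p \<Longrightarrow> GLP0 \<Lambda> q"
| Nec: "x < \<Lambda> \<Longrightarrow> GLP0 \<Lambda> p \<Longrightarrow> GLP0 \<Lambda> (Box x p)"

lemma GLP0_in_lang: "GLP0 \<Lambda> p \<Longrightarrow> in_lang \<Lambda> p"
  by (induction rule: GLP0.induct) auto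

section \<open>The Kripke frames\<close>

primrec kripke_sat ::
  "'w set \<Rightarrow> ('a ordinal \<Rightarrow> 'w \<Rightarrow> 'w \<Rightarrow> bool) \<Rightarrow> 'a form \<Rightarrow> 'w \<Rightarrow> bool" where
  "kripke_sat W R Falsum g \<longleftrightarrow> False"
| "kripke_sat W R (Neg p) g \<longleftrightarrow> \<not> kripke_sat W R p g"
| "kripke_sat W R (Conj p q) g \<longleftrightarrow> kripke_sat W R p g \<and> kripke_sat W R q g"
| "kripke_sat W R (Box x p) g \<longleftrightarrow> (\<forall>f\<in>W. R x f g \<longrightarrow> kripke_sat W R p f)"

lemma kripke_sat_Dia:
  "kripke_sat W R (Dia x p) g \<longleftrightarrow> (\<exists>f\<in>W. R x f g \<and> kripke_sat W R p f)"
  by simp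

text \<open>\<open>ell_sequences \<Theta> \<Lambda>\<close> is the set of $\ell$-sequences of depth \<open>\<Theta>\<close> and length \<open>\<Lambda>\<close>.\<close>

definition ell_sequences :: "'a ordinal \<Rightarrow> 'a ordinal \<Rightarrow> ('a ordinal \<Rightarrow> 'a ordinal) set"
  where "ell_sequences \<Theta> \<Lambda> = {f \<in> {..<\<Lambda>} \<rightarrow>\<^sub>E {..<\<Theta>}.
    \<forall>z. 0 < z \<and> z < \<Lambda> \<longrightarrow>
      (\<exists>t<z. \<forall>x. t \<le> x \<and> x < z \<longrightarrow> f z \<le> hyperlog (osub x z) (f x))}"

definition seq_less ::
  "'a ordinal \<Rightarrow> ('a ordinal \<Rightarrow> 'a ordinal) \<Rightarrow> ('a ordinal \<Rightarrow> 'a ordinal) \<Rightarrow> bool"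
  where "seq_less x f g \<longleftrightarrow> (\<forall>z<x. f z = g z) \<and> f x < g x"

definition kripke_complete :: "'a ordinal \<Rightarrow> 'a ordinal \<Rightarrow> bool"
  where "kripke_complete \<Theta> \<Lambda> \<longleftrightarrow>
    (\<forall>p. in_lang \<Lambda> p \<and>
      (\<forall>g\<in>ell_sequences \<Theta> \<Lambda>. kripke_sat (ell_sequences \<Theta> \<Lambda>) seq_less p g) \<longrightarrow>
      GLP0 \<Lambda> p)"

section \<open>The polytopological spaces\<close>

primrec top_sat :: "('a ordinal \<Rightarrow> 'w topology) \<Rightarrow> 'a form \<Rightarrow> 'w \<Rightarrow> bool" where
  "top_sat T Falsum x \<longleftrightarrow> False"
| "top_sat T (Neg p) x \<longleftrightarrow> \<not> top_sat T p x"
| "top_sat T (Conj p q) x \<longleftrightarrow> top_sat T p x \<and> top_sat T q x"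
| "top_sat T (Box l p) x \<longleftrightarrow> x \<notin> T l derived_set_of {y. \<not> top_sat T p y}"

lemma top_sat_Dia:
  assumes "x \<in> topspace (T l)"
  shows "top_sat T (Dia l p) x \<longleftrightarrow>
    (\<forall>U. openin (T l) U \<and> x \<in> U \<longrightarrow> (\<exists>y\<in>U. y \<noteq> x \<and> top_sat T p y))"
  using assms by (auto simp: in_derived_set_of)

definition ord_topology :: "'a ordinal \<Rightarrow> 'a ordinal \<Rightarrow> 'a ordinal topology"
  where "ord_topology \<Theta> l = topology_generated_by
    ({{z. z < \<Theta> \<and> a < hyperlog x z \<and> hyperlog x z \<le> b} | x a b. x < l \<and> a < b \<and> b \<le> \<Theta>} \<union>
     {{z. z < \<Theta> \<and> hyperlog x z \<le> b} | x b. x \<le> l \<and> b \<le> \<Theta>})"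

lemma topspace_ord_topology: "topspace (ord_topology \<Theta> l) = {..<\<Theta>}"
proof -
  have "hyperlog 0 z = z" for z :: "'a ordinal"
    using is_hyperlog_hyperlog[where 'a = 'a] by (simp add: is_hyperlog_def)
  then have "{..<\<Theta>} = {z. z < \<Theta> \<and> hyperlog 0 z \<le> \<Theta>}" by auto
  then have "{..<\<Theta>} \<in> {{z. z < \<Theta> \<and> hyperlog x z \<le> b} | x b. x \<le> l \<and> b \<le> \<Theta>}"
    by (intro CollectI exI[of _ 0] exI[of _ \<Theta>]) simp
  then have "{..<\<Theta>} \<subseteq> topspace (ord_topology \<Theta> l)"
    unfolding ord_topology_def topology_generated_by_topspace by blast
  moreover have "topspace (ord_topology \<Theta> l) \<subseteq> {..<\<Theta>}"
    unfolding ord_topology_def topology_generated_by_topspace by blast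
  ultimately show ?thesis by blast
qed

definition top_complete :: "'a ordinal \<Rightarrow> 'a ordinal \<Rightarrow> bool"
  where "top_complete \<Theta> \<Lambda> \<longleftrightarrow>
    (\<forall>p. in_lang \<Lambda> p \<and> (\<forall>x<\<Theta>. top_sat (ord_topology \<Theta>) p x) \<longrightarrow> GLP0 \<Lambda> p)"

end

theory Submission
  imports Defs
begin

text \<open>
  Every formula is provably equivalent to a disjunction of formulas
  $w \wedge \neg v_1 \wedge \dots \wedge \neg v_n$, where $w$ and the $v_i$ are worms
  (iterated diamonds applied to truth), because worms are closed under conjunction and
  linearly ordered by provable consistency. Hence a sound model is complete as soon as every
  worm $w$ has an exact point, where $w$ holds but no $\langle\xi\rangle w$ does.

  In the Kripke frame, a worm $w$ holds at $f$ iff $\ell^\xi o(w) \le f(\xi)$ for all $\xi$,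
  for an ordinal $o(w) < e^\Lambda 1$, so the axis point $(\ell^\xi o(w))_\xi$ is exact. The ordinals $o(w)$ are
  cofinal in $e^\Lambda 1$; a worm with $o(w) \ge \Theta$ is consistent but has no model of
  depth $\Theta$. The truth value of a formula at $f$ depends only on which of finitely many
  ordinals $\gamma$ satisfy $\ell^\xi \gamma \le f(\xi)$ for all $\xi$. This yields soundness of
  the monotonicity axiom, and it allows one to approximate arbitrary points by axis points,
  so that truth at $x$ in the topological space is truth at the axis point of $x$.
\<close>

section \<open>Hyperexponentials and hyperlogarithms\<close>

text \<open>The frame is not a GLP-frame: if \<open>seq_less z g f\<close> and \<open>x < z\<close>,
  then \<open>g x = f x\<close>, so \<open>seq_less x g f\<close> fails. Monotonicity holds only
  because a closed formula cannot tell \<open>g\<close> from a suitable other point, so invariance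
  under finitely many tests has to precede soundness. Likewise \<open>seq_less\<close> leads out of
  the axis points, which are all that the space has; finite tests lead back to them. Finitely many
  tests suffice because tests merge: the \<ell>-sequences above two axis sequences are those above a
  single one. This and the ordinal of a diamond rest on one construction,
  \<open>minimal_point\<close>, the least way to raise one coordinate; raising it forces changes at
  earlier coordinates. The constant \<open>hyperexp \<Lambda> 1\<close> arises as follows.
  \<open>hyperlog t\<close> maps the ordinals below it to ordinals below
  \<open>hyperexp (osub t \<Lambda>) 1\<close>, a limit for \<open>t < \<Lambda>\<close>, so adding
  one at coordinate \<open>t\<close> never leads out. Conversely, promoting modalities by
  \<open>wpow r\<close> raises ordinals as \<open>hyperexp (wpow r)\<close> does, so worms reach
  arbitrarily high below it.\<close>

lemma hyperexp_zero_left [simp]: "hyperexp 0 x = x"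
  and hyperexp_zero_right [simp]: "hyperexp a 0 = 0"
  and hyperexp_one: "hyperexp 1 = oexp"
  by (rule E0[OF is_hyperexp_hyperexp] Ez[OF is_hyperexp_hyperexp] E1[OF is_hyperexp_hyperexp])+

lemma normal_hyperexp: "normal (hyperexp a)"
  by (rule normal_E[OF is_hyperexp_hyperexp])

lemma hyperexp_le_iff [simp]: "hyperexp a x \<le> hyperexp a y \<longleftrightarrow> x \<le> y"
  and hyperexp_less_iff [simp]: "hyperexp a x < hyperexp a y \<longleftrightarrow> x < y"
  by (simp_all add: normal_le_iff[OF normal_hyperexp] normal_less_iff[OF normal_hyperexp])

lemma le_hyperexp: "x \<le> hyperexp a x"
  by (rule normal_ge[OF normal_hyperexp])

lemma wpow_add_less:
  assumes "a < wpow r" "b < wpow r"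
  shows "a + b < wpow r"
  using assms add_wpow[of a r] by (metis ord_add_less_iff)

text \<open>Serves to drop the side condition \<open>z < wpow r + z\<close> of the recursion
  equations. A leading exponent below \<open>r\<close> would make \<open>z\<close> too small to
  contain \<open>wpow r\<close>, and an equal one could be cancelled to give
  \<open>y = z\<close>.\<close>

lemma absorbed_leading:
  assumes "wpow r + z = z"
  obtains s y where "z = wpow s + y" "y < z" "r < s"
proof -
  have "0 < z"
    using assms by (metis ord_add_zero ordinal_pos_iff wpow_neq_zero(1))
  then obtain s y where sy: "z = wpow s + y" "y < z" "z < wpow (osuc s)"
    using ex_leading by blast
  have "r < s"
  proof (rule ccontr)
    assume "\<not> r < s"
    then consider "s < r" | "s = r" by fastforce
    then show False
    proof cases
      case 1
      then have "wpow (osuc s) \<le> wpow r" by (simp add: osuc_le_iff)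
      also have "\<dots> \<le> z" using assms ord_le_add1 by metis
      finally show False using sy by simp
    next
      case 2
      then have "y = z" using assms sy(1) by (metis ord_add_eq_iff)
      then show False using sy by simp
    qed
  qed
  then show thesis using that sy by blast
qed

lemma absorbed_or_less: "wpow r + z = z \<or> z < wpow r + z"
  using ord_le_add2[of z "wpow r"] by (auto simp: le_less)

text \<open>If \<open>z\<close> absorbs \<open>wpow r\<close>, its leading exponent exceeds
  \<open>r\<close>, and the values of that higher hyperexponential are fixed points of
  \<open>hyperexp (wpow r)\<close>. So the defining equation holds for every
  \<open>z\<close>.\<close>

lemma hyperexp_wpow_add: "hyperexp (wpow r + z) x = hyperexp (wpow r) (hyperexp z x)"
proof -
  \<comment> \<open>\<open>E_add_aux\<close> works below a power of \<omega> exceeding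
    \<open>z\<close>; the exponent \<open>osuc z\<close> always provides one.\<close>
  have "z < wpow (osuc z)"
    using normal_ge[OF normal_wpow, of "osuc z"] less_osuc order.strict_trans2 by blast
  then show ?thesis
    by (intro E_add_aux[OF is_hyperexp_hyperexp, of "osuc z"]) (auto simp: hx_absorb)
qed

lemma hyperexp_add: "hyperexp (x + y) a = hyperexp x (hyperexp y a)"
proof (induction x rule: less_induct)
  case (less x)
  show ?case
  proof (cases "x = 0")
    case False
    then obtain r z where "x = wpow r + z" "z < x"
      using ex_leading[of x] by (auto simp: ordinal_pos_iff)
    then show ?thesis using less by (simp add: hyperexp_wpow_add ord_add_assoc)
  qed simp
qed

section \<open>Hyperlogarithms: additivity and inversion\<close>

lemma hyperlog_zero_left [simp]: "hyperlog 0 a = a"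
  and hyperlog_zero_right [simp]: "hyperlog x 0 = 0"
  and hyperlog_add_right: "0 < x \<Longrightarrow> 0 < b \<Longrightarrow> hyperlog x (a + b) = hyperlog x b"
  and hyperlog_one_right: "0 < x \<Longrightarrow> hyperlog x 1 = 0"
  and hyperlog_wpow_hyperexp: "hyperlog (wpow r) (hyperexp (wpow d) a) =
    (if d < r then hyperlog (wpow r) a else if d = r then a else hyperexp (wpow d) a)"
proof -
  note h = is_hyperlog_hyperlog[unfolded is_hyperlog_def]
  note h2 = h[THEN conjunct2] note h3 = h2[THEN conjunct2] note h4 = h3[THEN conjunct2]
  show "hyperlog 0 a = a" "hyperlog x 0 = 0"
    by (rule h[THEN conjunct1, rule_format] h2[THEN conjunct1, rule_format])+
  show "0 < x \<Longrightarrow> 0 < b \<Longrightarrow> hyperlog x (a + b) = hyperlog x b"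
    by (rule h3[THEN conjunct1, rule_format]) (rule conjI)
  show "0 < x \<Longrightarrow> hyperlog x 1 = 0"
    by (rule h4[THEN conjunct1, rule_format])
  show "hyperlog (wpow r) (hyperexp (wpow d) a) =
    (if d < r then hyperlog (wpow r) a else if d = r then a else hyperexp (wpow d) a)"
    by (rule h4[THEN conjunct2, THEN conjunct2, rule_format])
qed

lemma hyperlog_CNF: "x < wpow r + x \<Longrightarrow> hyperlog (wpow r + x) a = hyperlog x (hyperlog (wpow r) a)"
  using is_hyperlog_hyperlog unfolding is_hyperlog_def by (metis comp_apply)

text \<open>
  To evaluate \<open>hyperlog (wpow r)\<close> one may replace an ordinal by its last Cantor term, which is
  either a value of \<open>hyperexp (wpow r)\<close> or a value of some \<open>hyperexp (wpow d)\<close> with \<open>d < r\<close>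
  at a smaller argument.
\<close>

lemma hyperlog_wpow_induct [case_names zero one same less]:
  assumes "P 0" and "\<And>b. P (b + 1)"
    and "\<And>b y. 0 < y \<Longrightarrow> P (b + hyperexp (wpow r) y)"
    and "\<And>b y d. 0 < y \<Longrightarrow> d < r \<Longrightarrow> y < b + hyperexp (wpow d) y \<Longrightarrow> P y \<Longrightarrow> P (b + hyperexp (wpow d) y)"
  shows "P a"
proof (induction a rule: less_induct)
  case (less a)
  show ?case
  proof (cases "a = 0")
    case False
    then obtain b g where bg: "a = b + wpow g" using ex_last[of a] by (auto simp: ordinal_pos_iff)
    consider "g = 0" | y where "wpow g = hyperexp (wpow r) y"
      | y d where "y < wpow g" "d < r" "wpow g = hyperexp (wpow d) y"
      using E_wpow_cases[OF is_hyperexp_hyperexp, of g r] unfolding ordinal_pos_iff by blast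
    then show ?thesis
    proof cases
      case 2
      then have "0 < y" by (metis hyperexp_zero_right ordinal_pos_iff wpow_neq_zero(1))
      then show ?thesis using assms(3) 2 bg by simp
    next
      case 3
      then have "0 < y" by (metis hyperexp_zero_right ordinal_pos_iff wpow_neq_zero(1))
      moreover have "y < a" using 3 bg ord_le_add2[of "wpow g" b] by simp
      ultimately show ?thesis using assms(4)[of y d b] less 3 bg by simp
    qed (use bg assms(2) in simp)
  qed (use assms(1) in simp)
qed

lemma hyperexp_pos_iff [simp]: "0 < hyperexp a x \<longleftrightarrow> 0 < x"
  using hyperexp_less_iff[of a 0 x] by simp

lemma hyperlog_wpow_hyperexp_last:
  "0 < y \<Longrightarrow> hyperlog (wpow r) (b + hyperexp (wpow d) y) =
    (if d < r then hyperlog (wpow r) y else if d = r then y else hyperexp (wpow d) y)"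
  by (simp add: hyperlog_add_right hyperlog_wpow_hyperexp)

lemma one_pos_ordinal [simp]: "0 < (1 :: 'a ordinal)"
  by (simp add: ordinal_pos_iff)

text \<open>\<open>hyperlog (wpow r)\<close> only removes earlier Cantor terms and hyperexponentials
  \<open>hyperexp (wpow d)\<close> with \<open>d \<le> r\<close>, and to all of these
  \<open>hyperlog (wpow s)\<close> is blind.\<close>

lemma hyperlog_wpow_absorb:
  assumes "r < s"
  shows "hyperlog (wpow s) (hyperlog (wpow r) a) = hyperlog (wpow s) a"
proof (induction a rule: hyperlog_wpow_induct[where r = r])
  case (one b)
  then show ?case by (simp add: hyperlog_add_right hyperlog_one_right)
next
  case (same b y)
  then show ?case using assms by (simp add: hyperlog_wpow_hyperexp_last)
next
  case (less b y d)
  moreover have "d < s" using less(2) assms by (rule order.strict_trans)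
  ultimately show ?case by (simp add: hyperlog_wpow_hyperexp_last)
qed simp

lemma hyperlog_wpow_add: "hyperlog (wpow r + z) a = hyperlog z (hyperlog (wpow r) a)"
proof (cases "wpow r + z = z")
  case True
  then obtain s y where "z = wpow s + y" "y < z" "r < s" by (rule absorbed_leading)
  then show ?thesis using True by (simp add: hyperlog_CNF hyperlog_wpow_absorb)
next
  case False
  then show ?thesis using absorbed_or_less hyperlog_CNF by blast
qed

lemma hyperlog_add: "hyperlog (x + y) a = hyperlog y (hyperlog x a)"
proof (induction x arbitrary: a rule: less_induct)
  case (less x)
  show ?case
  proof (cases "x = 0")
    case False
    then obtain r z where "x = wpow r + z" "z < x"
      using ex_leading[of x] by (auto simp: ordinal_pos_iff)
    then show ?thesis using less by (simp add: hyperlog_wpow_add ord_add_assoc)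
  qed simp
qed

lemma hyperlog_hyperexp [simp]: "hyperlog x (hyperexp x a) = a"
proof (induction x arbitrary: a rule: less_induct)
  case (less x)
  show ?case
  proof (cases "x = 0")
    case False
    then obtain r z where "x = wpow r + z" "z < x"
      using ex_leading[of x] by (auto simp: ordinal_pos_iff)
    then show ?thesis
      using less by (simp add: hyperexp_wpow_add hyperlog_wpow_add hyperlog_wpow_hyperexp)
  qed simp
qed

text \<open>On the last Cantor term the logarithm undoes an exponential or passes to a smaller
  argument; what is discarded can only make \<open>a\<close> larger.\<close>

lemma hyperexp_hyperlog_le: "hyperexp x (hyperlog x a) \<le> a"
proof (induction x arbitrary: a rule: less_induct)
  case (less x)
  have wp: "hyperexp (wpow r) (hyperlog (wpow r) a) \<le> a" for r a :: "'a ordinal"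
  proof (induction a rule: hyperlog_wpow_induct[where r = r])
    case (one b)
    then show ?case by (simp add: hyperlog_add_right hyperlog_one_right)
  next
    case (same b y)
    then show ?case by (simp add: hyperlog_wpow_hyperexp_last ord_le_add2)
  next
    case (less b y d)
    then show ?case by (simp add: hyperlog_wpow_hyperexp_last)
  qed simp
  show ?case
  proof (cases "x = 0")
    case False
    then obtain r z where rz: "x = wpow r + z" "z < x"
      using ex_leading[of x] by (auto simp: ordinal_pos_iff)
    have "hyperexp x (hyperlog x a) \<le> hyperexp (wpow r) (hyperlog (wpow r) a)"
      using less rz by (simp add: hyperexp_wpow_add hyperlog_wpow_add)
    also have "\<dots> \<le> a" by (rule wp)
    finally show ?thesis .
  qed simp
qed

text \<open>One half of an adjunction. The converse fails because \<open>hyperlog x\<close> is not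
  monotone: \<ell> vanishes at \<omega> + 1 although e(1) = \<omega>.\<close>

lemma le_hyperlogD: "c \<le> hyperlog x a \<Longrightarrow> hyperexp x c \<le> a"
  using hyperexp_hyperlog_le[of x a] by (meson hyperexp_le_iff order_trans)

lemma hyperlog_le: "hyperlog x a \<le> a"
  using le_hyperexp hyperexp_hyperlog_le order_trans by blast

lemma hyperlog_one_add_wpow [simp]: "hyperlog 1 (b + wpow g) = g"
proof (cases "g = 0")
  case False
  then have "hyperlog 1 (b + wpow g) = hyperlog 1 (hyperexp 1 g)"
    by (simp add: hyperlog_add_right hyperexp_one oexp_pos ordinal_pos_iff)
  then show ?thesis by simp
qed (simp add: hyperlog_add_right hyperlog_one_right)

lemma ex_add_wpow_hyperlog:
  assumes "0 < a"
  obtains b where "a = b + wpow (hyperlog 1 a)"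
  using ex_last[OF assms] hyperlog_one_add_wpow by metis

section \<open>Differences of exponents and behaviour below limit exponents\<close>

lemma osub_zero [simp]: "osub 0 a = a"
  using osub_add[of 0 a] by simp

lemma osub_self [simp]: "osub a a = 0"
  using osub_add[of a 0] by simp

lemma osub_pos_iff: "a \<le> b \<Longrightarrow> 0 < osub a b \<longleftrightarrow> a < b"
  using ord_add_osub[of a b] by (metis ord_add_less_iff ord_add_zero)

lemma osub_trans: "a \<le> b \<Longrightarrow> b \<le> c \<Longrightarrow> osub a c = osub a b + osub b c"
  by (metis ord_add_assoc ord_add_osub osub_add)

lemma hyperlog_osub: "a \<le> b \<Longrightarrow> hyperlog (osub a b) (hyperlog a x) = hyperlog b x"
  by (metis hyperlog_add ord_add_osub)

lemma hyperlog_antimono: "x \<le> y \<Longrightarrow> hyperlog y a \<le> hyperlog x a"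
  by (metis hyperlog_le hyperlog_osub)

lemma olimit_last:
  assumes "olimit b"
  obtains c r where "b = c + wpow r" "0 < r"
proof -
  obtain c r where cr: "b = c + wpow r" using ex_last olimit_pos[OF assms] by blast
  have "r \<noteq> 0"
  proof
    assume "r = 0"
    then have "b = osuc c" using cr by (simp add: ord_add_one)
    then show False using assms by simp
  qed
  then show thesis using that cr by (simp add: ordinal_pos_iff)
qed

text \<open>
  The values of \<open>hyperlog e a\<close> decrease as \<open>e\<close> grows, so they are eventually constant below a
  limit \<open>b = c + wpow r\<close>. The constant is a common fixed point of all \<open>hyperexp (wpow d)\<close> with
  \<open>d < r\<close>, hence a value of \<open>hyperexp (wpow r)\<close>.
\<close>

lemma hyperlog_eventually_hyperexp:
  assumes "olimit b"
  obtains t where "t < b"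
    "\<And>e. t \<le> e \<Longrightarrow> e < b \<Longrightarrow> hyperlog e a = hyperexp (osub e b) (hyperlog b a)"
proof -
  obtain c r where cr: "b = c + wpow r" "0 < r" using olimit_last assms by blast
  \<comment> \<open>Well-foundedness supplies the eventual value: the least one attained between
    \<open>c\<close> and \<open>b\<close> is kept from \<open>t\<close> on by antitonicity.\<close>
  define k where "k = (LEAST k. \<exists>e. c \<le> e \<and> e < b \<and> k = hyperlog e a)"
  have cb: "c < b" using cr by (metis ord_add_less_iff ord_add_zero wpow_pos)
  have "\<exists>e. c \<le> e \<and> e < b \<and> k = hyperlog e a"
    unfolding k_def by (rule LeastI_ex) (use cb in blast)
  then obtain t where t: "c \<le> t" "t < b" "k = hyperlog t a" by blast
  have const: "hyperlog e a = k" if "t \<le> e" "e < b" for e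
  proof -
    have "k \<le> hyperlog e a" unfolding k_def 
      by (rule Least_le, rule exI[of _ e]) (use that t(1) in auto)
    then show ?thesis using hyperlog_antimono[OF that(1), of a] t(3) by simp
  qed
  have small: "osub c e < wpow r" if "c \<le> e" "e < b" for e
    using that ord_add_osub[of c e] cr by (metis ord_add_less_iff)
  have osub: "osub e b = wpow r" if "c \<le> e" "e < b" for e
    using small[OF that] that cr add_wpow osub_add ord_add_osub ord_add_assoc by metis
  have "hyperexp (wpow d) k = k" if "d < r" for d
  proof -
    \<comment> \<open>The offset of \<open>t\<close> from \<open>c\<close> and \<open>wpow d\<close>
      both lie below \<open>wpow r\<close>, so \<open>t + wpow d\<close> is still below
      \<open>b\<close>; comparing the constant value at \<open>t\<close> and there gives
      \<open>hyperlog (wpow d) k = k\<close>.\<close>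
    have "t + wpow d = c + (osub c t + wpow d)"
      using t(1) by (metis ord_add_assoc ord_add_osub)
    also have "\<dots> < b"
      unfolding cr(1) using small[OF t(1,2)] that by (simp add: wpow_add_less)
    finally have "hyperlog (t + wpow d) a = k"
      by (intro const) (simp_all add: ord_le_add1)
    then have "hyperlog (wpow d) k = k" using t(3) by (simp add: hyperlog_add)
    then have "hyperexp (wpow d) k \<le> k" using hyperexp_hyperlog_le by metis
    then show ?thesis using le_hyperexp[of k] by (simp add: order.eq_iff)
  qed
  then obtain x where x: "k = hyperexp (wpow r) x"
    using E_range[OF is_hyperexp_hyperexp cr(2), of k] by blast
  have "hyperlog b a = hyperlog (osub t b) k"
    using hyperlog_osub[of t b a] t by simp
  also have "\<dots> = x" using x osub[OF t(1,2)] by simp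
  finally have "hyperlog b a = x" .
  then show thesis
    using that[OF t(2)] const x osub t(1) by (metis order_trans)
qed

lemma osub_add_add: "x \<le> z \<Longrightarrow> osub (s + x) (s + z) = osub x z"
  by (metis ord_add_assoc ord_add_osub osub_add)

lemma osub_osuc [simp]: "osub t (osuc t) = 1"
  using osub_add[of t 1] by (simp add: ord_add_one)

lemma hyperlog_osuc_right: "0 < x \<Longrightarrow> hyperlog x (osuc a) = 0"
  by (metis hyperlog_add_right hyperlog_one_right one_pos_ordinal ord_add_one)

lemma wpow_hyperlog_le:
  assumes "0 < c"
  shows "wpow (hyperlog 1 c) \<le> c"
proof -
  obtain b where "c = b + wpow (hyperlog 1 c)" using ex_add_wpow_hyperlog assms by blast
  then show ?thesis by (metis ord_le_add2)
qed

text \<open>The outermost factor \<open>hyperexp (wpow r)\<close> sends positive ordinals to powers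
  of \<omega>. Hence the ordinals below \<open>hyperexp y 1\<close> are closed under sums and, as
  \<open>0 < g\<close>, under successors.\<close>

lemma hyperexp_one_right_wpow:
  assumes "0 < y"
  obtains g where "0 < g" "hyperexp y 1 = wpow g"
proof -
  obtain r z where "y = wpow r + z" using ex_leading[OF assms] by blast
  then have "hyperexp y 1 = hyperexp (wpow r) (hyperexp z 1)" by (simp add: hyperexp_add)
  moreover have "0 < hyperexp z 1" by simp
  ultimately show thesis
    using that E_wpow_is_wpow[OF is_hyperexp_hyperexp, of "hyperexp z 1" r] by auto
qed

lemma osuc_less_hyperexp_one:
  assumes "0 < y" "c < hyperexp y 1"
  shows "osuc c < hyperexp y 1"
proof -
  obtain g where g: "0 < g" "hyperexp y 1 = wpow g" using hyperexp_one_right_wpow assms(1) by blast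
  then have "1 < wpow g" by (metis wpow_less_iff wpow_zero)
  then show ?thesis using wpow_add_less[of c g 1] g assms(2) by (simp add: ord_add_one)
qed

lemma olimit_hyperexp_one:
  assumes "0 < y"
  shows "olimit (hyperexp y 1)"
proof (cases "hyperexp y 1" rule: ordinal_cases)
  case 1
  then show ?thesis by (metis hyperexp_pos_iff one_pos_ordinal ordinal_not_less_zero)
next
  case (2 a)
  then show ?thesis using osuc_less_hyperexp_one[OF assms, of a] by simp
qed

text \<open>Additivity factors \<open>hyperexp \<Lambda> 1\<close> through
  \<open>hyperexp t\<close>, so too large a value at coordinate \<open>t\<close> would lift back to
  \<open>a\<close>.\<close>

lemma hyperlog_less_hyperexp_one:
  assumes "a < hyperexp \<Lambda> 1" "t \<le> \<Lambda>"
  shows "hyperlog t a < hyperexp (osub t \<Lambda>) 1"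
proof (rule ccontr)
  assume "\<not> ?thesis"
  then have "hyperexp (osub t \<Lambda>) 1 \<le> hyperlog t a" by simp
  then have "hyperexp t (hyperexp (osub t \<Lambda>) 1) \<le> a" by (rule le_hyperlogD)
  then show False using assms by (simp add: ord_add_osub flip: hyperexp_add)
qed

section \<open>The ordering of $\ell$-sequences\<close>

text \<open>The condition of \<open>ell_sequences\<close> without depth and extensionality, so that
  shifted, truncated and unrestricted sequences qualify as well.\<close>

definition lseq :: "'a ordinal \<Rightarrow> ('a ordinal \<Rightarrow> 'a ordinal) \<Rightarrow> bool"
  where "lseq \<Lambda> f \<longleftrightarrow> (\<forall>z. 0 < z \<and> z < \<Lambda> \<longrightarrow>
    (\<exists>t<z. \<forall>x. t \<le> x \<and> x < z \<longrightarrow> f z \<le> hyperlog (osub x z) (f x)))"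

lemma lseqD:
  assumes "lseq \<Lambda> f" "0 < z" "z < \<Lambda>"
  obtains t where "t < z" "\<And>x. t \<le> x \<Longrightarrow> x < z \<Longrightarrow> f z \<le> hyperlog (osub x z) (f x)"
  using assms unfolding lseq_def by blast

lemma lseqI:
  assumes "\<And>z. 0 < z \<Longrightarrow> z < \<Lambda> \<Longrightarrow> \<exists>t<z. \<forall>x. t \<le> x \<and> x < z \<longrightarrow> f z \<le> hyperlog (osub x z) (f x)"
  shows "lseq \<Lambda> f"
  using assms unfolding lseq_def by blast

lemma lseq_subset: "lseq \<Lambda> f \<Longrightarrow> \<Lambda>' \<le> \<Lambda> \<Longrightarrow> lseq \<Lambda>' f"
  unfolding lseq_def by (meson order.strict_trans2)

lemma lseq_hyperlog: "lseq \<Lambda> (\<lambda>z. hyperlog z a)"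
  by (rule lseqI) (auto simp: hyperlog_osub)

lemma lseq_cong:
  assumes "\<And>z. z < \<Lambda> \<Longrightarrow> f z = g z"
  shows "lseq \<Lambda> f \<longleftrightarrow> lseq \<Lambda> g"
proof -
  have "lseq \<Lambda> g" if fg: "\<And>z. z < \<Lambda> \<Longrightarrow> f z = g z" and f: "lseq \<Lambda> f" for f g
  proof (rule lseqI)
    fix z assume z: "0 < z" "z < \<Lambda>"
    obtain t where "t < z" "\<And>x. t \<le> x \<Longrightarrow> x < z \<Longrightarrow> f z \<le> hyperlog (osub x z) (f x)"
      using lseqD[OF f z] by blast
    then show "\<exists>t<z. \<forall>x. t \<le> x \<and> x < z \<longrightarrow> g z \<le> hyperlog (osub x z) (g x)"
      using fg z by (metis order.strict_trans)
  qed
  from this[of f g] this[of g f] show ?thesis using assms by metis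
qed

text \<open>The condition at \<open>s + z\<close> involves only differences of coordinates, which a
  shift preserves. A threshold at or below \<open>s\<close> is replaced by 0.\<close>

lemma lseq_shift:
  assumes f: "lseq \<Lambda> f" and s: "s \<le> \<Lambda>"
  shows "lseq (osub s \<Lambda>) (\<lambda>z. f (s + z))"
proof (rule lseqI)
  fix z assume z: "0 < z" "z < osub s \<Lambda>"
  have "s + z < \<Lambda>" using z s by (metis ord_add_less_iff ord_add_osub)
  moreover have "0 < s + z" using z(1) ord_le_add2[of z s] by simp
  ultimately obtain t where t: "t < s + z"
    "\<And>x. t \<le> x \<Longrightarrow> x < s + z \<Longrightarrow> f (s + z) \<le> hyperlog (osub x (s + z)) (f x)"
    using lseqD[OF f] by blast
  obtain t' where t': "t' < z" "t \<le> s + t'"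
  proof (cases "t \<le> s")
    case True
    then show ?thesis using that[of 0] z by simp
  next
    case False
    then have "s + osub s t = t" by (simp add: ord_add_osub)
    then show ?thesis using that[of "osub s t"] t(1) by (metis ord_add_less_iff order_refl)
  qed
  have "f (s + z) \<le> hyperlog (osub x z) (f (s + x))" if "t' \<le> x" "x < z" for x
  proof -
    have "t \<le> s + x" using t'(2) that(1) by (meson ord_add_le_iff order_trans)
    then have "f (s + z) \<le> hyperlog (osub (s + x) (s + z)) (f (s + x))"
      using that by (intro t(2)) simp_all
    then show ?thesis using that by (simp add: osub_add_add)
  qed
  then show "\<exists>t<z. \<forall>x. t \<le> x \<and> x < z \<longrightarrow> f (s + z) \<le> hyperlog (osub x z) (f (s + x))"
    using t' by blast
qed

text \<open>A smaller value at \<open>s\<close> asks less of the coordinates before it, and beyond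
  \<open>s\<close> the threshold \<open>s\<close> works, with equality along the axis
  sequence.\<close>

lemma lseq_glue:
  assumes f: "lseq \<Lambda> f" and le: "hyperlog s a \<le> f s"
  shows "lseq \<Lambda> (\<lambda>z. if z < s then f z else hyperlog z a)" (is "lseq \<Lambda> ?g")
proof (rule lseqI)
  fix z assume z: "0 < z" "z < \<Lambda>"
  obtain t where t: "t < z" "\<And>x. t \<le> x \<Longrightarrow> x < z \<Longrightarrow> f z \<le> hyperlog (osub x z) (f x)"
    using lseqD[OF f z] by blast
  show "\<exists>t<z. \<forall>x. t \<le> x \<and> x < z \<longrightarrow> ?g z \<le> hyperlog (osub x z) (?g x)"
  proof (cases "s < z")
    case True
    then show ?thesis by (intro exI[of _ s]) (auto simp: hyperlog_osub)
  next
    case False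
    then have "?g z \<le> f z" using le by (auto simp: le_less)
    then show ?thesis using t False by (intro exI[of _ t]) (auto intro: order_trans)
  qed
qed

text \<open>The defining condition speaks only about coordinates close to \<open>x\<close>. Read
  through \<open>hyperexp\<close>, which is monotone and additive in the exponent, it composes by
  well-founded descent into a bound at all earlier coordinates.\<close>

lemma lseq_hyperexp_le:
  assumes f: "lseq \<Lambda> f" and "z \<le> x" "x < \<Lambda>"
  shows "hyperexp (osub z x) (f x) \<le> f z"
  using assms(2,3)
proof (induction x rule: less_induct)
  case (less x)
  show ?case
  proof (cases "z = x")
    case False
    then have zx: "z < x" using less.prems by simp
    then have "0 < x" using ordinal_zero_le order.strict_trans1 by blast
    then obtain t where t: "t < x" "\<And>y. t \<le> y \<Longrightarrow> y < x \<Longrightarrow> f x \<le> hyperlog (osub y x) (f y)"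
      using lseqD[OF f _ less.prems(2)] by blast
    define y where "y = max t z"
    have y: "t \<le> y" "z \<le> y" "y < x" using t zx by (auto simp: y_def)
    have "hyperexp (osub y x) (f x) \<le> f y" by (rule le_hyperlogD) (rule t(2)[OF y(1,3)])
    then have "hyperexp (osub z y) (hyperexp (osub y x) (f x)) \<le> hyperexp (osub z y) (f y)" by simp
    also have "\<dots> \<le> f z" using less y by simp
    finally show ?thesis using y by (simp add: osub_trans[of z y x] hyperexp_add)
  qed simp
qed

text \<open>
  Induction on \<open>s\<close>: the requirement \<open>d \<le> f s\<close> is transferred to an earlier coordinate \<open>t\<close>. If
  \<open>s = t + 1\<close>, the value at \<open>t\<close> has to end in a power of \<open>\<omega>\<close> with exponent at least \<open>d\<close>; if \<open>s\<close> is a limit,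
  \<open>lseq_hyperexp_le\<close> and the eventual constancy of the hyperlogarithms apply.
\<close>

lemma minimal_point:
  assumes "hyperlog s a \<le> d"
  shows "\<exists>m. hyperlog s m = d \<and> (\<forall>z\<le>s. hyperlog z a \<le> hyperlog z m) \<and>
    (\<forall>f. lseq (osuc s) f \<longrightarrow> (\<forall>z<s. hyperlog z a \<le> f z) \<longrightarrow> d \<le> f s \<longrightarrow> (\<forall>z\<le>s. hyperlog z m \<le> f z)) \<and>
    (\<forall>\<Lambda>>s. a < hyperexp \<Lambda> 1 \<longrightarrow> d < hyperexp (osub s \<Lambda>) 1 \<longrightarrow> m < hyperexp \<Lambda> 1)"
  using assms
proof (induction s arbitrary: d rule: less_induct)
  case (less s)
  show ?case
  proof (cases s rule: ordinal_cases)
    case 1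
    then show ?thesis using less.prems by (intro exI[of _ d]) auto
  next
    case (2 t)
    \<comment> \<open>The least ordinal that is at least \<open>hyperlog t a\<close> and whose image
      under \<ell> is at least \<open>d\<close>.\<close>
    define d' where "d' = (if d = hyperlog s a then hyperlog t a else hyperlog t a + wpow d)"
    have log: "hyperlog s x = hyperlog 1 (hyperlog t x)" for x
      by (simp add: 2 hyperlog_add flip: ord_add_one)
    have d': "hyperlog t a \<le> d'" "hyperlog 1 d' = d"
      by (auto simp: d'_def ord_le_add1 log)
    have "t < s" using 2 by simp
    from less.IH[OF this d'(1)] obtain m where m: "hyperlog t m = d'"
      "\<forall>z\<le>t. hyperlog z a \<le> hyperlog z m"
      "\<And>f z. lseq (osuc t) f \<Longrightarrow> \<forall>z<t. hyperlog z a \<le> f z \<Longrightarrow> d' \<le> f t \<Longrightarrow> z \<le> t \<Longrightarrow> hyperlog z m \<le> f z"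
      "\<And>\<Lambda>. t < \<Lambda> \<Longrightarrow> a < hyperexp \<Lambda> 1 \<Longrightarrow> d' < hyperexp (osub t \<Lambda>) 1 \<Longrightarrow> m < hyperexp \<Lambda> 1"
      by blast
    have sm: "hyperlog s m = d" using m(1) d'(2) log by simp
    have cases_z: "z \<le> t \<or> z = s" if "z \<le> s" for z
      using that 2 by (auto simp: le_less less_osuc_iff)
    have "hyperlog z a \<le> hyperlog z m" if "z \<le> s" for z
      using cases_z[OF that] m(2) sm less.prems by auto
    moreover have "hyperlog z m \<le> f z"
      if f: "lseq (osuc s) f" "\<forall>z<s. hyperlog z a \<le> f z" "d \<le> f s" and z: "z \<le> s" for f z
    proof -
      have at: "hyperlog t a \<le> f t" using f(2) \<open>t < s\<close> by blast
      have "0 < s" using 2 by (simp add: ordinal_pos_iff)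
      then obtain t0 where "t0 < s" and t0: "\<And>x. t0 \<le> x \<Longrightarrow> x < s \<Longrightarrow> f s \<le> hyperlog (osub x s) (f x)"
        using lseqD[OF f(1), of s] by auto
      have "f s \<le> hyperlog (osub t s) (f t)"
        by (rule t0) (use \<open>t0 < s\<close> 2 in \<open>simp_all add: less_osuc_iff\<close>)
      then have dl: "d \<le> hyperlog 1 (f t)" using f(3) 2 by simp
      have "d' \<le> f t"
      proof (cases "d = hyperlog s a")
        case False
        then have ds: "hyperlog 1 (hyperlog t a) < d" using less.prems log by (simp add: le_less)
        obtain c where c: "f t = hyperlog t a + c" using ord_le_ex_add[OF at] by blast
        have "c \<noteq> 0" using c ds dl by auto
        then have "0 < c" by (simp add: ordinal_pos_iff)
        then have "d \<le> hyperlog 1 c" using dl c by (simp add: hyperlog_add_right)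
        then have "wpow d \<le> wpow (hyperlog 1 c)" by simp
        also have "\<dots> \<le> c" using wpow_hyperlog_le \<open>0 < c\<close> .
        finally show ?thesis using False c by (simp add: d'_def)
      qed (use at in \<open>simp add: d'_def\<close>)
      moreover have "lseq (osuc t) f" using f(1) by (rule lseq_subset) (simp add: 2 less_imp_le)
      ultimately have "hyperlog z m \<le> f z" if "z \<le> t"
        using m(3)[of f z] f(2) that \<open>t < s\<close> by auto
      then show ?thesis using cases_z[OF z] sm f(3) by auto
    qed
    moreover have "m < hyperexp \<Lambda> 1"
      if "s < \<Lambda>" "a < hyperexp \<Lambda> 1" "d < hyperexp (osub s \<Lambda>) 1" for \<Lambda>
    proof (rule m(4))
      show tl: "t < \<Lambda>" using \<open>t < s\<close> that(1) by (rule order.strict_trans)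
      have la: "hyperlog t a < hyperexp (osub t \<Lambda>) 1"
        by (rule hyperlog_less_hyperexp_one) (use that tl in auto)
      have "osub t \<Lambda> = osub t s + osub s \<Lambda>"
        using that(1) \<open>t < s\<close> by (intro osub_trans less_imp_le)
      moreover have "osub t s = 1" using 2 by simp
      ultimately have "osub t \<Lambda> = 1 + osub s \<Lambda>" by simp
      \<comment> \<open>The bound at \<open>t\<close> is \<open>wpow\<close> of the bound at
        \<open>s\<close>, so \<open>wpow d\<close> may be added to \<open>hyperlog t a\<close>
        without reaching it.\<close>
      then have "hyperexp (osub t \<Lambda>) 1 = oexp (hyperexp (osub s \<Lambda>) 1)"
        by (simp add: hyperexp_add hyperexp_one)
      also have "\<dots> = wpow (hyperexp (osub s \<Lambda>) 1)" by (simp add: oexp_pos)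
      finally show "d' < hyperexp (osub t \<Lambda>) 1"
        using la that(3) by (auto simp: d'_def intro!: wpow_add_less)
    qed (use that in simp)
    ultimately show ?thesis using sm by blast
  next
    case 3
    obtain t where t: "t < s"
      "\<And>e. t \<le> e \<Longrightarrow> e < s \<Longrightarrow> hyperlog e a = hyperexp (osub e s) (hyperlog s a)"
      using hyperlog_eventually_hyperexp[OF 3] by blast
    \<comment> \<open>The value that \<open>d\<close> at coordinate \<open>s\<close> forces at
      \<open>t\<close> in every \<ell>-sequence; from \<open>t\<close> on, the axis sequence of
      \<open>a\<close> has this form with \<open>hyperlog s a\<close> in place of \<open>d\<close>,
      hence lies below.\<close>
    define d' where "d' = hyperexp (osub t s) d"
    have "hyperlog t a \<le> d'" using t less.prems by (simp add: d'_def)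
    from less.IH[OF t(1) this] obtain m where m: "hyperlog t m = d'"
      "\<forall>z\<le>t. hyperlog z a \<le> hyperlog z m"
      "\<And>f z. lseq (osuc t) f \<Longrightarrow> \<forall>z<t. hyperlog z a \<le> f z \<Longrightarrow> d' \<le> f t \<Longrightarrow> z \<le> t \<Longrightarrow> hyperlog z m \<le> f z"
      "\<And>\<Lambda>. t < \<Lambda> \<Longrightarrow> a < hyperexp \<Lambda> 1 \<Longrightarrow> d' < hyperexp (osub t \<Lambda>) 1 \<Longrightarrow> m < hyperexp \<Lambda> 1"
      by blast
    have tail: "hyperlog z m = hyperexp (osub z s) d" if "t \<le> z" "z \<le> s" for z
    proof -
      have "hyperlog z m = hyperlog (osub t z) d'" using m(1) that hyperlog_osub by metis
      then show ?thesis using that by (simp add: d'_def osub_trans[of t z s] hyperexp_add)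
    qed
    have "hyperlog s m = d" using tail[of s] t(1) by simp
    moreover have "hyperlog z a \<le> hyperlog z m" if "z \<le> s" for z
    proof (cases "z \<le> t")
      case False
      then show ?thesis using tail[of z] t(2)[of z] that less.prems by (cases "z = s") auto
    qed (use m(2) in blast)
    moreover have "hyperlog z m \<le> f z"
      if f: "lseq (osuc s) f" "\<forall>z<s. hyperlog z a \<le> f z" "d \<le> f s" and z: "z \<le> s" for f z
    proof -
      have ex: "hyperexp (osub x s) d \<le> f x" if "x \<le> s" for x
      proof -
        have "hyperexp (osub x s) d \<le> hyperexp (osub x s) (f s)" using f(3) by simp
        also have "\<dots> \<le> f x" using lseq_hyperexp_le[OF f(1) that] by simp
        finally show ?thesis .
      qed
      show ?thesis
      proof (cases "z \<le> t")
        case True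
        moreover have "lseq (osuc t) f"
          using f(1) by (rule lseq_subset) (use t(1) in \<open>simp add: less_imp_le\<close>)
        ultimately show ?thesis
          using m(3)[of f z] ex[of t] f(2) t(1) unfolding d'_def by auto
      next
        case False
        then show ?thesis using tail[of z] ex[OF z] z by auto
      qed
    qed
    moreover have "m < hyperexp \<Lambda> 1"
      if "s < \<Lambda>" "a < hyperexp \<Lambda> 1" "d < hyperexp (osub s \<Lambda>) 1" for \<Lambda>
    proof (rule m(4))
      show "t < \<Lambda>" using t(1) that(1) by (rule order.strict_trans)
      have "osub t \<Lambda> = osub t s + osub s \<Lambda>" using t(1) that(1) by (intro osub_trans) auto
      then show "d' < hyperexp (osub t \<Lambda>) 1" using that(3) by (simp add: d'_def hyperexp_add)
    qed (use that in simp)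
    ultimately show ?thesis by blast
  qed
qed

section \<open>Cones above axis sequences and their finite intersections\<close>

definition up :: "'a ordinal \<Rightarrow> 'a ordinal \<Rightarrow> ('a ordinal \<Rightarrow> 'a ordinal) \<Rightarrow> bool"
  where "up \<Lambda> a f \<longleftrightarrow> (\<forall>z<\<Lambda>. hyperlog z a \<le> f z)"

lemma up_hyperlog_self [simp]: "up \<Lambda> a (\<lambda>z. hyperlog z a)"
  by (simp add: up_def)

lemma up_shiftD:
  assumes "up \<Lambda> a f" "s \<le> \<Lambda>"
  shows "up (osub s \<Lambda>) (hyperlog s a) (\<lambda>z. f (s + z))"
  unfolding up_def
proof (intro allI impI)
  fix z assume "z < osub s \<Lambda>"
  then have "s + z < \<Lambda>" using assms(2) by (metis ord_add_less_iff ord_add_osub)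
  then show "hyperlog z (hyperlog s a) \<le> f (s + z)"
    using assms(1) by (simp add: up_def flip: hyperlog_add)
qed

lemma up_shiftI:
  assumes "up (osub s \<Lambda>) (hyperlog s a) (\<lambda>z. f (s + z))" "s \<le> \<Lambda>" "\<forall>z<s. hyperlog z a \<le> f z"
  shows "up \<Lambda> a f"
  unfolding up_def
proof (intro allI impI)
  fix z assume z: "z < \<Lambda>"
  show "hyperlog z a \<le> f z"
  proof (cases "z < s")
    case False
    then have e: "s + osub s z = z" by (simp add: ord_add_osub)
    then have "osub s z < osub s \<Lambda>" using z assms(2) by (metis ord_add_less_iff ord_add_osub)
    then show ?thesis using assms(1) e by (auto simp: up_def simp flip: hyperlog_add dest!: spec[of _ "osub s z"])
  qed (use assms(3) in blast)
qed

text \<open>Let \<open>a \<le> b\<close>, and let \<open>s\<close> be the first coordinate where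
  \<open>a\<close> asks for more. Before \<open>s\<close> the requirement of \<open>b\<close>
  suffices; from \<open>s\<close> on, the shifted pair has a smaller maximum and is joined by
  induction. \<open>minimal_point\<close> combines the requirement of \<open>b\<close> before
  \<open>s\<close> with the joined value at \<open>s\<close>.\<close>

lemma ex_join2:
  "\<exists>g. \<forall>f. lseq \<Lambda> f \<longrightarrow> (up \<Lambda> g f \<longleftrightarrow> up \<Lambda> a f \<and> up \<Lambda> b f)"
proof (induction "max a b" arbitrary: \<Lambda> a b rule: less_induct)
  case less
  have main: "\<exists>g. \<forall>f. lseq \<Lambda> f \<longrightarrow> (up \<Lambda> g f \<longleftrightarrow> up \<Lambda> a f \<and> up \<Lambda> b f)"
    if ab: "a \<le> b" and IH: "\<And>\<Lambda> a' b'. max a' b' < max a b \<Longrightarrow>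
        \<exists>g. \<forall>f. lseq \<Lambda> f \<longrightarrow> (up \<Lambda> g f \<longleftrightarrow> up \<Lambda> a' f \<and> up \<Lambda> b' f)" for a b
  proof (cases "\<exists>s<\<Lambda>. hyperlog s b < hyperlog s a")
    case False
    then have "hyperlog s a \<le> hyperlog s b" if "s < \<Lambda>" for s using that by force
    then have "up \<Lambda> a f" if "up \<Lambda> b f" for f
      using that unfolding up_def by (meson order_trans)
    then show ?thesis by blast
  next
    case True
    define s where "s = (LEAST s. s < \<Lambda> \<and> hyperlog s b < hyperlog s a)"
    have s: "s < \<Lambda>" "hyperlog s b < hyperlog s a"
      using LeastI_ex[OF True] unfolding s_def by auto
    have below: "hyperlog z a \<le> hyperlog z b" if "z < s" for z
      using not_less_Least[of z "\<lambda>s. s < \<Lambda> \<and> hyperlog s b < hyperlog s a"] that s(1) unfolding s_def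
      by (meson linorder_not_le order.strict_trans)
    have "hyperlog s a \<le> a" by (rule hyperlog_le)
    moreover have "a \<noteq> b" using s(2) by auto
    ultimately have "max (hyperlog s a) (hyperlog s b) < max a b"
      using ab s(2) by (auto simp: max_def)
    from IH[OF this, of "osub s \<Lambda>"] obtain g where
      g: "\<And>f. lseq (osub s \<Lambda>) f \<Longrightarrow>
        up (osub s \<Lambda>) g f \<longleftrightarrow> up (osub s \<Lambda>) (hyperlog s a) f \<and> up (osub s \<Lambda>) (hyperlog s b) f"
      by blast
    have pos: "0 < osub s \<Lambda>" using s(1) by (simp add: osub_pos_iff less_imp_le)
    \<comment> \<open>The characterization of \<open>g\<close>, tested on the axis sequence of
      \<open>g\<close> itself.\<close>
    have "up (osub s \<Lambda>) (hyperlog s a) (\<lambda>z. hyperlog z g)"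
      using g[OF lseq_hyperlog, of g] by simp
    then have "hyperlog s a \<le> g" using pos by (auto simp: up_def dest: spec[of _ 0])
    then have "hyperlog s b \<le> g" using s(2) by simp
    from minimal_point[OF this] obtain m where m: "hyperlog s m = g"
      "\<And>z. z \<le> s \<Longrightarrow> hyperlog z b \<le> hyperlog z m"
      "\<And>f z. lseq (osuc s) f \<Longrightarrow> \<forall>z<s. hyperlog z b \<le> f z \<Longrightarrow> g \<le> f s \<Longrightarrow> z \<le> s \<Longrightarrow> hyperlog z m \<le> f z"
      by blast
    have "up \<Lambda> m f \<longleftrightarrow> up \<Lambda> a f \<and> up \<Lambda> b f" if f: "lseq \<Lambda> f" for f
    proof -
      have sh: "lseq (osub s \<Lambda>) (\<lambda>z. f (s + z))" using f s(1) by (intro lseq_shift) auto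
      show ?thesis
      proof
        assume m': "up \<Lambda> m f"
        have bz: "\<forall>z<s. hyperlog z b \<le> f z"
          using m(2) m' s(1) unfolding up_def by (meson less_imp_le order.strict_trans order_trans)
        then have az: "\<forall>z<s. hyperlog z a \<le> f z" using below order_trans by blast
        have "up (osub s \<Lambda>) g (\<lambda>z. f (s + z))"
          using up_shiftD[OF m' less_imp_le[OF s(1)]] m(1) by simp
        then have "up (osub s \<Lambda>) (hyperlog s a) (\<lambda>z. f (s + z))" "up (osub s \<Lambda>) (hyperlog s b) (\<lambda>z. f (s + z))"
          using g[OF sh] by blast+
        then show "up \<Lambda> a f \<and> up \<Lambda> b f"
          using up_shiftI[OF _ less_imp_le[OF s(1)]] az bz by blast
      next
        assume ab': "up \<Lambda> a f \<and> up \<Lambda> b f"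
        then have sg: "up (osub s \<Lambda>) g (\<lambda>z. f (s + z))"
          using g[OF sh] up_shiftD s(1) by (metis less_imp_le)
        then have "g \<le> f s" using pos by (auto simp: up_def dest: spec[of _ 0])
        moreover have "\<forall>z<s. hyperlog z b \<le> f z"
          using ab' s(1) unfolding up_def by (meson order.strict_trans)
        moreover have "lseq (osuc s) f" using f by (rule lseq_subset) (use s(1) in \<open>simp add: osuc_le_iff\<close>)
        ultimately have "\<forall>z<s. hyperlog z m \<le> f z" using m(3) by (meson less_imp_le)
        then show "up \<Lambda> m f" using up_shiftI[OF _ less_imp_le[OF s(1)]] sg m(1) by blast
      qed
    qed
    then show ?thesis by blast
  qed
  show ?case
  proof (cases "a \<le> b")
    case True
    show ?thesis by (rule main[OF True]) (rule less)
  next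
    case False
    then have "b \<le> a" by simp
    have "\<exists>g. \<forall>f. lseq \<Lambda> f \<longrightarrow> (up \<Lambda> g f \<longleftrightarrow> up \<Lambda> b f \<and> up \<Lambda> a f)"
      by (rule main[OF \<open>b \<le> a\<close>]) (rule less, simp only: max.commute)
    then show ?thesis by blast
  qed
qed

lemma ex_join:
  assumes "finite A"
  shows "\<exists>g. \<forall>f. lseq \<Lambda> f \<longrightarrow> (up \<Lambda> g f \<longleftrightarrow> (\<forall>a\<in>A. up \<Lambda> a f))"
  using assms
proof induction
  case empty
  show ?case by (intro exI[of _ 0]) (simp add: up_def)
next
  case (insert a A)
  then obtain g where g: "\<And>f. lseq \<Lambda> f \<Longrightarrow> up \<Lambda> g f \<longleftrightarrow> (\<forall>a\<in>A. up \<Lambda> a f)" by blast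
  obtain h where "\<And>f. lseq \<Lambda> f \<Longrightarrow> up \<Lambda> h f \<longleftrightarrow> up \<Lambda> a f \<and> up \<Lambda> g f"
    using ex_join2[of \<Lambda> a g] by blast
  then show ?case using g by (intro exI[of _ h]) simp
qed

definition join :: "'a ordinal \<Rightarrow> 'a ordinal set \<Rightarrow> 'a ordinal"
  where "join \<Lambda> A = (SOME g. \<forall>f. lseq \<Lambda> f \<longrightarrow> (up \<Lambda> g f \<longleftrightarrow> (\<forall>a\<in>A. up \<Lambda> a f)))"

lemma up_join_iff: "finite A \<Longrightarrow> lseq \<Lambda> f \<Longrightarrow> up \<Lambda> (join \<Lambda> A) f \<longleftrightarrow> (\<forall>a\<in>A. up \<Lambda> a f)"
  unfolding join_def using someI_ex[OF ex_join[of A \<Lambda>]] by blast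

lemma up_join_hyperlog: "finite A \<Longrightarrow> a \<in> A \<Longrightarrow> up \<Lambda> a (\<lambda>z. hyperlog z (join \<Lambda> A))"
  using up_join_iff[of A \<Lambda> "\<lambda>z. hyperlog z (join \<Lambda> A)"] by (simp add: lseq_hyperlog)

section \<open>The ordinals of worms\<close>

text \<open>The minimal point for the value \<open>osuc (hyperlog s a)\<close>, the least one
  leaving room for a step down at \<open>s\<close> to something above \<open>a\<close>. Thus it
  turns the ordinal of a worm into that of the worm under \<open>Dia s\<close>; the last clause
  keeps it below \<open>hyperexp \<Lambda> 1\<close>.\<close>

definition dia_ord :: "'a ordinal \<Rightarrow> 'a ordinal \<Rightarrow> 'a ordinal"
  where "dia_ord s a = (SOME m. hyperlog s m = osuc (hyperlog s a) \<and> (\<forall>z\<le>s. hyperlog z a \<le> hyperlog z m) \<and>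
    (\<forall>f. lseq (osuc s) f \<longrightarrow> (\<forall>z<s. hyperlog z a \<le> f z) \<longrightarrow> osuc (hyperlog s a) \<le> f s \<longrightarrow>
      (\<forall>z\<le>s. hyperlog z m \<le> f z)) \<and>
    (\<forall>\<Lambda>>s. a < hyperexp \<Lambda> 1 \<longrightarrow> osuc (hyperlog s a) < hyperexp (osub s \<Lambda>) 1 \<longrightarrow> m < hyperexp \<Lambda> 1))"

lemma hyperlog_dia_ord: "hyperlog s (dia_ord s a) = osuc (hyperlog s a)"
  and hyperlog_le_dia_ord: "z \<le> s \<Longrightarrow> hyperlog z a \<le> hyperlog z (dia_ord s a)"
  and dia_ord_minimal: "lseq (osuc s) f \<Longrightarrow> \<forall>z<s. hyperlog z a \<le> f z \<Longrightarrow> hyperlog s a < f s \<Longrightarrow>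
    z \<le> s \<Longrightarrow> hyperlog z (dia_ord s a) \<le> f z"
  and dia_ord_less: "s < \<Lambda> \<Longrightarrow> a < hyperexp \<Lambda> 1 \<Longrightarrow> osuc (hyperlog s a) < hyperexp (osub s \<Lambda>) 1 \<Longrightarrow>
    dia_ord s a < hyperexp \<Lambda> 1"
  using someI_ex[OF minimal_point[of s a "osuc (hyperlog s a)"], folded dia_ord_def]
  by (auto simp: osuc_le_iff less_imp_le)

text \<open>Up to \<open>s\<close> this is minimality. Beyond \<open>s\<close> nothing is demanded,
  because all further logarithms of the successor at coordinate \<open>s\<close> vanish.\<close>

lemma up_dia_ord_iff:
  assumes "lseq \<Lambda> f" "s < \<Lambda>"
  shows "up \<Lambda> (dia_ord s a) f \<longleftrightarrow> (\<forall>z<s. hyperlog z a \<le> f z) \<and> hyperlog s a < f s"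
proof
  assume u: "up \<Lambda> (dia_ord s a) f"
  have "hyperlog z a \<le> f z" if "z < s" for z
    using u that assms(2) hyperlog_le_dia_ord[of z s a] unfolding up_def
    by (meson less_imp_le order.strict_trans order_trans)
  moreover have "hyperlog s a < f s"
    using u assms(2) hyperlog_dia_ord[of s a] by (auto simp: up_def osuc_le_iff dest: spec[of _ s])
  ultimately show "(\<forall>z<s. hyperlog z a \<le> f z) \<and> hyperlog s a < f s" by blast
next
  assume r: "(\<forall>z<s. hyperlog z a \<le> f z) \<and> hyperlog s a < f s"
  have "lseq (osuc s) f" using assms by (auto intro: lseq_subset simp: osuc_le_iff)
  then have le: "hyperlog z (dia_ord s a) \<le> f z" if "z \<le> s" for z
    using dia_ord_minimal r that by blast
  have "hyperlog z (dia_ord s a) = 0" if "s < z" for z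
  proof -
    have "hyperlog z (dia_ord s a) = hyperlog (osub s z) (osuc (hyperlog s a))"
      using that hyperlog_osub[of s z "dia_ord s a"] hyperlog_dia_ord by (metis less_imp_le)
    then show ?thesis using that by (simp add: hyperlog_osuc_right osub_pos_iff less_imp_le)
  qed
  then show "up \<Lambda> (dia_ord s a) f"
    unfolding up_def using le by (metis linorder_not_le ordinal_zero_le)
qed

lemma dia_ord_zero: "dia_ord 0 a = osuc a"
  using hyperlog_dia_ord[of 0 a] by simp

primrec worm_ord :: "'a ordinal list \<Rightarrow> 'a ordinal" where
  "worm_ord [] = 0"
| "worm_ord (x # w) = dia_ord x (worm_ord w)"

lemma worm_ord_less: "set w \<subseteq> {..<\<Lambda>} \<Longrightarrow> worm_ord w < hyperexp \<Lambda> 1"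
proof (induction w)
  case (Cons x w)
  then have x: "x < \<Lambda>" and w: "worm_ord w < hyperexp \<Lambda> 1" by auto
  have "hyperlog x (worm_ord w) < hyperexp (osub x \<Lambda>) 1"
    using w x by (intro hyperlog_less_hyperexp_one) auto
  then have "osuc (hyperlog x (worm_ord w)) < hyperexp (osub x \<Lambda>) 1"
    using x by (intro osuc_less_hyperexp_one) (auto simp: osub_pos_iff less_imp_le)
  then show ?case using x w by (simp add: dia_ord_less)
qed simp

text \<open>Promoting all modalities by \<open>s\<close> moves the requirements \<open>s\<close>
  coordinates to the right, so the axis sequence of the promoted worm, read from \<open>s\<close>
  on, meets those of the original.\<close>

lemma hyperlog_worm_ord_shift:
  "hyperlog z (worm_ord w) \<le> hyperlog (s + z) (worm_ord (map ((+) s) w))"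
proof (induction w arbitrary: z)
  case (Cons x w)
  let ?b = "worm_ord (map ((+) s) (x # w))" and ?c = "worm_ord (map ((+) s) w)"
  let ?f = "\<lambda>z. hyperlog z (hyperlog s ?b)"
  define \<Lambda> where "\<Lambda> = osuc (max x z)"
  have xz: "x < \<Lambda>" "z < \<Lambda>" by (simp_all add: \<Lambda>_def less_osuc_iff)
  have "hyperlog y (worm_ord w) \<le> ?f y" if "y < x" for y
  proof -
    have "hyperlog (s + y) ?c \<le> hyperlog (s + y) ?b"
      using that hyperlog_le_dia_ord[of "s + y" "s + x" ?c] by simp
    then show ?thesis using Cons[of y] by (simp flip: hyperlog_add)
  qed
  moreover have "hyperlog x (worm_ord w) < ?f x"
  proof -
    have "?f x = osuc (hyperlog (s + x) ?c)"
      using hyperlog_dia_ord[of "s + x" ?c] by (simp flip: hyperlog_add)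
    then show ?thesis using Cons[of x] by (simp add: less_osuc_iff)
  qed
  ultimately have "up \<Lambda> (worm_ord (x # w)) ?f"
    using up_dia_ord_iff[OF lseq_hyperlog xz(1)] by simp
  then show ?case using xz(2) by (simp add: up_def hyperlog_add)
qed simp

text \<open>Follows the recursion for \<open>hyperexp \<Lambda> 1\<close> along \<Lambda> =
  \<open>wpow r + y\<close>. Iterating \<open>Dia 0\<close> exhausts \<omega> when \<Lambda> = 1,
  other powers of \<omega> are limits of smaller lengths, and for \<open>0 < y\<close> worms over
  \<open>y\<close>, promoted by \<open>wpow r\<close>, overtake the values of
  \<open>hyperexp (wpow r)\<close>.\<close>

lemma worm_ord_cofinal: "a < hyperexp \<Lambda> 1 \<Longrightarrow> \<exists>w. set w \<subseteq> {..<\<Lambda>} \<and> a \<le> worm_ord w"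
proof (induction \<Lambda> arbitrary: a rule: less_induct)
  case (less \<Lambda>)
  show ?case
  proof (cases "\<Lambda> = 0")
    case True
    then have "a = 0" using less.prems by simp
    then show ?thesis by (intro exI[of _ "[]"]) simp
  next
    case False
    then obtain r y where ry: "\<Lambda> = wpow r + y" "y < \<Lambda>"
      using ex_leading[of \<Lambda>] by (auto simp: ordinal_pos_iff)
    consider "y = 0" "r = 0" | "y = 0" "0 < r" | "0 < y" by (auto simp: ordinal_pos_iff)
    then show ?thesis
    proof cases
      case 1
      then have L: "\<Lambda> = 1" using ry by simp
      then have "hyperexp \<Lambda> 1 = wpow (osuc 0)"
        by (simp add: hyperexp_one oexp_pos) (simp add: one_ordinal_def)
      then have "a < 1 * omega" using less.prems by (simp add: wpow_osuc)
      then obtain n where n: "n < omega" "a < 1 * n"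
        using normal_limit_greater[OF normal_mult[OF one_pos_ordinal] olimit_omega] by blast
      have "\<exists>w. set w \<subseteq> {..<\<Lambda>} \<and> 1 * n \<le> worm_ord w" using n(1)
      proof (induction rule: omega_induct)
        case zero
        show ?case by (intro exI[of _ "[]"]) simp
      next
        case (osuc m)
        then obtain w where "set w \<subseteq> {..<\<Lambda>}" "1 * m \<le> worm_ord w" by blast
        then show ?case
          using L by (intro exI[of _ "0 # w"]) (simp add: dia_ord_zero ord_add_one)
      qed
      then show ?thesis using n(2) by (meson less_imp_le order_trans)
    next
      case 2
      \<comment> \<open>The successor clause of the hyperexponential at argument 0, where
        \<open>hyperexp (wpow r) 0 = 0\<close>.\<close>
      have "hyperexp \<Lambda> 1 = osup ((\<lambda>z. hyperexp z 1) ` {..<wpow r})"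
        using Esuc[OF is_hyperexp_hyperexp 2(2), of 0] ry 2(1) by (simp add: one_ordinal_def)
      then obtain z where z: "z < wpow r" "a < hyperexp z 1"
        using less.prems osup_image_le_iff[of "\<lambda>z. hyperexp z 1" "wpow r" a]
        by (auto simp: linorder_not_le[symmetric])
      moreover have "wpow r = \<Lambda>" using ry 2 by simp
      ultimately obtain w where "set w \<subseteq> {..<z}" "a \<le> worm_ord w" using less.IH by blast
      then show ?thesis using z(1) \<open>wpow r = \<Lambda>\<close> by (meson lessThan_subset_iff less_imp_le order_trans)
    next
      case 3
      have "a < hyperexp (wpow r) (hyperexp y 1)" using less.prems ry by (simp add: hyperexp_add)
      then obtain b where b: "b < hyperexp y 1" "a < hyperexp (wpow r) b"
        using normal_limit_greater[OF normal_hyperexp olimit_hyperexp_one[OF 3]] by blast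
      obtain w where w: "set w \<subseteq> {..<y}" "b \<le> worm_ord w" using less.IH[OF ry(2) b(1)] by blast
      let ?w = "map ((+) (wpow r)) w"
      have "worm_ord w \<le> hyperlog (wpow r) (worm_ord ?w)"
        using hyperlog_worm_ord_shift[of 0 w "wpow r"] by simp
      then have "hyperexp (wpow r) b \<le> worm_ord ?w"
        using w(2) by (intro le_hyperlogD) simp
      then have "a \<le> worm_ord ?w" using b(2) by simp
      moreover have "set ?w \<subseteq> {..<\<Lambda>}" using w(1) ry(1) by auto
      ultimately show ?thesis by blast
    qed
  qed
qed

section \<open>Derivations in the closed fragment\<close>

abbreviation Or :: "'a form \<Rightarrow> 'a form \<Rightarrow> 'a form"
  where "Or p q \<equiv> Neg (Conj (Neg p) (Neg q))"

definition entails :: "'a ordinal \<Rightarrow> 'a form \<Rightarrow> 'a form \<Rightarrow> bool"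
  where "entails \<Lambda> p q \<longleftrightarrow> GLP0 \<Lambda> (Imp p q)"

definition equivalent :: "'a ordinal \<Rightarrow> 'a form \<Rightarrow> 'a form \<Rightarrow> bool"
  where "equivalent \<Lambda> p q \<longleftrightarrow> entails \<Lambda> p q \<and> entails \<Lambda> q p"

text \<open>Propositional steps are reduced to all valuations \<open>v\<close>, with boxed formulas
  as atoms, so that simplification can settle them.\<close>

lemma GLP0_taut1:
  assumes "GLP0 \<Lambda> p" "in_lang \<Lambda> q" "\<And>v. prop_eval v p \<Longrightarrow> prop_eval v q"
  shows "GLP0 \<Lambda> q"
proof -
  have "GLP0 \<Lambda> (Imp p q)"
    using assms GLP0_in_lang[OF assms(1)] by (intro GLP0.Taut) (auto simp: tautology_def)
  then show ?thesis using assms(1) by (rule GLP0.MP)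
qed

lemma GLP0_taut2:
  assumes "GLP0 \<Lambda> p" "GLP0 \<Lambda> p'" "in_lang \<Lambda> q"
    "\<And>v. prop_eval v p \<Longrightarrow> prop_eval v p' \<Longrightarrow> prop_eval v q"
  shows "GLP0 \<Lambda> q"
proof -
  have "GLP0 \<Lambda> (Imp p' q)"
    using assms GLP0_in_lang[OF assms(2)] by (intro GLP0_taut1[OF assms(1)]) auto
  then show ?thesis using assms(2) by (rule GLP0.MP)
qed

lemma entails_lang: "entails \<Lambda> p q \<Longrightarrow> in_lang \<Lambda> p \<and> in_lang \<Lambda> q"
  unfolding entails_def by (drule GLP0_in_lang) simp

lemma equivalent_lang: "equivalent \<Lambda> p q \<Longrightarrow> in_lang \<Lambda> p \<and> in_lang \<Lambda> q"
  unfolding equivalent_def using entails_lang by blast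

lemma entails_taut:
  assumes "in_lang \<Lambda> p" "in_lang \<Lambda> q" "\<And>v. prop_eval v p \<Longrightarrow> prop_eval v q"
  shows "entails \<Lambda> p q"
  unfolding entails_def using assms by (intro GLP0.Taut) (auto simp: tautology_def)

lemma entails_taut1:
  assumes "entails \<Lambda> a b" "in_lang \<Lambda> p" "in_lang \<Lambda> q"
    "\<And>v. (prop_eval v a \<longrightarrow> prop_eval v b) \<Longrightarrow> prop_eval v p \<Longrightarrow> prop_eval v q"
  shows "entails \<Lambda> p q"
  unfolding entails_def
  by (rule GLP0_taut1[OF assms(1)[unfolded entails_def]]) (use assms(2-4) in auto)

lemma entails_taut2:
  assumes "entails \<Lambda> a b" "entails \<Lambda> c d" "in_lang \<Lambda> p" "in_lang \<Lambda> q"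
    "\<And>v. (prop_eval v a \<longrightarrow> prop_eval v b) \<Longrightarrow> (prop_eval v c \<longrightarrow> prop_eval v d) \<Longrightarrow>
      prop_eval v p \<Longrightarrow> prop_eval v q"
  shows "entails \<Lambda> p q"
  unfolding entails_def
  by (rule GLP0_taut2[OF assms(1,2)[unfolded entails_def]]) (use assms(3-5) in auto)

lemma entails_refl: "in_lang \<Lambda> p \<Longrightarrow> entails \<Lambda> p p"
  by (rule entails_taut)

lemma entails_trans [trans]: "entails \<Lambda> p q \<Longrightarrow> entails \<Lambda> q r \<Longrightarrow> entails \<Lambda> p r"
  by (rule entails_taut2[of \<Lambda> p q q r]) (use entails_lang in auto)

lemma entails_conj: "entails \<Lambda> p q \<Longrightarrow> entails \<Lambda> p r \<Longrightarrow> entails \<Lambda> p (Conj q r)"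
  by (rule entails_taut2[of \<Lambda> p q p r]) (use entails_lang in auto)

lemma entails_conj1: "in_lang \<Lambda> (Conj p q) \<Longrightarrow> entails \<Lambda> (Conj p q) p"
  and entails_conj2: "in_lang \<Lambda> (Conj p q) \<Longrightarrow> entails \<Lambda> (Conj p q) q"
  by (auto intro: entails_taut)

lemma entails_conj_mono:
  "entails \<Lambda> p p' \<Longrightarrow> entails \<Lambda> q q' \<Longrightarrow> entails \<Lambda> (Conj p q) (Conj p' q')"
  by (rule entails_taut2[of \<Lambda> p p' q q']) (use entails_lang in auto)

lemma entails_neg: "entails \<Lambda> p q \<Longrightarrow> entails \<Lambda> (Neg q) (Neg p)"
  by (rule entails_taut1[of \<Lambda> p q]) (use entails_lang in auto)

lemma equivalentI: "entails \<Lambda> p q \<Longrightarrow> entails \<Lambda> q p \<Longrightarrow> equivalent \<Lambda> p q"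
  by (simp add: equivalent_def)

lemma equivalentD: "equivalent \<Lambda> p q \<Longrightarrow> entails \<Lambda> p q" "equivalent \<Lambda> p q \<Longrightarrow> entails \<Lambda> q p"
  by (simp_all add: equivalent_def)

lemma equivalent_taut:
  "in_lang \<Lambda> p \<Longrightarrow> in_lang \<Lambda> q \<Longrightarrow> (\<And>v. prop_eval v p \<longleftrightarrow> prop_eval v q) \<Longrightarrow> equivalent \<Lambda> p q"
  by (intro equivalentI entails_taut) simp_all

lemma equivalent_refl: "in_lang \<Lambda> p \<Longrightarrow> equivalent \<Lambda> p p"
  by (simp add: equivalent_def entails_refl)

lemma equivalent_sym: "equivalent \<Lambda> p q \<Longrightarrow> equivalent \<Lambda> q p"
  by (auto simp: equivalent_def)

lemma equivalent_trans [trans]: "equivalent \<Lambda> p q \<Longrightarrow> equivalent \<Lambda> q r \<Longrightarrow> equivalent \<Lambda> p r"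
  unfolding equivalent_def using entails_trans by blast

lemma equivalent_neg: "equivalent \<Lambda> p q \<Longrightarrow> equivalent \<Lambda> (Neg p) (Neg q)"
  unfolding equivalent_def using entails_neg by blast

lemma equivalent_conj:
  "equivalent \<Lambda> p p' \<Longrightarrow> equivalent \<Lambda> q q' \<Longrightarrow> equivalent \<Lambda> (Conj p q) (Conj p' q')"
  unfolding equivalent_def by (simp add: entails_conj_mono)

section \<open>Modal derivations\<close>

lemma box_mono:
  assumes "entails \<Lambda> p q" "x < \<Lambda>"
  shows "entails \<Lambda> (Box x p) (Box x q)"
proof -
  have l: "in_lang \<Lambda> p" "in_lang \<Lambda> q" using entails_lang assms by blast+
  have "GLP0 \<Lambda> (Box x (Imp p q))"
    using assms unfolding entails_def by (intro GLP0.Nec)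
  with GLP0.K[OF assms(2) l] show ?thesis unfolding entails_def by (rule GLP0.MP)
qed

lemma dia_mono: "entails \<Lambda> p q \<Longrightarrow> x < \<Lambda> \<Longrightarrow> entails \<Lambda> (Dia x p) (Dia x q)"
  by (intro entails_neg box_mono)

lemma equivalent_dia: "equivalent \<Lambda> p q \<Longrightarrow> x < \<Lambda> \<Longrightarrow> equivalent \<Lambda> (Dia x p) (Dia x q)"
  unfolding equivalent_def by (simp add: dia_mono)

lemma box_conj:
  assumes "x < \<Lambda>" "in_lang \<Lambda> p" "in_lang \<Lambda> q"
  shows "entails \<Lambda> (Conj (Box x p) (Box x q)) (Box x (Conj p q))"
proof -
  have "entails \<Lambda> p (Imp q (Conj p q))" using assms by (intro entails_taut) auto
  then have "entails \<Lambda> (Box x p) (Box x (Imp q (Conj p q)))" using assms(1) by (rule box_mono)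
  moreover have "entails \<Lambda> (Box x (Imp q (Conj p q))) (Imp (Box x q) (Box x (Conj p q)))"
    using GLP0.K[of x \<Lambda> q "Conj p q"] assms by (simp add: entails_def)
  ultimately have "entails \<Lambda> (Box x p) (Imp (Box x q) (Box x (Conj p q)))"
    by (rule entails_trans)
  then show ?thesis by (rule entails_taut1) (use assms in auto)
qed

lemma dia_box:
  assumes "x < \<Lambda>" "in_lang \<Lambda> p" "in_lang \<Lambda> q"
  shows "entails \<Lambda> (Conj (Dia x p) (Box x q)) (Dia x (Conj p q))"
proof -
  have "entails \<Lambda> (Conj (Neg (Conj p q)) q) (Neg p)" using assms by (intro entails_taut) auto
  then have "entails \<Lambda> (Box x (Conj (Neg (Conj p q)) q)) (Box x (Neg p))" using assms(1) by (rule box_mono)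
  moreover have "entails \<Lambda> (Conj (Box x (Neg (Conj p q))) (Box x q)) (Box x (Conj (Neg (Conj p q)) q))"
    using assms by (intro box_conj) auto
  ultimately show ?thesis by (rule entails_taut2) (use assms in auto)
qed

lemma dia_falsum: "x < \<Lambda> \<Longrightarrow> entails \<Lambda> (Dia x Falsum) Falsum"
proof -
  assume x: "x < \<Lambda>"
  have "GLP0 \<Lambda> (Neg Falsum)" by (rule GLP0.Taut) (simp_all add: tautology_def)
  then have "GLP0 \<Lambda> (Box x (Neg Falsum))" using x by (intro GLP0.Nec)
  then show ?thesis unfolding entails_def by (rule GLP0_taut1) (use x in auto)
qed

lemma dia_or:
  assumes "x < \<Lambda>" "in_lang \<Lambda> p" "in_lang \<Lambda> q"
  shows "equivalent \<Lambda> (Dia x (Or p q)) (Or (Dia x p) (Dia x q))"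
proof (rule equivalentI)
  have "entails \<Lambda> (Conj (Neg p) (Neg q)) (Neg (Or p q))" using assms by (intro entails_taut) auto
  then have "entails \<Lambda> (Box x (Conj (Neg p) (Neg q))) (Box x (Neg (Or p q)))" using assms(1) by (rule box_mono)
  moreover have "entails \<Lambda> (Conj (Box x (Neg p)) (Box x (Neg q))) (Box x (Conj (Neg p) (Neg q)))"
    using assms by (intro box_conj) auto
  ultimately show "entails \<Lambda> (Dia x (Or p q)) (Or (Dia x p) (Dia x q))"
    by (rule entails_taut2) (use assms in auto)
  have "entails \<Lambda> (Dia x p) (Dia x (Or p q))" "entails \<Lambda> (Dia x q) (Dia x (Or p q))"
    using assms by (auto intro!: dia_mono entails_taut)
  then show "entails \<Lambda> (Or (Dia x p) (Dia x q)) (Dia x (Or p q))"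
    by (rule entails_taut2) (use assms in auto)
qed

text \<open>Loeb's axiom for \<open>Neg p\<close>, contraposed: a successor satisfying
  \<open>p\<close> may be chosen without further such successors.\<close>

lemma dia_loeb:
  assumes "x < \<Lambda>" "in_lang \<Lambda> p"
  shows "entails \<Lambda> (Dia x p) (Dia x (Conj p (Neg (Dia x p))))"
proof -
  let ?n = "Neg p"
  have "entails \<Lambda> (Neg (Conj p (Neg (Dia x p)))) (Imp (Box x ?n) ?n)"
    using assms by (intro entails_taut) auto
  then have "entails \<Lambda> (Box x (Neg (Conj p (Neg (Dia x p))))) (Box x (Imp (Box x ?n) ?n))"
    using assms(1) by (rule box_mono)
  moreover have "entails \<Lambda> (Box x (Imp (Box x ?n) ?n)) (Box x ?n)"
    using GLP0.Loeb[of x \<Lambda> ?n] assms by (simp add: entails_def)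
  ultimately show ?thesis by (rule entails_taut2) (use assms in auto)
qed

text \<open>Transitivity is a consequence of Loeb's axiom applied to \<open>Conj p (Box x p)\<close>.\<close>

lemma box_trans:
  assumes "x < \<Lambda>" "in_lang \<Lambda> p"
  shows "entails \<Lambda> (Box x p) (Box x (Box x p))"
proof -
  let ?q = "Conj p (Box x p)"
  have qp: "entails \<Lambda> (Box x ?q) (Box x p)" using assms by (intro box_mono entails_conj1) auto
  have "entails \<Lambda> p (Imp (Box x ?q) ?q)" by (rule entails_taut1[OF qp]) (use assms in auto)
  then have "entails \<Lambda> (Box x p) (Box x (Imp (Box x ?q) ?q))" using assms(1) by (rule box_mono)
  also have "entails \<Lambda> \<dots> (Box x ?q)"
    using GLP0.Loeb[of x \<Lambda> ?q] assms by (simp add: entails_def)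
  also have "entails \<Lambda> \<dots> (Box x (Box x p))" using assms by (intro box_mono entails_conj2) auto
  finally show ?thesis .
qed

lemma dia_trans:
  assumes "x < \<Lambda>" "in_lang \<Lambda> p"
  shows "entails \<Lambda> (Dia x (Dia x p)) (Dia x p)"
proof -
  have "entails \<Lambda> (Box x (Neg p)) (Neg (Dia x p))" using assms by (intro entails_taut) auto
  then have "entails \<Lambda> (Box x (Box x (Neg p))) (Box x (Neg (Dia x p)))" using assms(1) by (rule box_mono)
  moreover have "entails \<Lambda> (Box x (Neg p)) (Box x (Box x (Neg p)))"
    using assms by (intro box_trans) auto
  ultimately show ?thesis by (rule entails_taut2) (use assms in auto)
qed

lemma dia_lower: "x \<le> z \<Longrightarrow> z < \<Lambda> \<Longrightarrow> in_lang \<Lambda> p \<Longrightarrow> entails \<Lambda> (Dia z p) (Dia x p)"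
  by (cases "x = z") (auto simp: entails_def intro: GLP0.Mono entails_refl[unfolded entails_def])

text \<open>\<open>Dia x\<close> commutes with conjunction by a stable formula (\<open>dia_conj_stable\<close>).\<close>

definition stable :: "'a ordinal \<Rightarrow> 'a ordinal \<Rightarrow> 'a form \<Rightarrow> bool"
  where "stable \<Lambda> x l \<longleftrightarrow> entails \<Lambda> l (Box x l) \<and> entails \<Lambda> (Dia x l) l"

lemma stable_lang: "stable \<Lambda> x l \<Longrightarrow> in_lang \<Lambda> l"
  unfolding stable_def using entails_lang by blast

text \<open>Negation exchanges the two halves of stability.\<close>

lemma stable_neg:
  assumes "stable \<Lambda> x l" "x < \<Lambda>"
  shows "stable \<Lambda> x (Neg l)"
proof -
  note l = stable_lang[OF assms(1)]
  have "entails \<Lambda> (Neg l) (Box x (Neg l))"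
    by (rule entails_taut1[of \<Lambda> "Dia x l" l]) (use assms l in \<open>auto simp: stable_def\<close>)
  moreover have "entails \<Lambda> l (Neg (Neg l))" using l by (intro entails_taut) auto
  then have b: "entails \<Lambda> (Box x l) (Box x (Neg (Neg l)))" using assms(2) by (rule box_mono)
  have "entails \<Lambda> (Dia x (Neg l)) (Neg l)"
    by (rule entails_taut2[OF _ b, of l "Box x l"]) (use assms l in \<open>auto simp: stable_def\<close>)
  ultimately show ?thesis by (simp add: stable_def)
qed

lemma stable_conj:
  assumes "stable \<Lambda> x k" "stable \<Lambda> x l" "x < \<Lambda>"
  shows "stable \<Lambda> x (Conj k l)"
proof -
  note kl = stable_lang[OF assms(1)] stable_lang[OF assms(2)]
  have "entails \<Lambda> (Conj k l) (Conj (Box x k) (Box x l))"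
    using assms by (intro entails_conj_mono) (simp_all add: stable_def)
  also have "entails \<Lambda> \<dots> (Box x (Conj k l))" using assms kl by (intro box_conj)
  finally have 1: "entails \<Lambda> (Conj k l) (Box x (Conj k l))" .
  have "entails \<Lambda> (Dia x (Conj k l)) (Dia x k)" "entails \<Lambda> (Dia x (Conj k l)) (Dia x l)"
    using kl assms by (auto intro!: dia_mono entails_conj1 entails_conj2)
  then have "entails \<Lambda> (Dia x (Conj k l)) (Conj k l)"
    using assms by (intro entails_conj) (auto simp: stable_def intro: entails_trans)
  with 1 show ?thesis by (simp add: stable_def)
qed

text \<open>One half is the axiom \<open>Neg_Intro\<close>; the other lowers \<open>x\<close> to
  \<open>z\<close> and uses transitivity.\<close>

lemma stable_dia:
  assumes "z < x" "x < \<Lambda>" "in_lang \<Lambda> p"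
  shows "stable \<Lambda> x (Dia z p)"
proof -
  have z: "z < \<Lambda>" using assms by (meson order.strict_trans)
  have "entails \<Lambda> (Dia x (Dia z p)) (Dia z (Dia z p))"
    using assms z by (intro dia_lower) auto
  also have "entails \<Lambda> \<dots> (Dia z p)" using z assms by (intro dia_trans)
  finally show ?thesis using GLP0.Neg_Intro[OF assms] by (simp add: stable_def entails_def)
qed

lemma dia_conj_stable:
  assumes "stable \<Lambda> x l" "x < \<Lambda>" "in_lang \<Lambda> p"
  shows "equivalent \<Lambda> (Dia x (Conj p l)) (Conj (Dia x p) l)"
proof (rule equivalentI)
  note l = stable_lang[OF assms(1)]
  have "entails \<Lambda> (Dia x (Conj p l)) (Dia x l)"
    using assms l by (intro dia_mono entails_conj2) auto
  then have "entails \<Lambda> (Dia x (Conj p l)) l"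
    using assms by (auto simp: stable_def intro: entails_trans)
  then show "entails \<Lambda> (Dia x (Conj p l)) (Conj (Dia x p) l)"
    using assms l by (auto intro!: entails_conj dia_mono entails_conj1)
  have "entails \<Lambda> (Conj (Dia x p) l) (Conj (Dia x p) (Box x l))"
    using assms by (intro entails_conj_mono entails_refl) (auto simp: stable_def)
  also have "entails \<Lambda> \<dots> (Dia x (Conj p l))" using assms l by (intro dia_box)
  finally show "entails \<Lambda> (Conj (Dia x p) l) (Dia x (Conj p l))" .
qed

section \<open>Worms\<close>

primrec worm :: "'a ordinal list \<Rightarrow> 'a form" where
  "worm [] = Neg Falsum"
| "worm (x # w) = Dia x (worm w)"

lemma in_lang_worm [simp]: "in_lang \<Lambda> (worm w) \<longleftrightarrow> set w \<subseteq> {..<\<Lambda>}"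
  by (induction w) auto

lemma entails_top: "in_lang \<Lambda> p \<Longrightarrow> entails \<Lambda> p (worm [])"
  by (rule entails_taut) auto

lemma stable_worm_Nil: "x < \<Lambda> \<Longrightarrow> stable \<Lambda> x (worm [])"
proof -
  assume x: "x < \<Lambda>"
  have "GLP0 \<Lambda> (worm [])" by (rule GLP0.Taut) (simp_all add: tautology_def)
  then have "GLP0 \<Lambda> (Box x (worm []))" using x by (intro GLP0.Nec)
  then have "entails \<Lambda> (worm []) (Box x (worm []))"
    unfolding entails_def by (rule GLP0_taut1) (use x in auto)
  then show ?thesis using x by (simp add: stable_def entails_top[simplified])
qed

text \<open>Every modality of \<open>u\<close> exceeds the first one of \<open>v\<close>, so
  \<open>worm v\<close> is stable for all of them and can be pulled out of \<open>u\<close> one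
  diamond at a time.\<close>

lemma worm_append:
  assumes "set (u @ v) \<subseteq> {..<\<Lambda>}" "v = [] \<or> (\<forall>a\<in>set u. hd v < a)"
  shows "equivalent \<Lambda> (worm (u @ v)) (Conj (worm u) (worm v))"
  using assms
proof (induction u)
  case Nil
  then show ?case by (intro equivalent_taut) auto
next
  case (Cons a u)
  have l: "a < \<Lambda>" "in_lang \<Lambda> (worm u)" using Cons.prems by auto
  have st: "stable \<Lambda> a (worm v)"
  proof (cases "v = []")
    case True
    then show ?thesis using stable_worm_Nil[OF l(1)] by simp
  next
    case False
    then obtain z w where v: "v = z # w" by (cases v) auto
    then have "in_lang \<Lambda> (worm w)" "z < a" using Cons.prems by auto
    then show ?thesis using stable_dia[of z a \<Lambda> "worm w"] v l(1) by simp
  qed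
  have "equivalent \<Lambda> (worm (u @ v)) (Conj (worm u) (worm v))" using Cons by auto
  then have "equivalent \<Lambda> (Dia a (worm (u @ v))) (Dia a (Conj (worm u) (worm v)))"
    using l(1) by (rule equivalent_dia)
  also have "equivalent \<Lambda> \<dots> (Conj (Dia a (worm u)) (worm v))"
    using st l by (rule dia_conj_stable)
  finally show ?case by simp
qed

text \<open>The cut is at the first modality below \<open>x\<close>, so that the remainder is empty
  or starts with a smaller modality, and is stable for \<open>x\<close> in either case.\<close>

definition head :: "'a ordinal \<Rightarrow> 'a ordinal list \<Rightarrow> 'a ordinal list"
  where "head x w = takeWhile (\<lambda>a. x \<le> a) w"

definition rest :: "'a ordinal \<Rightarrow> 'a ordinal list \<Rightarrow> 'a ordinal list"
  where "rest x w = dropWhile (\<lambda>a. x \<le> a) w"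

lemma head_rest: "head x w @ rest x w = w"
  by (simp add: head_def rest_def)

lemma set_head: "set (head x w) \<subseteq> set w" "set (head x w) \<subseteq> {x..}"
  unfolding head_def by (auto dest: set_takeWhileD)

lemma set_rest: "set (rest x w) \<subseteq> set w"
  unfolding rest_def by (auto dest: set_dropWhileD)

lemma rest_cases:
  obtains "rest x w = []" | z v where "rest x w = z # v" "z < x"
  using hd_dropWhile[of "\<lambda>a. x \<le> a" w] unfolding rest_def by (metis linorder_not_le list.exhaust_sel)

lemma worm_head_rest:
  assumes "set w \<subseteq> {..<\<Lambda>}"
  shows "equivalent \<Lambda> (worm w) (Conj (worm (head x w)) (worm (rest x w)))"
proof -
  have "equivalent \<Lambda> (worm (head x w @ rest x w)) (Conj (worm (head x w)) (worm (rest x w)))"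
  proof (rule worm_append)
    show "rest x w = [] \<or> (\<forall>a\<in>set (head x w). hd (rest x w) < a)"
    proof (rule rest_cases[of x w])
      fix z v assume "rest x w = z # v" "z < x"
      then show ?thesis using set_head(2)[of x w] by (auto intro: order.strict_trans2)
    qed simp
  qed (use assms in \<open>simp only: head_rest\<close>)
  then show ?thesis by (simp add: head_rest)
qed

lemma equivalent_conjD1: "equivalent \<Lambda> r (Conj p q) \<Longrightarrow> entails \<Lambda> r p"
  and equivalent_conjD2: "equivalent \<Lambda> r (Conj p q) \<Longrightarrow> entails \<Lambda> r q"
  using entails_trans[OF equivalentD(1) entails_conj1] entails_trans[OF equivalentD(1) entails_conj2]
    equivalent_lang by blast+

lemma equivalent_conjI:
  "equivalent \<Lambda> r (Conj p q) \<Longrightarrow> entails \<Lambda> s p \<Longrightarrow> entails \<Lambda> s q \<Longrightarrow> entails \<Lambda> s r"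
  using entails_trans[OF entails_conj equivalentD(2)] by blast

lemma entails_head: "set w \<subseteq> {..<\<Lambda>} \<Longrightarrow> entails \<Lambda> (worm w) (worm (head x w))"
  and entails_rest: "set w \<subseteq> {..<\<Lambda>} \<Longrightarrow> entails \<Lambda> (worm w) (worm (rest x w))"
  using equivalent_conjD1 equivalent_conjD2 worm_head_rest by blast+

lemma stable_rest:
  assumes "set w \<subseteq> {..<\<Lambda>}" "x < \<Lambda>"
  shows "stable \<Lambda> x (worm (rest x w))"
proof (rule rest_cases[of x w])
  assume "rest x w = []"
  then show ?thesis using stable_worm_Nil[OF assms(2)] by simp
next
  fix z v assume zv: "rest x w = z # v" "z < x"
  then have "set v \<subseteq> {..<\<Lambda>}" using set_rest[of x w] assms(1) by auto
  then show ?thesis using zv assms(2) stable_dia[of z x \<Lambda> "worm v"] by simp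
qed

text \<open>As \<open>m\<close> bounds the modalities from below, cutting at \<open>osuc m\<close>
  splits \<open>w\<close> at its first \<open>m\<close>, if there is one. Both pieces are then
  shorter, which drives the recursions on worms.\<close>

lemma rest_osuc_cases:
  assumes "set w \<subseteq> {m..}"
  obtains "rest (osuc m) w = []" "m \<notin> set w" | v where "rest (osuc m) w = m # v" "m \<in> set w" "set v \<subseteq> set w"
    "length v < length w" "length (head (osuc m) w) < length w"
proof (rule rest_cases[of "osuc m" w])
  assume r: "rest (osuc m) w = []"
  then have "head (osuc m) w = w" using head_rest[of "osuc m" w] by simp
  then have "m \<notin> set w" using set_head(2)[of "osuc m" w] by (auto simp: osuc_le_iff)
  then show thesis using that r by blast
next
  fix z v assume r: "rest (osuc m) w = z # v" "z < osuc m"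
  have sub: "set (z # v) \<subseteq> set w" using set_rest[of "osuc m" w] r(1) by simp
  then have "m \<le> z" using assms by auto
  then have z: "z = m" using r(2) by (simp add: less_osuc_iff)
  have "length w = length (head (osuc m) w) + Suc (length v)"
    using arg_cong[OF head_rest[of "osuc m" w], of length] r(1) by simp
  then show thesis using that(2)[of v] r(1) sub z by auto
qed

section \<open>Linear order and conjunction of worms\<close>

definition comparable :: "'a ordinal \<Rightarrow> 'a ordinal \<Rightarrow> 'a ordinal list \<Rightarrow> 'a ordinal list \<Rightarrow> bool"
  where "comparable \<Lambda> x u v \<longleftrightarrow> equivalent \<Lambda> (worm u) (worm v) \<or>
    entails \<Lambda> (worm u) (Dia x (worm v)) \<or> entails \<Lambda> (worm v) (Dia x (worm u))"

lemma dia_absorb: "entails \<Lambda> p (Dia x q) \<Longrightarrow> entails \<Lambda> (Dia x p) (Dia x q)"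
  using entails_lang[of \<Lambda> p "Dia x q"] by (auto intro!: entails_trans[OF dia_mono dia_trans])

lemma comparable_dia:
  assumes "comparable \<Lambda> x u v" "x < \<Lambda>"
  shows "entails \<Lambda> (Dia x (worm u)) (Dia x (worm v)) \<or> entails \<Lambda> (worm v) (Dia x (worm u))"
  using assms dia_absorb dia_mono equivalentD(1) unfolding comparable_def by blast

lemma subset_interval_iff: "A \<subseteq> {x..<y} \<longleftrightarrow> A \<subseteq> {x..} \<and> A \<subseteq> {..<y}" for x y :: "'a ordinal"
  by auto

text \<open>Both worms are split at the first occurrence of their least modality \<open>m\<close>.
  Comparing what follows \<open>m\<close> with the whole other worm, by induction, settles the
  matter unless each worm entails the remainder of the other; then the heads, compared at
  \<open>osuc m\<close>, decide.\<close>

lemma worm_comparable: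
  assumes "set u \<subseteq> {x..<\<Lambda>}" "set v \<subseteq> {x..<\<Lambda>}"
  shows "comparable \<Lambda> x u v"
  using assms
proof (induction "length u + length v" arbitrary: u v x rule: less_induct)
  case less
  show ?case
  proof (cases "set u \<union> set v = {}")
    case True
    then show ?thesis by (simp add: comparable_def equivalent_refl)
  next
    case False
    define m where "m = Min (set u \<union> set v)"
    have m: "m \<in> set u \<union> set v" unfolding m_def by (rule Min_in) (use False in auto)
    have mle: "set u \<subseteq> {m..}" "set v \<subseteq> {m..}" by (auto simp: m_def)
    have xm: "x \<le> m" "m < \<Lambda>" using m less.prems by auto
    have lu: "set u \<subseteq> {..<\<Lambda>}" and lv: "set v \<subseteq> {..<\<Lambda>}" using less.prems by auto
    let ?s = "osuc m"
    have lower: "entails \<Lambda> p (Dia x q)" if "entails \<Lambda> p (Dia y q)" "x \<le> y" for p q y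
    proof -
      have "in_lang \<Lambda> (Dia y q)" using entails_lang that(1) by blast
      then show ?thesis using entails_trans[OF that(1) dia_lower[OF that(2)]] by simp
    qed
    \<comment> \<open>Comparing a proper suffix of one worm with the other worm either decides, or shows that
      each worm entails the rest of the other.\<close>
    have side: "comparable \<Lambda> x p q \<or> entails \<Lambda> (worm q) (worm (rest ?s p))"
      if p: "set p \<subseteq> {m..<\<Lambda>}" and q: "set q \<subseteq> {m..<\<Lambda>}" and len: "length p + length q = length u + length v"
      for p q
    proof (rule rest_osuc_cases[of p m])
      show "set p \<subseteq> {m..}" using p by auto
    next
      assume "rest ?s p = []"
      moreover have "in_lang \<Lambda> (worm q)" using q by auto
      ultimately show ?thesis using entails_top by metis
    next
      fix w assume w: "rest ?s p = m # w" "set w \<subseteq> set p" "length w < length p"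
      have lang: "in_lang \<Lambda> (worm w)" "in_lang \<Lambda> (worm q)" "set p \<subseteq> {..<\<Lambda>}"
        using p q w(2) unfolding subset_interval_iff in_lang_worm by blast+
      have "entails \<Lambda> (worm p) (Dia m (worm w))" using entails_rest[of p \<Lambda> ?s] lang(3) w(1) by simp
      moreover have "comparable \<Lambda> m w q"
        by (rule less.hyps) (use w p q len subset_trans[OF w(2)] in auto)
      then have "entails \<Lambda> (Dia m (worm w)) (Dia m (worm q)) \<or> entails \<Lambda> (worm q) (Dia m (worm w))"
        using xm(2) by (rule comparable_dia)
      ultimately have "entails \<Lambda> (worm p) (Dia m (worm q)) \<or> entails \<Lambda> (worm q) (Dia m (worm w))"
        using entails_trans by blast
      then show ?thesis using lower xm(1) w(1) by (auto simp: comparable_def)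
    qed
    \<comment> \<open>The remainder of \<open>q\<close> is stable for \<open>osuc m\<close>, so it
      joins the head under the diamond and rebuilds \<open>worm q\<close>; the diamond is then
      lowered to \<open>x\<close>.\<close>
    have top: "entails \<Lambda> (worm p) (Dia x (worm q))"
      if "set p \<subseteq> {..<\<Lambda>}" "set q \<subseteq> {..<\<Lambda>}" and h: "entails \<Lambda> (worm (head ?s p)) (Dia ?s (worm (head ?s q)))"
        and r: "entails \<Lambda> (worm p) (worm (rest ?s q))" for p q
    proof -
      have s: "?s < \<Lambda>" using entails_lang[OF h] by simp
      have "entails \<Lambda> (worm p) (Dia ?s (worm (head ?s q)))"
        using entails_trans[OF entails_head h] that(1) by blast
      then have "entails \<Lambda> (worm p) (Conj (Dia ?s (worm (head ?s q))) (worm (rest ?s q)))"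
        using r by (rule entails_conj)
      also have "entails \<Lambda> \<dots> (Dia ?s (Conj (worm (head ?s q)) (worm (rest ?s q))))"
        using dia_conj_stable[OF stable_rest[OF that(2) s] s] entails_lang[OF h] by (intro equivalentD(2)) simp
      also have "entails \<Lambda> \<dots> (Dia ?s (worm q))"
        using worm_head_rest[OF that(2), of ?s] s by (intro dia_mono) (simp_all add: equivalent_def)
      finally show ?thesis by (rule lower) (use xm(1) in \<open>simp add: less_osuc_iff less_imp_le\<close>)
    qed
    show ?thesis
    proof (cases "comparable \<Lambda> x u v \<or> comparable \<Lambda> x v u")
      case True
      then show ?thesis by (auto simp: comparable_def equivalent_def)
    next
      case False
      have sub: "set u \<subseteq> {m..<\<Lambda>}" "set v \<subseteq> {m..<\<Lambda>}" using mle lu lv by auto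
      have vu: "entails \<Lambda> (worm v) (worm (rest ?s u))" using side[OF sub] False by auto
      have uv: "entails \<Lambda> (worm u) (worm (rest ?s v))" using side[OF sub(2,1)] False by auto
      have len: "length (head ?s w) \<le> length w" "m \<in> set w \<Longrightarrow> length (head ?s w) < length w"
        if "set w \<subseteq> {m..}" for w
        by (use length_takeWhile_le[of _ w] in \<open>simp add: head_def\<close>)
          (rule rest_osuc_cases[OF that]; simp)
      have "comparable \<Lambda> ?s (head ?s u) (head ?s v)"
      proof (rule less.hyps)
        show "length (head ?s u) + length (head ?s v) < length u + length v"
          using m len[OF mle(1)] len[OF mle(2)] by auto
        show "set (head ?s u) \<subseteq> {?s..<\<Lambda>}" "set (head ?s v) \<subseteq> {?s..<\<Lambda>}"
          unfolding subset_interval_iff using set_head[of ?s u] set_head[of ?s v] lu lv by blast+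
      qed
      then consider "equivalent \<Lambda> (worm (head ?s u)) (worm (head ?s v))"
        | "entails \<Lambda> (worm (head ?s u)) (Dia ?s (worm (head ?s v)))"
        | "entails \<Lambda> (worm (head ?s v)) (Dia ?s (worm (head ?s u)))"
        unfolding comparable_def by blast
      then show ?thesis
      proof cases
        case 1
        have "entails \<Lambda> (worm p) (worm q)"
          if "set p \<subseteq> {..<\<Lambda>}" "set q \<subseteq> {..<\<Lambda>}" "entails \<Lambda> (worm (head ?s p)) (worm (head ?s q))"
            "entails \<Lambda> (worm p) (worm (rest ?s q))" for p q
        proof -
          have "entails \<Lambda> (worm p) (worm (head ?s q))"
            using entails_trans[OF entails_head that(3)] that(1) by blast
          then show ?thesis using equivalent_conjI[OF worm_head_rest[OF that(2)]] that(4) by blast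
        qed
        then show ?thesis using 1 lu lv uv vu by (simp add: comparable_def equivalent_def)
      next
        case 2
        then show ?thesis using top[OF lu lv _ uv] by (simp add: comparable_def)
      next
        case 3
        then show ?thesis using top[OF lv lu _ vu] by (simp add: comparable_def)
      qed
    qed
  qed
qed

text \<open>The heads above the least modality \<open>m\<close> are merged by induction into
  \<open>w\<close>. The remainders are empty or start with \<open>m\<close> and are linearly
  ordered, so the stronger one, \<open>R\<close>, stands for both; it can be appended to
  \<open>w\<close> because \<open>w\<close> has only modalities above \<open>m\<close>.\<close>

lemma worm_conj:
  assumes "set u \<subseteq> {..<\<Lambda>}" "set v \<subseteq> {..<\<Lambda>}"
  shows "\<exists>w. set w \<subseteq> set u \<union> set v \<and> equivalent \<Lambda> (worm w) (Conj (worm u) (worm v))"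
  using assms
proof (induction "length u + length v" arbitrary: u v rule: less_induct)
  case less
  show ?case
  proof (cases "set u \<union> set v = {}")
    case True
    then show ?thesis by (intro exI[of _ "[]"]) (auto intro: equivalent_taut)
  next
    case False
    define m where "m = Min (set u \<union> set v)"
    have m: "m \<in> set u \<union> set v" unfolding m_def by (rule Min_in) (use False in auto)
    have mle: "set u \<subseteq> {m..}" "set v \<subseteq> {m..}" by (auto simp: m_def)
    have mL: "m < \<Lambda>" using m less.prems by auto
    let ?s = "osuc m"
    have len: "length (head ?s w) \<le> length w" "m \<in> set w \<Longrightarrow> length (head ?s w) < length w"
      if "set w \<subseteq> {m..}" for w
      by (use length_takeWhile_le[of _ w] in \<open>simp add: head_def\<close>)
        (rule rest_osuc_cases[OF that]; simp)
    have hl: "length (head ?s u) + length (head ?s v) < length u + length v"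
      using m len[OF mle(1)] len[OF mle(2)] by auto
    have hs: "set (head ?s u) \<subseteq> {..<\<Lambda>}" "set (head ?s v) \<subseteq> {..<\<Lambda>}"
      using set_head(1)[of ?s u] set_head(1)[of ?s v] less.prems by auto
    obtain w where w: "set w \<subseteq> set (head ?s u) \<union> set (head ?s v)"
      "equivalent \<Lambda> (worm w) (Conj (worm (head ?s u)) (worm (head ?s v)))"
      using less.hyps[OF hl hs] by blast
    have rl: "in_lang \<Lambda> (worm (rest ?s u))" "in_lang \<Lambda> (worm (rest ?s v))"
      using set_rest[of ?s u] set_rest[of ?s v] less.prems by auto
    have "entails \<Lambda> (worm (rest ?s u)) (worm (rest ?s v)) \<or> entails \<Lambda> (worm (rest ?s v)) (worm (rest ?s u))"
    proof (rule rest_osuc_cases[OF mle(1)]; rule rest_osuc_cases[OF mle(2)])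
      fix p q assume p: "rest ?s u = m # p" "set p \<subseteq> set u" and q: "rest ?s v = m # q" "set q \<subseteq> set v"
      have pl: "set p \<subseteq> {m..<\<Lambda>}" "set q \<subseteq> {m..<\<Lambda>}"
        unfolding subset_interval_iff using p(2) q(2) mle less.prems by blast+
      have "entails \<Lambda> (Dia m (worm p)) (Dia m (worm q)) \<or> entails \<Lambda> (worm q) (Dia m (worm p))"
        using comparable_dia[OF worm_comparable[OF pl] mL] .
      then have "entails \<Lambda> (Dia m (worm p)) (Dia m (worm q)) \<or> entails \<Lambda> (Dia m (worm q)) (Dia m (worm p))"
        using dia_absorb by blast
      then show ?thesis using p q by simp
    qed (metis rl entails_top)+
    then obtain R where R: "R = rest ?s u \<or> R = rest ?s v"
      "entails \<Lambda> (worm R) (worm (rest ?s u))" "entails \<Lambda> (worm R) (worm (rest ?s v))"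
      using rl entails_refl by blast
    have Rsub: "set R \<subseteq> set u \<union> set v" using R(1) set_rest[of ?s u] set_rest[of ?s v] by auto
    have wsub: "set w \<subseteq> set u \<union> set v" "set w \<subseteq> {?s..}"
      using w(1) set_head[of ?s u] set_head[of ?s v] by blast+
    have wR: "equivalent \<Lambda> (worm (w @ R)) (Conj (worm w) (worm R))"
    proof (rule worm_append)
      have "rest ?s u = [] \<or> hd (rest ?s u) = m" by (rule rest_osuc_cases[OF mle(1)]) simp_all
      moreover have "rest ?s v = [] \<or> hd (rest ?s v) = m" by (rule rest_osuc_cases[OF mle(2)]) simp_all
      ultimately have "R = [] \<or> hd R = m" using R(1) by auto
      then show "R = [] \<or> (\<forall>a\<in>set w. hd R < a)" using wsub(2) by (auto simp: osuc_le_iff)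
    qed (use wsub Rsub less.prems in auto)
    let ?C = "Conj (worm u) (worm v)"
    have C: "in_lang \<Lambda> ?C" using less.prems by simp
    have one: "entails \<Lambda> (worm (w @ R)) (worm q)"
      if q: "set q \<subseteq> {..<\<Lambda>}" "entails \<Lambda> (worm w) (worm (head ?s q))" "entails \<Lambda> (worm R) (worm (rest ?s q))" for q
    proof -
      have "entails \<Lambda> (worm (w @ R)) (worm (head ?s q))" "entails \<Lambda> (worm (w @ R)) (worm (rest ?s q))"
        using entails_trans equivalent_conjD1[OF wR] equivalent_conjD2[OF wR] q(2,3) by blast+
      then show ?thesis by (rule equivalent_conjI[OF worm_head_rest[OF q(1)]])
    qed
    have to: "entails \<Lambda> (worm (w @ R)) ?C"
      using one[OF less.prems(1) equivalent_conjD1[OF w(2)] R(2)]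
        one[OF less.prems(2) equivalent_conjD2[OF w(2)] R(3)] by (rule entails_conj)
    have Cu: "entails \<Lambda> ?C (worm u)" and Cv: "entails \<Lambda> ?C (worm v)"
      using C by (auto intro: entails_conj1 entails_conj2)
    have "entails \<Lambda> ?C (worm w)"
      by (rule equivalent_conjI[OF w(2)])
        (use entails_trans[OF Cu entails_head] entails_trans[OF Cv entails_head] less.prems in blast)+
    moreover have "entails \<Lambda> ?C (worm R)"
      using R(1) entails_trans[OF Cu entails_rest] entails_trans[OF Cv entails_rest] less.prems by blast
    ultimately have "entails \<Lambda> ?C (worm (w @ R))" by (rule equivalent_conjI[OF wR])
    with to have "equivalent \<Lambda> (worm (w @ R)) ?C" by (simp add: equivalent_def)
    then show ?thesis using wsub(1) Rsub by (intro exI[of _ "w @ R"]) auto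
  qed
qed

text \<open>By Loeb, \<open>p\<close> entails \<open>Dia x\<close> of
  \<open>Conj p (Neg (Dia x p))\<close>, which the hypothesis makes contradictory.\<close>

lemma entails_dia_self:
  assumes "entails \<Lambda> p (Dia x p)" "x < \<Lambda>"
  shows "entails \<Lambda> p Falsum"
proof -
  have l: "in_lang \<Lambda> p" using entails_lang assms by blast
  have "entails \<Lambda> p (Dia x p)" by fact
  also have "entails \<Lambda> \<dots> (Dia x (Conj p (Neg (Dia x p))))" using assms(2) l by (rule dia_loeb)
  also have "entails \<Lambda> \<dots> (Dia x Falsum)"
    using assms(2) by (rule dia_mono[rotated]) (rule entails_taut1[OF assms(1)], use assms(2) l in auto)
  also have "entails \<Lambda> \<dots> Falsum" using assms(2) by (rule dia_falsum)
  finally show ?thesis .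
qed

lemma entails_falsum: "entails \<Lambda> p Falsum \<Longrightarrow> in_lang \<Lambda> q \<Longrightarrow> entails \<Lambda> p q"
  by (rule entails_taut1[of \<Lambda> p Falsum]) (use entails_lang[of \<Lambda> p Falsum] in auto)

text \<open>Let \<open>w\<close> be the conjunction as a worm and compare it with \<open>u\<close>.
  If \<open>u\<close> entails \<open>w\<close>, it entails \<open>v\<close>; if \<open>u\<close>
  entails \<open>Dia x\<close> of \<open>w\<close>, it entails its own diamond and is inconsistent.
  Only the claim remains.\<close>

lemma worm_conj_dia:
  assumes u: "set u \<subseteq> {x..<\<Lambda>}" and v: "set v \<subseteq> {x..<\<Lambda>}" and "x < \<Lambda>"
    and not: "\<not> entails \<Lambda> (worm u) (worm v)"
  shows "entails \<Lambda> (Conj (worm u) (worm v)) (Dia x (worm u))"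
proof -
  have l: "set u \<subseteq> {..<\<Lambda>}" "set v \<subseteq> {..<\<Lambda>}" using u v by auto
  then obtain w where w: "set w \<subseteq> set u \<union> set v" "equivalent \<Lambda> (worm w) (Conj (worm u) (worm v))"
    using worm_conj by blast
  note wu = equivalent_conjD1[OF w(2)] and wv = equivalent_conjD2[OF w(2)]
  have "comparable \<Lambda> x u w" using u v w(1) by (intro worm_comparable) auto
  then consider "entails \<Lambda> (worm u) (worm w)" | "entails \<Lambda> (worm u) (Dia x (worm w))"
    | "entails \<Lambda> (worm w) (Dia x (worm u))"
    unfolding comparable_def equivalent_def by blast
  then show ?thesis
  proof cases
    case 1
    then show ?thesis using entails_trans[OF 1 wv] not by blast
  next
    case 2
    then have "entails \<Lambda> (worm u) (Dia x (worm u))" using dia_mono[OF wu assms(3)] by (rule entails_trans)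
    then have "entails \<Lambda> (worm u) Falsum" using assms(3) by (rule entails_dia_self)
    then show ?thesis using not l by (simp add: entails_falsum)
  next
    case 3
    with equivalentD(2)[OF w(2)] show ?thesis by (rule entails_trans)
  qed
qed

section \<open>Normal forms\<close>

primrec negs :: "'a ordinal list list \<Rightarrow> 'a form" where
  "negs [] = worm []"
| "negs (v # vs) = Conj (Neg (worm v)) (negs vs)"

lemma in_lang_negs [simp]: "in_lang \<Lambda> (negs vs) \<longleftrightarrow> (\<forall>v\<in>set vs. set v \<subseteq> {..<\<Lambda>})"
  by (induction vs) auto

lemma entails_negs:
  assumes "in_lang \<Lambda> p" "\<And>v. v \<in> set vs \<Longrightarrow> entails \<Lambda> p (Neg (worm v))"
  shows "entails \<Lambda> p (negs vs)"
  using assms(2)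
proof (induction vs)
  case Nil
  then show ?case using assms(1) by (simp add: entails_top[simplified])
next
  case (Cons v vs)
  then show ?case by (auto intro: entails_conj)
qed

lemma negs_entails: "v \<in> set vs \<Longrightarrow> in_lang \<Lambda> (negs vs) \<Longrightarrow> entails \<Lambda> (negs vs) (Neg (worm v))"
  by (rule entails_taut) (auto, induction vs, auto)

inductive basic :: "'a ordinal \<Rightarrow> 'a form \<Rightarrow> bool" for \<Lambda> where
  basic_worm: "set w \<subseteq> {..<\<Lambda>} \<Longrightarrow> basic \<Lambda> (worm w)"
| basic_neg: "basic \<Lambda> p \<Longrightarrow> set v \<subseteq> {..<\<Lambda>} \<Longrightarrow> basic \<Lambda> (Conj p (Neg (worm v)))"

text \<open>Closed under provable equivalence by fiat, so that the Boolean and modal closure proofs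
  are inductions on \<open>nf\<close> rather than manipulations of lists of disjuncts.\<close>

inductive nf :: "'a ordinal \<Rightarrow> 'a form \<Rightarrow> bool" for \<Lambda> where
  nf_Falsum: "nf \<Lambda> Falsum"
| nf_basic: "basic \<Lambda> p \<Longrightarrow> nf \<Lambda> p"
| nf_Or: "nf \<Lambda> p \<Longrightarrow> nf \<Lambda> q \<Longrightarrow> nf \<Lambda> (Or p q)"
| nf_equivalent: "nf \<Lambda> p \<Longrightarrow> equivalent \<Lambda> q p \<Longrightarrow> nf \<Lambda> q"

lemma basic_lang: "basic \<Lambda> p \<Longrightarrow> in_lang \<Lambda> p"
  by (induction rule: basic.induct) auto

lemma nf_lang: "nf \<Lambda> p \<Longrightarrow> in_lang \<Lambda> p"
  by (induction rule: nf.induct) (auto simp: basic_lang dest: equivalent_lang)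

lemma nf_conj_neg_worm:
  assumes "nf \<Lambda> p" "set v \<subseteq> {..<\<Lambda>}"
  shows "nf \<Lambda> (Conj p (Neg (worm v)))"
  using assms(1)
proof induction
  case nf_Falsum
  show ?case by (rule nf_equivalent[OF nf.nf_Falsum], rule equivalent_taut) (use assms(2) in auto)
next
  case (nf_basic p)
  then show ?case using assms(2) by (intro nf.nf_basic basic_neg)
next
  case (nf_Or p q)
  show ?case
    by (rule nf_equivalent[OF nf.nf_Or[OF nf_Or.IH]], rule equivalent_taut)
      (use assms(2) nf_Or.hyps nf_lang in auto)
next
  case (nf_equivalent p q)
  then show ?case using assms(2)
    by (intro nf.nf_equivalent[OF nf_equivalent.IH] equivalent_conj equivalent_refl) auto
qed

text \<open>A positive worm is merged by \<open>worm_conj\<close>; negated worms are carried along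
  unchanged.\<close>

lemma nf_conj_worm:
  assumes "nf \<Lambda> p" "set v \<subseteq> {..<\<Lambda>}"
  shows "nf \<Lambda> (Conj p (worm v))"
  using assms(1)
proof induction
  case nf_Falsum
  show ?case by (rule nf_equivalent[OF nf.nf_Falsum], rule equivalent_taut) (use assms(2) in auto)
next
  case (nf_basic p)
  then show ?case
  proof induction
    case (basic_worm u)
    then obtain w where w: "set w \<subseteq> set u \<union> set v" "equivalent \<Lambda> (worm w) (Conj (worm u) (worm v))"
      using worm_conj[of u \<Lambda> v] assms(2) by blast
    have "nf \<Lambda> (worm w)" using w(1) basic_worm assms(2) by (intro nf.nf_basic basic.basic_worm) auto
    then show ?case using nf.nf_equivalent equivalent_sym w(2) by blast
  next
    case (basic_neg p u)
    show ?case
      by (rule nf_equivalent[OF nf_conj_neg_worm[OF basic_neg.IH basic_neg.hyps(2)]], rule equivalent_taut)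
        (use assms(2) basic_neg.hyps basic_lang in auto)
  qed
next
  case (nf_Or p q)
  show ?case
    by (rule nf_equivalent[OF nf.nf_Or[OF nf_Or.IH]], rule equivalent_taut)
      (use assms(2) nf_Or.hyps nf_lang in auto)
next
  case (nf_equivalent p q)
  then show ?case using assms(2)
    by (intro nf.nf_equivalent[OF nf_equivalent.IH] equivalent_conj equivalent_refl) auto
qed

lemma nf_Conj:
  assumes p: "nf \<Lambda> p" and q: "nf \<Lambda> q"
  shows "nf \<Lambda> (Conj p q)"
  using q
proof induction
  case nf_Falsum
  show ?case by (rule nf_equivalent[OF nf.nf_Falsum], rule equivalent_taut) (use nf_lang[OF p] in auto)
next
  case (nf_basic q)
  then show ?case
  proof induction
    case (basic_worm w)
    then show ?case by (rule nf_conj_worm[OF p])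
  next
    case (basic_neg q v)
    show ?case
      by (rule nf_equivalent[OF nf_conj_neg_worm[OF basic_neg.IH basic_neg.hyps(2)]], rule equivalent_taut)
        (use nf_lang[OF p] basic_neg.hyps basic_lang in auto)
  qed
next
  case (nf_Or q r)
  show ?case
    by (rule nf_equivalent[OF nf.nf_Or[OF nf_Or.IH]], rule equivalent_taut)
      (use nf_lang[OF p] nf_Or.hyps nf_lang in auto)
next
  case (nf_equivalent q r)
  then show ?case using nf_lang[OF p]
    by (intro nf.nf_equivalent[OF nf_equivalent.IH] equivalent_conj equivalent_refl) auto
qed

lemma nf_Neg: "nf \<Lambda> p \<Longrightarrow> nf \<Lambda> (Neg p)"
proof (induction rule: nf.induct)
  case nf_Falsum
  have "basic \<Lambda> (worm [])" by (rule basic_worm) simp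
  then show ?case by (simp add: nf_basic)
next
  case (nf_basic p)
  then show ?case
  proof induction
    case (basic_worm w)
    have "basic \<Lambda> (Conj (worm []) (Neg (worm w)))" using basic_worm by (intro basic.intros) auto
    then show ?case
      by (rule nf_equivalent[OF nf.nf_basic]) (rule equivalent_taut, use basic_worm in auto)
  next
    case (basic_neg p v)
    then have "nf \<Lambda> (worm v)" by (intro nf.nf_basic basic_worm)
    then show ?case
      by (rule nf_equivalent[OF nf_Or[OF basic_neg.IH]]) (rule equivalent_taut, use basic_neg basic_lang in auto)
  qed
next
  case (nf_Or p q)
  show ?case
    by (rule nf_equivalent[OF nf_Conj[OF nf_Or.IH]], rule equivalent_taut)
      (use nf_Or.hyps nf_lang in auto)
next
  case (nf_equivalent p q)
  then show ?case by (intro nf.nf_equivalent[OF nf_equivalent.IH] equivalent_neg)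
qed

text \<open>By Loeb's axiom one may pass to a successor refuting \<open>Dia x (worm u)\<close>; there every worm not
  entailed by \<open>u\<close> fails.\<close>

lemma dia_worm_negs:
  assumes "x < \<Lambda>" "set u \<subseteq> {x..<\<Lambda>}" "\<And>v. v \<in> set vs \<Longrightarrow> set v \<subseteq> {x..<\<Lambda>}"
  shows "nf \<Lambda> (Dia x (Conj (worm u) (negs vs)))"
proof -
  have l: "in_lang \<Lambda> (worm u)" "in_lang \<Lambda> (negs vs)" using assms by fastforce+
  have lv: "in_lang \<Lambda> (worm v)" if "v \<in> set vs" for v using assms(3)[OF that] by auto
  show ?thesis
  proof (cases "\<exists>v\<in>set vs. entails \<Lambda> (worm u) (worm v)")
    case True
    then obtain v where v: "v \<in> set vs" "entails \<Lambda> (worm u) (worm v)" by blast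
    have "entails \<Lambda> (Conj (worm u) (negs vs)) Falsum"
      by (rule entails_taut2[OF v(2) negs_entails[OF v(1) l(2)]]) (use l in auto)
    then have "entails \<Lambda> (Dia x (Conj (worm u) (negs vs))) Falsum"
      using dia_mono dia_falsum entails_trans assms(1) by blast
    then show ?thesis
      by (intro nf_equivalent[OF nf_Falsum] equivalentI)
        (use l assms(1) in \<open>auto intro!: entails_taut\<close>)
  next
    case False
    let ?p = "Conj (worm u) (Neg (Dia x (worm u)))"
    have lp: "in_lang \<Lambda> ?p" using l assms(1) by simp
    have "entails \<Lambda> ?p (Neg (worm v))" if v: "v \<in> set vs" for v
    proof -
      have "entails \<Lambda> (Conj (worm u) (worm v)) (Dia x (worm u))"
        using assms v False by (intro worm_conj_dia) auto
      then show ?thesis by (rule entails_taut1) (use lp lv[OF v] in auto)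
    qed
    then have "entails \<Lambda> ?p (Conj (worm u) (negs vs))"
      using lp by (intro entails_conj entails_conj1 entails_negs)
    then have "entails \<Lambda> (Dia x (worm u)) (Dia x (Conj (worm u) (negs vs)))"
      using dia_loeb[OF assms(1) l(1)] dia_mono assms(1) entails_trans by blast
    moreover have "entails \<Lambda> (Dia x (Conj (worm u) (negs vs))) (Dia x (worm u))"
      using l assms(1) by (intro dia_mono entails_conj1) auto
    ultimately have "equivalent \<Lambda> (Dia x (Conj (worm u) (negs vs))) (worm (x # u))"
      by (simp add: equivalent_def)
    moreover have "basic \<Lambda> (worm (x # u))" using l assms(1) by (intro basic_worm) auto
    ultimately show ?thesis using nf_basic nf_equivalent by blast
  qed
qed

text \<open>Entries below \<open>x\<close> are moved out of the scope of \<open>Dia x\<close> as stable conjuncts \<open>l\<close>.\<close>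

lemma nf_dia_basic:
  assumes "basic \<Lambda> p" "x < \<Lambda>" "\<And>v. v \<in> set vs \<Longrightarrow> set v \<subseteq> {x..<\<Lambda>}" "stable \<Lambda> x l" "nf \<Lambda> l"
  shows "nf \<Lambda> (Dia x (Conj (Conj p (negs vs)) l))"
  using assms(1,3-5)
proof (induction arbitrary: vs l rule: basic.induct)
  case (basic_worm w)
  let ?h = "worm (head x w)" and ?r = "worm (rest x w)"
  have lang: "in_lang \<Lambda> l" "in_lang \<Lambda> (negs vs)" "in_lang \<Lambda> ?h" "in_lang \<Lambda> ?r"
    using basic_worm stable_lang set_head(1)[of x w] set_rest[of x w] by fastforce+
  have st: "stable \<Lambda> x (Conj ?r l)"
    using stable_conj stable_rest basic_worm assms(2) by blast
  have "equivalent \<Lambda> (Conj (Conj (worm w) (negs vs)) l) (Conj (Conj (Conj ?h ?r) (negs vs)) l)"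
    using worm_head_rest[OF basic_worm.hyps] lang by (intro equivalent_conj equivalent_refl)
  also have "equivalent \<Lambda> \<dots> (Conj (Conj ?h (negs vs)) (Conj ?r l))"
    by (rule equivalent_taut) (use lang in auto)
  finally have "equivalent \<Lambda> (Dia x (Conj (Conj (worm w) (negs vs)) l)) (Dia x (Conj (Conj ?h (negs vs)) (Conj ?r l)))"
    using assms(2) by (rule equivalent_dia)
  also have "equivalent \<Lambda> \<dots> (Conj (Dia x (Conj ?h (negs vs))) (Conj ?r l))"
    using st assms(2) by (rule dia_conj_stable) (use lang in simp)
  finally have e: "equivalent \<Lambda> (Dia x (Conj (Conj (worm w) (negs vs)) l)) (Conj (Dia x (Conj ?h (negs vs))) (Conj ?r l))" .
  have "nf \<Lambda> (Dia x (Conj ?h (negs vs)))"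
  proof (rule dia_worm_negs[OF assms(2)])
    show "set (head x w) \<subseteq> {x..<\<Lambda>}"
      unfolding subset_interval_iff using set_head[of x w] basic_worm.hyps by blast
  qed (rule basic_worm.prems(1))
  moreover have "nf \<Lambda> ?r" using lang(4) by (intro nf_basic basic.basic_worm) simp
  ultimately show ?case using nf_equivalent[OF _ e] nf_Conj basic_worm.prems(3) by blast
next
  case (basic_neg p v)
  let ?h = "worm (head x v)" and ?r = "worm (rest x v)"
  have lang: "in_lang \<Lambda> l" "in_lang \<Lambda> (negs vs)" "in_lang \<Lambda> ?h" "in_lang \<Lambda> ?r" "in_lang \<Lambda> p" "in_lang \<Lambda> (worm v)"
    using basic_neg stable_lang set_head(1)[of x v] set_rest[of x v] basic_lang by fastforce+
  \<comment> \<open>A refuted worm fails in its head or in its remainder: the former enlarges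
    \<open>vs\<close>, the latter is a stable conjunct and goes into \<open>l\<close>. Hence the
    induction is over arbitrary \<open>vs\<close> and \<open>l\<close>.\<close>
  let ?a = "Conj (Conj p (negs (head x v # vs))) l" and ?b = "Conj (Conj p (negs vs)) (Conj (Neg ?r) l)"
  have "equivalent \<Lambda> (Conj (Conj (Conj p (Neg (worm v))) (negs vs)) l)
      (Conj (Conj (Conj p (Neg (Conj ?h ?r))) (negs vs)) l)"
    using worm_head_rest[OF basic_neg.hyps(2)] lang by (intro equivalent_conj equivalent_neg equivalent_refl)
  also have "equivalent \<Lambda> \<dots> (Or ?a ?b)"
    by (rule equivalent_taut) (use lang in auto)
  finally have "equivalent \<Lambda> (Dia x (Conj (Conj (Conj p (Neg (worm v))) (negs vs)) l)) (Dia x (Or ?a ?b))"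
    using assms(2) by (rule equivalent_dia)
  also have "equivalent \<Lambda> \<dots> (Or (Dia x ?a) (Dia x ?b))"
    using assms(2) by (rule dia_or) (use lang in auto)
  finally have e: "equivalent \<Lambda> (Dia x (Conj (Conj (Conj p (Neg (worm v))) (negs vs)) l)) (Or (Dia x ?a) (Dia x ?b))" .
  have "set (head x v) \<subseteq> {x..<\<Lambda>}"
    unfolding subset_interval_iff using set_head[of x v] basic_neg.hyps by blast
  then have "nf \<Lambda> (Dia x ?a)"
    using basic_neg.prems by (intro basic_neg.IH) auto
  moreover have "nf \<Lambda> (Dia x ?b)"
  proof (rule basic_neg.IH)
    show "stable \<Lambda> x (Conj (Neg ?r) l)"
      using stable_conj stable_neg stable_rest basic_neg assms(2) by blast
    have "nf \<Lambda> ?r" using lang(4) by (intro nf_basic basic.basic_worm) simp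
    then show "nf \<Lambda> (Conj (Neg ?r) l)" using basic_neg.prems(3) by (intro nf_Conj nf_Neg)
  qed (use basic_neg in auto)
  ultimately show ?case using nf_equivalent[OF _ e] nf_Or by blast
qed

lemma nf_Dia:
  assumes "nf \<Lambda> p" "x < \<Lambda>"
  shows "nf \<Lambda> (Dia x p)"
  using assms(1)
proof induction
  case nf_Falsum
  show ?case
    by (rule nf_equivalent[OF nf.nf_Falsum], rule equivalentI[OF dia_falsum[OF assms(2)]], rule entails_taut)
      (use assms(2) in auto)
next
  case (nf_basic p)
  have top: "nf \<Lambda> (worm [])" by (rule nf.nf_basic, rule basic_worm) simp
  have "nf \<Lambda> (Dia x (Conj (Conj p (negs [])) (worm [])))"
    by (rule nf_dia_basic[OF nf_basic assms(2)]) (use top stable_worm_Nil[OF assms(2)] in auto)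
  moreover have "equivalent \<Lambda> p (Conj (Conj p (negs [])) (worm []))"
    by (rule equivalent_taut) (use basic_lang[OF nf_basic] in auto)
  ultimately show ?case using equivalent_dia assms(2) nf_equivalent by blast
next
  case (nf_Or p q)
  show ?case
    by (rule nf_equivalent[OF nf.nf_Or[OF nf_Or.IH]], rule dia_or)
      (use assms(2) nf_Or.hyps nf_lang in auto)
next
  case (nf_equivalent p q)
  then show ?case using assms(2) by (intro nf.nf_equivalent[OF nf_equivalent.IH] equivalent_dia)
qed

lemma nf_in_lang: "in_lang \<Lambda> p \<Longrightarrow> nf \<Lambda> p"
proof (induction p)
  case (Box x p)
  then have "nf \<Lambda> (Neg (Dia x (Neg p)))" by (intro nf_Neg nf_Dia) auto
  moreover have "equivalent \<Lambda> (Box x p) (Neg (Dia x (Neg p)))"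
  proof (rule equivalentI)
    have "entails \<Lambda> p (Neg (Neg p))" "entails \<Lambda> (Neg (Neg p)) p" using Box by (auto intro: entails_taut)
    then have "entails \<Lambda> (Box x p) (Box x (Neg (Neg p)))" "entails \<Lambda> (Box x (Neg (Neg p))) (Box x p)"
      using Box by (auto intro: box_mono)
    then show "entails \<Lambda> (Box x p) (Neg (Dia x (Neg p)))" "entails \<Lambda> (Neg (Dia x (Neg p))) (Box x p)"
      by - (erule entails_taut1; use Box in auto)+
  qed
  ultimately show ?case by (rule nf_equivalent)
qed (auto intro: nf_Falsum nf_Neg nf_Conj)

section \<open>Completeness from exact points\<close>

text \<open>Modalities enter only through soundness, so \<open>W\<close> may consist of the axis
  points alone, with truth still taken in the full frame, where accessibility leads out of
  \<open>W\<close>.\<close>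

locale sound_model =
  fixes \<Lambda> :: "'a ordinal" and W :: "'w set" and sat :: "'a form \<Rightarrow> 'w \<Rightarrow> bool"
  assumes sat_Falsum: "x \<in> W \<Longrightarrow> \<not> sat Falsum x"
    and sat_Neg: "x \<in> W \<Longrightarrow> sat (Neg p) x \<longleftrightarrow> \<not> sat p x"
    and sat_Conj: "x \<in> W \<Longrightarrow> sat (Conj p q) x \<longleftrightarrow> sat p x \<and> sat q x"
    and sound: "GLP0 \<Lambda> p \<Longrightarrow> x \<in> W \<Longrightarrow> sat p x"
begin

lemma sat_entails: "entails \<Lambda> p q \<Longrightarrow> x \<in> W \<Longrightarrow> sat p x \<Longrightarrow> sat q x"
  using sound[of "Imp p q" x] unfolding entails_def by (simp add: sat_Neg sat_Conj)

definition exact :: "'a ordinal list \<Rightarrow> 'w \<Rightarrow> bool"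
  where "exact w x \<longleftrightarrow> x \<in> W \<and> sat (worm w) x \<and> (\<forall>z<\<Lambda>. \<not> sat (Dia z (worm w)) x)"

text \<open>The head of \<open>v\<close> above its least modality \<open>m\<close> is handled by
  induction. If the remainder \<open>m # u\<close> were not entailed, comparing \<open>u\<close>
  with \<open>head m w\<close> would give \<open>Dia m\<close> of that head at \<open>x\<close>;
  with the stable remainder of \<open>w\<close> this makes \<open>Dia m (worm w)\<close> true,
  against exactness.\<close>

lemma exact_entails:
  assumes ex: "exact w x" and w: "set w \<subseteq> {..<\<Lambda>}"
  shows "set v \<subseteq> {..<\<Lambda>} \<Longrightarrow> sat (worm v) x \<Longrightarrow> entails \<Lambda> (worm w) (worm v)"
proof (induction "length v" arbitrary: v rule: less_induct)
  case less
  show ?case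
  proof (cases "v = []")
    case True
    then show ?thesis using w entails_top[of \<Lambda> "worm w"] by simp
  next
    case False
    define m where "m = Min (set v)"
    have m: "m \<in> set v" "set v \<subseteq> {m..}" using False by (auto simp: m_def)
    have mL: "m < \<Lambda>" using m less.prems by auto
    have xW: "x \<in> W" using ex by (simp add: exact_def)
    let ?s = "osuc m"
    obtain u where u: "rest ?s v = m # u" "set u \<subseteq> set v" "length (head ?s v) < length v"
      using rest_osuc_cases[OF m(2)] m(1) by metis
    have "sat (worm (head ?s v)) x" using sat_entails[OF entails_head] less.prems xW by blast
    then have 1: "entails \<Lambda> (worm w) (worm (head ?s v))"
      using less.hyps u(3) less.prems(1) set_head(1)[of ?s v] by blast
    have su: "sat (Dia m (worm u)) x" using sat_entails[OF entails_rest[of v \<Lambda> ?s]] less.prems xW u(1) by simp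
    let ?h = "head m w"
    have hu: "set ?h \<subseteq> {m..<\<Lambda>}" "set u \<subseteq> {m..<\<Lambda>}"
      unfolding subset_interval_iff using set_head[of m w] w u(2) m(2) less.prems by blast+
    then have lang: "in_lang \<Lambda> (worm ?h)" "in_lang \<Lambda> (worm u)" by auto
    have "\<not> entails \<Lambda> (Dia m (worm u)) (Dia m (worm ?h))"
    proof
      assume "entails \<Lambda> (Dia m (worm u)) (Dia m (worm ?h))"
      then have h: "sat (Dia m (worm ?h)) x" using su sat_entails xW by blast
      have sx: "sat (worm w) x" using ex by (simp add: exact_def)
      then have r: "sat (worm (rest m w)) x" using sat_entails[OF entails_rest] w xW by blast
      have "entails \<Lambda> (Conj (Dia m (worm ?h)) (worm (rest m w))) (Dia m (Conj (worm ?h) (worm (rest m w))))"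
        using dia_conj_stable[OF stable_rest[OF w mL] mL lang(1)] by (simp add: equivalent_def)
      also have "entails \<Lambda> \<dots> (Dia m (worm w))"
        using worm_head_rest[OF w, of m] mL by (intro dia_mono) (simp_all add: equivalent_def)
      finally have "sat (Dia m (worm w)) x" using sat_entails xW h r by (simp add: sat_Conj)
      then show False using ex mL by (auto simp: exact_def)
    qed
    moreover have "entails \<Lambda> (Dia m (worm u)) (Dia m (worm ?h)) \<or> entails \<Lambda> (worm ?h) (Dia m (worm u))"
      using comparable_dia[OF worm_comparable[OF hu(2,1)] mL] .
    ultimately have "entails \<Lambda> (worm ?h) (worm (rest ?s v))" using u(1) by simp
    then have "entails \<Lambda> (worm w) (worm (rest ?s v))" using entails_trans[OF entails_head] w by blast
    with 1 show ?thesis by (rule equivalent_conjI[OF worm_head_rest[OF less.prems(1)]])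
  qed
qed

text \<open>\<open>w\<close> is the positive worm of \<open>p\<close>. At an exact point of
  \<open>w\<close> only worms entailed by \<open>w\<close> hold, and if a negated conjunct were one
  of these, \<open>p\<close> would be inconsistent.\<close>

lemma basic_satisfiable:
  assumes "basic \<Lambda> p" "\<not> entails \<Lambda> p Falsum"
  shows "\<exists>w. set w \<subseteq> {..<\<Lambda>} \<and> entails \<Lambda> p (worm w) \<and> (\<forall>x. exact w x \<longrightarrow> sat p x)"
  using assms
proof induction
  case (basic_worm w)
  then show ?case by (intro exI[of _ w]) (auto simp: exact_def entails_refl)
next
  case (basic_neg p v)
  have l: "in_lang \<Lambda> (Conj p (Neg (worm v)))" using basic_neg basic_lang by auto
  have cp: "entails \<Lambda> (Conj p (Neg (worm v))) p" using l by (rule entails_conj1)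
  then have "\<not> entails \<Lambda> p Falsum" using basic_neg.prems entails_trans by blast
  then obtain w where w: "set w \<subseteq> {..<\<Lambda>}" "entails \<Lambda> p (worm w)" "\<And>x. exact w x \<Longrightarrow> sat p x"
    using basic_neg.IH by blast
  have "\<not> sat (worm v) x" if x: "exact w x" for x
  proof
    assume "sat (worm v) x"
    then have "entails \<Lambda> (worm w) (worm v)" using exact_entails x w(1) basic_neg.hyps(2) by blast
    then have "entails \<Lambda> p (worm v)" using w(2) entails_trans by blast
    then have "entails \<Lambda> (Conj p (Neg (worm v))) Falsum" by (rule entails_taut1) (use l in auto)
    then show False using basic_neg.prems by blast
  qed
  moreover have "x \<in> W" if "exact w x" for x using that by (simp add: exact_def)
  ultimately have "\<forall>x. exact w x \<longrightarrow> sat (Conj p (Neg (worm v))) x"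
    using w(3) by (simp add: sat_Neg sat_Conj)
  then show ?case using w cp entails_trans by blast
qed

lemma nf_satisfiable:
  assumes "nf \<Lambda> p" "\<not> entails \<Lambda> p Falsum" and ex: "\<And>w. set w \<subseteq> {..<\<Lambda>} \<Longrightarrow> \<exists>x. exact w x"
  shows "\<exists>x\<in>W. sat p x"
  using assms(1,2)
proof induction
  case nf_Falsum
  then show ?case by (simp add: entails_refl)
next
  case (nf_basic p)
  then show ?case using basic_satisfiable ex by (metis exact_def)
next
  case (nf_Or p q)
  have "\<not> (entails \<Lambda> p Falsum \<and> entails \<Lambda> q Falsum)"
  proof
    assume "entails \<Lambda> p Falsum \<and> entails \<Lambda> q Falsum"
    then have "entails \<Lambda> (Or p q) Falsum"
      by (elim conjE) (rule entails_taut2[of \<Lambda> p Falsum q Falsum], use nf_Or.hyps nf_lang in auto)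
    then show False using nf_Or.prems by blast
  qed
  then show ?case using nf_Or.IH by (auto simp: sat_Neg sat_Conj)
next
  case (nf_equivalent p q)
  then have "\<not> entails \<Lambda> p Falsum" unfolding equivalent_def using entails_trans by blast
  then show ?case using nf_equivalent sat_entails unfolding equivalent_def by blast
qed

theorem completeness:
  assumes "\<And>w. set w \<subseteq> {..<\<Lambda>} \<Longrightarrow> \<exists>x. exact w x" "in_lang \<Lambda> p" "\<And>x. x \<in> W \<Longrightarrow> sat p x"
  shows "GLP0 \<Lambda> p"
proof (rule ccontr)
  assume not: "\<not> GLP0 \<Lambda> p"
  have "\<not> entails \<Lambda> (Neg p) Falsum"
  proof
    assume "entails \<Lambda> (Neg p) Falsum"
    then have "GLP0 \<Lambda> p" unfolding entails_def by (rule GLP0_taut1) (use assms(2) in auto)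
    then show False using not by blast
  qed
  moreover have "nf \<Lambda> (Neg p)" using assms(2) by (intro nf_in_lang) simp
  ultimately show False using nf_satisfiable assms(1,3) sat_Neg by blast
qed

end

section \<open>Truth in the Kripke frames\<close>

abbreviation ksat :: "'a ordinal \<Rightarrow> 'a ordinal \<Rightarrow> 'a form \<Rightarrow> ('a ordinal \<Rightarrow> 'a ordinal) \<Rightarrow> bool"
  where "ksat \<Theta> \<Lambda> \<equiv> kripke_sat (ell_sequences \<Theta> \<Lambda>) seq_less"

lemma ell_sequences_iff:
  "f \<in> ell_sequences \<Theta> \<Lambda> \<longleftrightarrow> f \<in> {..<\<Lambda>} \<rightarrow>\<^sub>E {..<\<Theta>} \<and> lseq \<Lambda> f"
  by (simp add: ell_sequences_def lseq_def)

lemma ell_sequences_lseq: "f \<in> ell_sequences \<Theta> \<Lambda> \<Longrightarrow> lseq \<Lambda> f"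
  by (simp add: ell_sequences_iff)

lemma ell_sequences_less: "f \<in> ell_sequences \<Theta> \<Lambda> \<Longrightarrow> z < \<Lambda> \<Longrightarrow> f z < \<Theta>"
  by (auto simp: ell_sequences_iff)

section \<open>Axis points and glued sequences\<close>

definition axis :: "'a ordinal \<Rightarrow> 'a ordinal \<Rightarrow> 'a ordinal \<Rightarrow> 'a ordinal"
  where "axis \<Lambda> x = restrict (\<lambda>z. hyperlog z x) {..<\<Lambda>}"

lemma axis_apply [simp]: "z < \<Lambda> \<Longrightarrow> axis \<Lambda> x z = hyperlog z x"
  by (simp add: axis_def)

lemma axis_in_ell_sequences: "x < \<Theta> \<Longrightarrow> axis \<Lambda> x \<in> ell_sequences \<Theta> \<Lambda>"
  using lseq_cong[of \<Lambda> "axis \<Lambda> x" "\<lambda>z. hyperlog z x"] lseq_hyperlog[of \<Lambda> x]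
  by (auto simp: ell_sequences_iff axis_def intro: order.strict_trans1[OF hyperlog_le])

lemma up_axis_iff: "up \<Lambda> a (axis \<Lambda> x) \<longleftrightarrow> up \<Lambda> a (\<lambda>z. hyperlog z x)"
  by (simp add: up_def)

text \<open>The least sequence that agrees with \<open>f\<close> before \<open>s\<close> and
  dominates the axis sequence of \<open>a\<close> from \<open>s\<close> on; it supplies the
  witnesses for diamonds.\<close>

definition glue :: "'a ordinal \<Rightarrow> 'a ordinal \<Rightarrow> 'a ordinal \<Rightarrow> ('a ordinal \<Rightarrow> 'a ordinal) \<Rightarrow> 'a ordinal \<Rightarrow> 'a ordinal"
  where "glue \<Lambda> s a f = restrict (\<lambda>z. if z < s then f z else hyperlog z a) {..<\<Lambda>}"

lemma glue_apply: "z < \<Lambda> \<Longrightarrow> glue \<Lambda> s a f z = (if z < s then f z else hyperlog z a)"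
  by (simp add: glue_def)

lemma glue_in_ell_sequences:
  assumes "f \<in> ell_sequences \<Theta> \<Lambda>" "s < \<Lambda>" "hyperlog s a \<le> f s"
  shows "glue \<Lambda> s a f \<in> ell_sequences \<Theta> \<Lambda>"
proof -
  have "lseq \<Lambda> (\<lambda>z. if z < s then f z else hyperlog z a)"
    using assms by (intro lseq_glue) (auto simp: ell_sequences_lseq)
  then have "lseq \<Lambda> (glue \<Lambda> s a f)"
    by (subst lseq_cong[OF glue_apply])
  moreover have "glue \<Lambda> s a f z < \<Theta>" if "z < \<Lambda>" for z
  proof (cases "z < s")
    case True
    then show ?thesis using ell_sequences_less[OF assms(1) that] that by (simp add: glue_apply)
  next
    case False
    then have "hyperlog z a \<le> hyperlog s a" by (intro hyperlog_antimono) simp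
    also note assms(3)
    also have "f s < \<Theta>" using ell_sequences_less assms(1,2) by blast
    finally show ?thesis using False that by (simp add: glue_apply)
  qed
  moreover have "glue \<Lambda> s a f \<in> extensional {..<\<Lambda>}" by (simp add: glue_def)
  ultimately show ?thesis by (auto simp: ell_sequences_iff PiE_iff)
qed

lemma seq_less_glue: "s < \<Lambda> \<Longrightarrow> hyperlog s a < f s \<Longrightarrow> seq_less s (glue \<Lambda> s a f) f"
  by (auto simp: seq_less_def glue_apply intro: order.strict_trans)

lemma up_glueI:
  assumes "\<And>z. z < s \<Longrightarrow> hyperlog z c \<le> f z" "\<And>z. s \<le> z \<Longrightarrow> z < \<Lambda> \<Longrightarrow> hyperlog z c \<le> hyperlog z a"
  shows "up \<Lambda> c (glue \<Lambda> s a f)"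
  using assms by (simp add: up_def glue_apply)

lemma up_glueD:
  assumes "up \<Lambda> c (glue \<Lambda> s a f)"
  shows "s \<le> \<Lambda> \<Longrightarrow> z < s \<Longrightarrow> hyperlog z c \<le> f z" "s \<le> z \<Longrightarrow> z < \<Lambda> \<Longrightarrow> hyperlog z c \<le> hyperlog z a"
proof -
  have le: "hyperlog z c \<le> glue \<Lambda> s a f z" if "z < \<Lambda>" using assms that by (simp add: up_def)
  show "hyperlog z c \<le> f z" if "s \<le> \<Lambda>" "z < s"
    using le[OF order.strict_trans2[OF that(2,1)]] order.strict_trans2[OF that(2,1)] that(2)
    by (simp add: glue_apply)
  show "hyperlog z c \<le> hyperlog z a" if "s \<le> z" "z < \<Lambda>"
    using le that by (simp add: glue_apply leD)
qed

text \<open>The witness glues \<open>a\<close> to \<open>f\<close> at \<open>s\<close>. By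
  iteration, the truth sets of worms are cones.\<close>

lemma up_dia_ord_iff_ex:
  assumes f: "f \<in> ell_sequences \<Theta> \<Lambda>" and s: "s < \<Lambda>"
  shows "up \<Lambda> (dia_ord s a) f \<longleftrightarrow> (\<exists>g\<in>ell_sequences \<Theta> \<Lambda>. seq_less s g f \<and> up \<Lambda> a g)"
  unfolding up_dia_ord_iff[OF ell_sequences_lseq[OF f] s]
proof
  assume r: "(\<forall>z<s. hyperlog z a \<le> f z) \<and> hyperlog s a < f s"
  show "\<exists>g\<in>ell_sequences \<Theta> \<Lambda>. seq_less s g f \<and> up \<Lambda> a g"
  proof (intro bexI conjI)
    show "glue \<Lambda> s a f \<in> ell_sequences \<Theta> \<Lambda>" using f s r by (intro glue_in_ell_sequences) auto
    show "seq_less s (glue \<Lambda> s a f) f" using s r by (intro seq_less_glue) auto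
    show "up \<Lambda> a (glue \<Lambda> s a f)" using r by (intro up_glueI) auto
  qed
next
  assume "\<exists>g\<in>ell_sequences \<Theta> \<Lambda>. seq_less s g f \<and> up \<Lambda> a g"
  then obtain g where g: "seq_less s g f" "up \<Lambda> a g" by blast
  have "hyperlog z a \<le> f z" if "z < s" for z
    using g that s unfolding up_def seq_less_def by (metis order.strict_trans)
  moreover have "hyperlog s a < f s" using g s by (auto simp: up_def seq_less_def intro: order.strict_trans1)
  ultimately show "(\<forall>z<s. hyperlog z a \<le> f z) \<and> hyperlog s a < f s" by blast
qed

section \<open>Finite tests and invariance of truth\<close>

definition agree :: "'a ordinal \<Rightarrow> 'a ordinal set \<Rightarrow> ('a ordinal \<Rightarrow> 'a ordinal) \<Rightarrow> ('a ordinal \<Rightarrow> 'a ordinal) \<Rightarrow> bool"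
  where "agree \<Lambda> S f g \<longleftrightarrow> (\<forall>c\<in>S. up \<Lambda> c f \<longleftrightarrow> up \<Lambda> c g)"

lemma agree_sym: "agree \<Lambda> S f g \<Longrightarrow> agree \<Lambda> S g f"
  by (simp add: agree_def)

text \<open>Approximates an arbitrary \<ell>-sequence by an axis sequence: it lies below
  \<open>g\<close>, yet for finite \<open>S\<close> no element of \<open>S\<close> can tell its axis
  sequence from \<open>g\<close>.\<close>

definition lower_part :: "'a ordinal \<Rightarrow> 'a ordinal set \<Rightarrow> ('a ordinal \<Rightarrow> 'a ordinal) \<Rightarrow> 'a ordinal"
  where "lower_part \<Lambda> S g = join \<Lambda> {c \<in> S. up \<Lambda> c g}"

lemma up_lower_part:
  assumes "finite S" "lseq \<Lambda> g"
  shows "up \<Lambda> (lower_part \<Lambda> S g) g"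
  using up_join_iff[of "{c \<in> S. up \<Lambda> c g}" \<Lambda> g] assms by (simp add: lower_part_def)

lemma up_trans: "up \<Lambda> a (\<lambda>z. hyperlog z b) \<Longrightarrow> up \<Lambda> b f \<Longrightarrow> up \<Lambda> a f"
  unfolding up_def by (meson order_trans)

lemma up_lower_part_iff:
  assumes "finite S" "lseq \<Lambda> g" "c \<in> S"
  shows "up \<Lambda> c (\<lambda>z. hyperlog z (lower_part \<Lambda> S g)) \<longleftrightarrow> up \<Lambda> c g"
proof
  assume "up \<Lambda> c (\<lambda>z. hyperlog z (lower_part \<Lambda> S g))"
  then show "up \<Lambda> c g" using up_lower_part[OF assms(1,2)] by (rule up_trans)
next
  assume "up \<Lambda> c g"
  then show "up \<Lambda> c (\<lambda>z. hyperlog z (lower_part \<Lambda> S g))"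
    unfolding lower_part_def using assms(1,3) by (intro up_join_hyperlog) auto
qed

text \<open>
  The successor \<open>g\<close> of \<open>f\<close> is imitated by gluing \<open>f'\<close> to the largest axis point \<open>x\<close> below \<open>g\<close> that is
  visible to \<open>S\<close>. If the glued sequence were above some further \<open>c \<in> S\<close>, then \<open>f'\<close>, hence \<open>f\<close>,
  would have a successor above the join of \<open>c\<close> and the elements of \<open>S\<close> below \<open>g\<close>.
\<close>

lemma agree_back:
  assumes S: "finite S" and s: "s < \<Lambda>"
    and f: "f \<in> ell_sequences \<Theta> \<Lambda>" "f' \<in> ell_sequences \<Theta> \<Lambda>" "g \<in> ell_sequences \<Theta> \<Lambda>"
    and less: "seq_less s g f" and agree: "agree \<Lambda> ((\<lambda>A. dia_ord s (join \<Lambda> A)) ` Pow S) f f'"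
  shows "\<exists>g'\<in>ell_sequences \<Theta> \<Lambda>. seq_less s g' f' \<and> agree \<Lambda> S g g'"
proof -
  note lg = ell_sequences_lseq[OF f(3)]
  define A where "A = {c \<in> S. up \<Lambda> c g}"
  define x where "x = lower_part \<Lambda> S g"
  have xA: "x = join \<Lambda> A" by (simp add: x_def A_def lower_part_def)
  have A: "A \<subseteq> S" "finite A" using S by (auto simp: A_def)
  \<comment> \<open>Two kinds of subsets of \<open>S\<close> matter: \<open>A\<close> for finding a
    successor of \<open>f'\<close>, and \<open>A\<close> with one further \<open>c\<close> for
    bounding it.\<close>
  have transfer: "up \<Lambda> (dia_ord s (join \<Lambda> B)) f \<longleftrightarrow> up \<Lambda> (dia_ord s (join \<Lambda> B)) f'" if "B \<subseteq> S" for B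
    using agree that by (auto simp: agree_def)
  have xg: "up \<Lambda> x g" unfolding x_def by (rule up_lower_part[OF S lg])
  then have "up \<Lambda> (dia_ord s x) f" using up_dia_ord_iff_ex[OF f(1) s] f(3) less by blast
  then have "up \<Lambda> (dia_ord s x) f'" using transfer A(1) xA by blast
  then have xf': "\<forall>z<s. hyperlog z x \<le> f' z" "hyperlog s x < f' s"
    using up_dia_ord_iff[OF ell_sequences_lseq[OF f(2)] s] by blast+
  define g' where "g' = glue \<Lambda> s x f'"
  have g': "g' \<in> ell_sequences \<Theta> \<Lambda>"
    unfolding g'_def using f(2) s xf' by (intro glue_in_ell_sequences) auto
  have less': "seq_less s g' f'" unfolding g'_def using s xf'(2) by (rule seq_less_glue)
  have xg': "up \<Lambda> x g'" unfolding g'_def using xf'(1) by (intro up_glueI) auto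
  have "up \<Lambda> c g \<longleftrightarrow> up \<Lambda> c g'" if c: "c \<in> S" for c
  proof
    assume "up \<Lambda> c g"
    then have "up \<Lambda> c (\<lambda>z. hyperlog z x)" unfolding x_def using up_lower_part_iff[OF S lg c] by blast
    then show "up \<Lambda> c g'" using xg' by (rule up_trans)
  next
    assume cg': "up \<Lambda> c g'"
    define y where "y = join \<Lambda> (insert c A)"
    have "up \<Lambda> x g' \<longleftrightarrow> (\<forall>a\<in>A. up \<Lambda> a g')"
      unfolding xA by (rule up_join_iff[OF A(2) ell_sequences_lseq[OF g']])
    then have "up \<Lambda> y g'"
      unfolding y_def using up_join_iff[OF _ ell_sequences_lseq[OF g'], of "insert c A"] A(2) cg' xg' by simp
    then have "up \<Lambda> (dia_ord s y) f'" using up_dia_ord_iff_ex[OF f(2) s] g' less' by blast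
    then have "up \<Lambda> (dia_ord s y) f" using transfer[of "insert c A"] A(1) c by (simp add: y_def)
    then have yf: "\<forall>z<s. hyperlog z y \<le> f z"
      using up_dia_ord_iff[OF ell_sequences_lseq[OF f(1)] s] by blast
    have cy: "up \<Lambda> c (\<lambda>z. hyperlog z y)" unfolding y_def using A(2) by (intro up_join_hyperlog) auto
    show "up \<Lambda> c g"
      unfolding up_def
    proof (intro allI impI)
      fix z assume z: "z < \<Lambda>"
      show "hyperlog z c \<le> g z"
      proof (cases "z < s")
        case True
        have "hyperlog z c \<le> hyperlog z y" using cy z by (simp add: up_def)
        also have "\<dots> \<le> f z" using yf True by blast
        also have "\<dots> = g z" using less True by (simp add: seq_less_def)
        finally show ?thesis .
      next
        case False
        then have "hyperlog z c \<le> hyperlog z x" using up_glueD(2)[OF cg'[unfolded g'_def]] z by simp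
        also have "\<dots> \<le> g z" using xg z by (simp add: up_def)
        finally show ?thesis .
      qed
    qed
  qed
  then show ?thesis using g' less' unfolding agree_def by blast
qed

definition invariant :: "'a ordinal \<Rightarrow> 'a ordinal \<Rightarrow> 'a ordinal set \<Rightarrow> (('a ordinal \<Rightarrow> 'a ordinal) \<Rightarrow> bool) \<Rightarrow> bool"
  where "invariant \<Theta> \<Lambda> S Q \<longleftrightarrow> (\<forall>f\<in>ell_sequences \<Theta> \<Lambda>. \<forall>g\<in>ell_sequences \<Theta> \<Lambda>. agree \<Lambda> S f g \<longrightarrow> (Q f \<longleftrightarrow> Q g))"

lemma invariantD:
  "invariant \<Theta> \<Lambda> S Q \<Longrightarrow> f \<in> ell_sequences \<Theta> \<Lambda> \<Longrightarrow> g \<in> ell_sequences \<Theta> \<Lambda> \<Longrightarrow> agree \<Lambda> S f g \<Longrightarrow> Q f \<longleftrightarrow> Q g"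
  unfolding invariant_def by blast

text \<open>For a box, the new tests are the diamonds over all joins of old tests. They form a
  finite set, and \<open>agree_back\<close>, applied in both directions, is the back-and-forth step
  of a bisimulation.\<close>

lemma ex_invariant:
  assumes "in_lang \<Lambda> p"
  obtains S where "finite S" "invariant \<Theta> \<Lambda> S (ksat \<Theta> \<Lambda> p)"
proof -
  have "\<exists>S. finite S \<and> invariant \<Theta> \<Lambda> S (ksat \<Theta> \<Lambda> p)"
    using assms
  proof (induction p)
    case Falsum
    show ?case by (intro exI[of _ "{}"]) (simp add: invariant_def)
  next
    case (Neg p)
    then show ?case by (simp add: invariant_def)
  next
    case (Conj p q)
    obtain S where S: "finite S" "invariant \<Theta> \<Lambda> S (ksat \<Theta> \<Lambda> p)" using Conj.IH(1) Conj.prems by auto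
    obtain T where T: "finite T" "invariant \<Theta> \<Lambda> T (ksat \<Theta> \<Lambda> q)" using Conj.IH(2) Conj.prems by auto
    have "invariant \<Theta> \<Lambda> (S \<union> T) (ksat \<Theta> \<Lambda> (Conj p q))"
      unfolding invariant_def
    proof (intro ballI impI)
      fix f g assume fg: "f \<in> ell_sequences \<Theta> \<Lambda>" "g \<in> ell_sequences \<Theta> \<Lambda>" "agree \<Lambda> (S \<union> T) f g"
      then have "agree \<Lambda> S f g" "agree \<Lambda> T f g" by (auto simp: agree_def)
      then show "ksat \<Theta> \<Lambda> (Conj p q) f \<longleftrightarrow> ksat \<Theta> \<Lambda> (Conj p q) g"
        using invariantD[OF S(2) fg(1,2)] invariantD[OF T(2) fg(1,2)] by simp
    qed
    then show ?case using S(1) T(1) by blast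
  next
    case (Box s p)
    obtain S where S: "finite S" "invariant \<Theta> \<Lambda> S (ksat \<Theta> \<Lambda> p)" using Box.IH Box.prems by auto
    let ?T = "(\<lambda>A. dia_ord s (join \<Lambda> A)) ` Pow S"
    have *: "ksat \<Theta> \<Lambda> (Box s p) f"
      if f: "f \<in> ell_sequences \<Theta> \<Lambda>" "f' \<in> ell_sequences \<Theta> \<Lambda>" and ag: "agree \<Lambda> ?T f f'"
        and sat: "ksat \<Theta> \<Lambda> (Box s p) f'" for f f'
      unfolding kripke_sat.simps
    proof (intro ballI impI)
      fix g assume g: "g \<in> ell_sequences \<Theta> \<Lambda>" "seq_less s g f"
      obtain g' where g': "g' \<in> ell_sequences \<Theta> \<Lambda>" "seq_less s g' f'" "agree \<Lambda> S g g'"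
        using agree_back[OF S(1) _ f g ag] Box.prems by auto
      then have "ksat \<Theta> \<Lambda> p g'" using sat by simp
      then show "ksat \<Theta> \<Lambda> p g" using invariantD[OF S(2) g(1) g'(1,3)] by simp
    qed
    have "invariant \<Theta> \<Lambda> ?T (ksat \<Theta> \<Lambda> (Box s p))"
      unfolding invariant_def
    proof (intro ballI impI iffI)
      fix f g assume fg: "f \<in> ell_sequences \<Theta> \<Lambda>" "g \<in> ell_sequences \<Theta> \<Lambda>" "agree \<Lambda> ?T f g"
      show "ksat \<Theta> \<Lambda> (Box s p) g" if "ksat \<Theta> \<Lambda> (Box s p) f"
        using fg(2,1) agree_sym[OF fg(3)] that by (rule *)
      show "ksat \<Theta> \<Lambda> (Box s p) f" if "ksat \<Theta> \<Lambda> (Box s p) g"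
        using fg that by (rule *)
    qed
    moreover have "finite ?T" using S(1) by simp
    ultimately show ?case by (intro exI[of _ ?T] conjI)
  qed
  then show thesis using that by blast
qed

text \<open>If \<open>f\<close> coincided at \<open>s\<close> with an axis point below it, it would coincide with it up to \<open>z\<close>.\<close>

lemma axis_below_strict:
  assumes f: "lseq \<Lambda> f" and st: "s \<le> z" "z < \<Lambda>" and le: "\<And>y. s \<le> y \<Longrightarrow> y < z \<Longrightarrow> hyperlog y x \<le> f y"
    and less: "hyperlog z x < f z"
  shows "hyperlog s x \<noteq> f s"
proof
  assume eq: "hyperlog s x = f s"
  have "f y \<le> hyperlog y x" if "s \<le> y" "y \<le> z" for y
    using that
  proof (induction y rule: less_induct)
    case (less y)
    show ?case
    proof (cases "y = s")
      case False
      then have sy: "s < y" using less.prems by simp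
      then have "0 < y" using ordinal_zero_le order.strict_trans1 by blast
      moreover have "y < \<Lambda>" using less.prems st by simp
      ultimately obtain t where t: "t < y" "\<And>u. t \<le> u \<Longrightarrow> u < y \<Longrightarrow> f y \<le> hyperlog (osub u y) (f u)"
        using lseqD[OF f] by blast
      define u where "u = max s t"
      have u: "s \<le> u" "t \<le> u" "u < y" using sy t by (auto simp: u_def)
      have "u < z" using u(3) less.prems(2) by (rule order.strict_trans2)
      then have "f u \<le> hyperlog u x" "hyperlog u x \<le> f u"
        using less.IH[OF u(3,1)] le[OF u(1)] by (auto intro: less_imp_le)
      then have "f u = hyperlog u x" by (rule order.antisym)
      then show ?thesis using t(2)[OF u(2,3)] u by (simp add: hyperlog_osub)
    qed (use eq in simp)
  qed
  then show False using less st by (meson linorder_not_le order_refl)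
qed

text \<open>Substitute for the missing frame condition: \<open>g\<close> itself agrees with
  \<open>f\<close> at \<open>s\<close>, so it is replaced by its axis approximation
  \<open>x\<close>, glued to \<open>f\<close> at \<open>s\<close>. As \<open>x\<close> is strictly
  below \<open>f\<close> at \<open>z\<close>, \<open>axis_below_strict\<close> makes it strictly
  below at \<open>s\<close> too.\<close>

lemma agree_lower:
  assumes S: "finite S" and xz: "s < z" "z < \<Lambda>"
    and f: "f \<in> ell_sequences \<Theta> \<Lambda>" and g: "g \<in> ell_sequences \<Theta> \<Lambda>" and less: "seq_less z g f"
  shows "\<exists>g'\<in>ell_sequences \<Theta> \<Lambda>. seq_less s g' f \<and> agree \<Lambda> S g g'"
proof -
  note lg = ell_sequences_lseq[OF g]
  have s: "s < \<Lambda>" using xz by (rule order.strict_trans)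
  define x where "x = lower_part \<Lambda> S g"
  have xg: "up \<Lambda> x g" unfolding x_def by (rule up_lower_part[OF S lg])
  have fg: "f y = g y" if "y < z" for y using less that by (simp add: seq_less_def)
  have le: "hyperlog y x \<le> f y" if "y < z" for y
    using xg fg[OF that] order.strict_trans[OF that xz(2)] by (simp add: up_def)
  have "hyperlog z x \<le> g z" "g z < f z" using xg xz(2) less by (auto simp: up_def seq_less_def)
  then have "hyperlog z x < f z" by simp
  then have "hyperlog s x \<noteq> f s"
    by (intro axis_below_strict[OF ell_sequences_lseq[OF f], of s z]) (use xz le in auto)
  then have xs: "hyperlog s x < f s" using le[OF xz(1)] by simp
  define g' where "g' = glue \<Lambda> s x f"
  have g': "g' \<in> ell_sequences \<Theta> \<Lambda>"
    unfolding g'_def using f s xs by (intro glue_in_ell_sequences) auto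
  have less': "seq_less s g' f" unfolding g'_def using s xs by (rule seq_less_glue)
  have xg': "up \<Lambda> x g'" unfolding g'_def using le[OF order.strict_trans[OF _ xz(1)]] by (intro up_glueI) auto
  have "up \<Lambda> c g \<longleftrightarrow> up \<Lambda> c g'" if c: "c \<in> S" for c
  proof
    assume "up \<Lambda> c g"
    then have "up \<Lambda> c (\<lambda>z. hyperlog z x)" unfolding x_def using up_lower_part_iff[OF S lg c] by blast
    then show "up \<Lambda> c g'" using xg' by (rule up_trans)
  next
    assume cg': "up \<Lambda> c g'"
    show "up \<Lambda> c g"
      unfolding up_def
    proof (intro allI impI)
      fix y assume y: "y < \<Lambda>"
      show "hyperlog y c \<le> g y"
      proof (cases "y < s")
        case True
        then show ?thesis
          using up_glueD(1)[OF cg'[unfolded g'_def], of y] s fg[of y] xz(1) by auto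
      next
        case False
        then have "hyperlog y c \<le> hyperlog y x" using up_glueD(2)[OF cg'[unfolded g'_def]] y by simp
        also have "\<dots> \<le> g y" using xg y by (simp add: up_def)
        finally show ?thesis .
      qed
    qed
  qed
  then show ?thesis using g' less' unfolding agree_def by blast
qed

section \<open>Soundness and truth of worms\<close>

lemma kripke_sat_prop_eval: "kripke_sat W R p g \<longleftrightarrow> prop_eval (\<lambda>x q. kripke_sat W R (Box x q) g) p"
  by (induction p) simp_all

lemma seq_less_trans: "seq_less x f g \<Longrightarrow> seq_less x g h \<Longrightarrow> seq_less x f h"
  by (auto simp: seq_less_def)

text \<open>Loeb's axiom is induction on the value at coordinate \<open>x\<close>, and
  \<open>Neg_Intro\<close> holds because points related by \<open>seq_less z\<close> agree up to
  \<open>x\<close>. Monotonicity alone goes through invariance.\<close>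

lemma ksat_sound: "GLP0 \<Lambda> p \<Longrightarrow> f \<in> ell_sequences \<Theta> \<Lambda> \<Longrightarrow> ksat \<Theta> \<Lambda> p f"
proof (induction arbitrary: f rule: GLP0.induct)
  case (Taut p)
  then show ?case by (subst kripke_sat_prop_eval) (simp add: tautology_def)
next
  case (Loeb x p)
  have "ksat \<Theta> \<Lambda> p g" if 1: "ksat \<Theta> \<Lambda> (Box x (Imp (Box x p) p)) f"
    and "g \<in> ell_sequences \<Theta> \<Lambda>" "seq_less x g f" for g
    using that(2,3)
  proof (induction "g x" arbitrary: g rule: less_induct)
    case less
    have "ksat \<Theta> \<Lambda> p h" if "h \<in> ell_sequences \<Theta> \<Lambda>" "seq_less x h g" for h
      using less.hyps[of h] that seq_less_trans[OF that(2) less.prems(2)] by (simp add: seq_less_def)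
    then show ?case using 1 less.prems by auto
  qed
  then have "ksat \<Theta> \<Lambda> (Box x (Imp (Box x p) p)) f \<Longrightarrow> ksat \<Theta> \<Lambda> (Box x p) f" by simp
  then show ?case unfolding kripke_sat.simps(2,3) by blast
next
  case (Mono x z p)
  have False if g: "g \<in> ell_sequences \<Theta> \<Lambda>" "seq_less z g f" "ksat \<Theta> \<Lambda> p g"
    and no: "\<And>g. g \<in> ell_sequences \<Theta> \<Lambda> \<Longrightarrow> seq_less x g f \<Longrightarrow> \<not> ksat \<Theta> \<Lambda> p g" for g
  proof -
    obtain S where S: "finite S" "invariant \<Theta> \<Lambda> S (ksat \<Theta> \<Lambda> p)"
      using ex_invariant[OF Mono(3)] by blast
    obtain g' where g': "g' \<in> ell_sequences \<Theta> \<Lambda>" "seq_less x g' f" "agree \<Lambda> S g g'"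
      using agree_lower[OF S(1) Mono(1,2,4) g(1,2)] by blast
    then have "ksat \<Theta> \<Lambda> p g'" using invariantD[OF S(2) g(1) g'(1,3)] g(3) by simp
    then show False using no g' by blast
  qed
  then show ?case by auto
next
  case (Neg_Intro x z p)
  have "\<exists>h\<in>ell_sequences \<Theta> \<Lambda>. seq_less x h g \<and> ksat \<Theta> \<Lambda> p h"
    if "seq_less z g f" "h \<in> ell_sequences \<Theta> \<Lambda>" "seq_less x h f" "ksat \<Theta> \<Lambda> p h" for g h
  proof -
    have "seq_less x h g" using that(1,3) Neg_Intro(1) by (auto simp: seq_less_def)
    then show ?thesis using that by blast
  qed
  then show ?case by auto
qed auto

lemma ksat_worm_iff:
  assumes "set w \<subseteq> {..<\<Lambda>}" "f \<in> ell_sequences \<Theta> \<Lambda>"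
  shows "ksat \<Theta> \<Lambda> (worm w) f \<longleftrightarrow> up \<Lambda> (worm_ord w) f"
  using assms
proof (induction w arbitrary: f)
  case Nil
  show ?case by (simp add: up_def)
next
  case (Cons x w)
  have "ksat \<Theta> \<Lambda> (worm (x # w)) f \<longleftrightarrow> (\<exists>g\<in>ell_sequences \<Theta> \<Lambda>. seq_less x g f \<and> ksat \<Theta> \<Lambda> (worm w) g)"
    by simp
  also have "\<dots> \<longleftrightarrow> (\<exists>g\<in>ell_sequences \<Theta> \<Lambda>. seq_less x g f \<and> up \<Lambda> (worm_ord w) g)"
    using Cons by auto
  also have "\<dots> \<longleftrightarrow> up \<Lambda> (worm_ord (x # w)) f"
    using up_dia_ord_iff_ex[OF Cons.prems(2), of x "worm_ord w"] Cons.prems(1) by simp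
  finally show ?case .
qed

lemma sound_model_axis: "sound_model \<Lambda> (axis \<Lambda> ` {..<\<Theta>}) (ksat \<Theta> \<Lambda>)"
  by unfold_locales (auto intro: ksat_sound axis_in_ell_sequences)

lemma exact_axis:
  assumes w: "set w \<subseteq> {..<\<Lambda>}" and less: "worm_ord w < \<Theta>"
  shows "sound_model.exact \<Lambda> (axis \<Lambda> ` {..<\<Theta>}) (ksat \<Theta> \<Lambda>) w (axis \<Lambda> (worm_ord w))"
  unfolding sound_model.exact_def[OF sound_model_axis]
proof (intro conjI allI impI)
  let ?x = "axis \<Lambda> (worm_ord w)"
  have x: "?x \<in> ell_sequences \<Theta> \<Lambda>" using less by (rule axis_in_ell_sequences)
  show "?x \<in> axis \<Lambda> ` {..<\<Theta>}" using less by blast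
  show "ksat \<Theta> \<Lambda> (worm w) ?x" by (simp add: ksat_worm_iff[OF w x] up_axis_iff)
  fix z assume z: "z < \<Lambda>"
  show "\<not> ksat \<Theta> \<Lambda> (Dia z (worm w)) ?x"
  proof
    assume "ksat \<Theta> \<Lambda> (Dia z (worm w)) ?x"
    then obtain g where g: "g \<in> ell_sequences \<Theta> \<Lambda>" "seq_less z g ?x" "up \<Lambda> (worm_ord w) g"
      using ksat_worm_iff[OF w] by auto
    then have "hyperlog z (worm_ord w) \<le> g z" "g z < hyperlog z (worm_ord w)"
      using z by (auto simp: up_def seq_less_def)
    then show False by simp
  qed
qed

lemma complete_axis:
  assumes "hyperexp \<Lambda> 1 \<le> \<Theta>" "in_lang \<Lambda> p" "\<And>x. x < \<Theta> \<Longrightarrow> ksat \<Theta> \<Lambda> p (axis \<Lambda> x)"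
  shows "GLP0 \<Lambda> p"
proof (rule sound_model.completeness[OF sound_model_axis _ assms(2)])
  fix w :: "'a ordinal list" assume w: "set w \<subseteq> {..<\<Lambda>}"
  then have "worm_ord w < \<Theta>" using worm_ord_less assms(1) by (meson order.strict_trans2)
  then show "\<exists>x. sound_model.exact \<Lambda> (axis \<Lambda> ` {..<\<Theta>}) (ksat \<Theta> \<Lambda>) w x" using exact_axis w by blast
qed (use assms(3) in auto)

text \<open>At depth \<Theta> the worm already fails at coordinate 0, so completeness would make its
  negation derivable.\<close>

lemma kripke_complete_imp_ge:
  assumes "0 < \<Lambda>" "kripke_complete \<Theta> \<Lambda>"
  shows "hyperexp \<Lambda> 1 \<le> \<Theta>"
proof (rule ccontr)
  assume "\<not> ?thesis"
  then have "\<Theta> < hyperexp \<Lambda> 1" by simp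
  then obtain w where w: "set w \<subseteq> {..<\<Lambda>}" "\<Theta> \<le> worm_ord w" using worm_ord_cofinal by blast
  have "\<not> ksat \<Theta> \<Lambda> (worm w) f" if f: "f \<in> ell_sequences \<Theta> \<Lambda>" for f
  proof
    assume "ksat \<Theta> \<Lambda> (worm w) f"
    then have "worm_ord w \<le> f 0"
      using ksat_worm_iff[OF w(1) f] assms(1) by (auto simp: up_def dest: spec[of _ 0])
    then show False using w(2) ell_sequences_less[OF f assms(1)] by simp
  qed
  then have "GLP0 \<Lambda> (Neg (worm w))"
    using assms(2) w(1) unfolding kripke_complete_def by (metis in_lang.simps(2) in_lang_worm kripke_sat.simps(2))
  \<comment> \<open>Soundness is now used for a second frame, of depth
    \<open>hyperexp \<Lambda> 1\<close>, which contains the axis point of the worm.\<close>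
  moreover have ax: "axis \<Lambda> (worm_ord w) \<in> ell_sequences (hyperexp \<Lambda> 1) \<Lambda>"
    by (intro axis_in_ell_sequences worm_ord_less w(1))
  ultimately have "\<not> ksat (hyperexp \<Lambda> 1) \<Lambda> (worm w) (axis \<Lambda> (worm_ord w))"
    using ksat_sound by fastforce
  then show False using ksat_worm_iff[OF w(1) ax] by (simp add: up_axis_iff)
qed

section \<open>Truth in the polytopological spaces\<close>

lemma ord_topology_open_le:
  assumes "s \<le> l" "x < \<Theta>"
  shows "openin (ord_topology \<Theta> l) {y. y < \<Theta> \<and> hyperlog s y \<le> hyperlog s x}"
proof -
  have "hyperlog s x \<le> \<Theta>" using hyperlog_le[of s x] assms(2) by simp
  then show ?thesis
    unfolding ord_topology_def using assms(1) by (intro topology_generated_by_Basis) blast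
qed

lemma ord_topology_open_greater:
  assumes "s < l" "x < \<Theta>" "a < hyperlog s x"
  shows "openin (ord_topology \<Theta> l) {y. y < \<Theta> \<and> a < hyperlog s y \<and> hyperlog s y \<le> hyperlog s x}"
proof -
  have "hyperlog s x \<le> \<Theta>" using hyperlog_le[of s x] assms(2) by simp
  then show ?thesis
    unfolding ord_topology_def using assms(1,3) by (intro topology_generated_by_Basis) blast
qed

lemma ord_topology_mono:
  assumes "k \<le> l" "openin (ord_topology \<Theta> k) U"
  shows "openin (ord_topology \<Theta> l) U"
proof -
  have "generate_topology_on S U \<Longrightarrow> S \<subseteq> S' \<Longrightarrow> generate_topology_on S' U" for S S' :: "'a ordinal set set"
    by (induction rule: generate_topology_on.induct) (auto intro: generate_topology_on.intros)
  moreover have "{{z. z < \<Theta> \<and> a < hyperlog x z \<and> hyperlog x z \<le> b} | x a b. x < k \<and> a < b \<and> b \<le> \<Theta>} \<union>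
     {{z. z < \<Theta> \<and> hyperlog x z \<le> b} | x b. x \<le> k \<and> b \<le> \<Theta>} \<subseteq>
    {{z. z < \<Theta> \<and> a < hyperlog x z \<and> hyperlog x z \<le> b} | x a b. x < l \<and> a < b \<and> b \<le> \<Theta>} \<union>
     {{z. z < \<Theta> \<and> hyperlog x z \<le> b} | x b. x \<le> l \<and> b \<le> \<Theta>}"
    using assms(1) order.strict_trans2 order_trans by blast
  ultimately show ?thesis
    using assms(2) unfolding ord_topology_def openin_topology_generated_by_iff by blast
qed

text \<open>Points dominated by \<open>x\<close> in all coordinates up to \<open>l\<close> meet
  every upper bound at once, so only the finitely many lower bounds are recorded.\<close>

lemma ord_topology_basic_nbhd:
  assumes "openin (ord_topology \<Theta> l) U" "x \<in> U"
  shows "\<exists>F. finite F \<and> (\<forall>(s, a)\<in>F. s < l \<and> a < hyperlog s x) \<and>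
    (\<forall>y<\<Theta>. (\<forall>(s, a)\<in>F. a < hyperlog s y) \<and> (\<forall>s\<le>l. hyperlog s y \<le> hyperlog s x) \<longrightarrow> y \<in> U)"
  using assms unfolding ord_topology_def openin_topology_generated_by_iff
proof (induction rule: generate_topology_on.induct)
  case Empty
  then show ?case by simp
next
  case (Int U V)
  then obtain F G where
    F: "finite F" "\<forall>(s, a)\<in>F. s < l \<and> a < hyperlog s x"
      "\<forall>y<\<Theta>. (\<forall>(s, a)\<in>F. a < hyperlog s y) \<and> (\<forall>s\<le>l. hyperlog s y \<le> hyperlog s x) \<longrightarrow> y \<in> U" and
    G: "finite G" "\<forall>(s, a)\<in>G. s < l \<and> a < hyperlog s x"
      "\<forall>y<\<Theta>. (\<forall>(s, a)\<in>G. a < hyperlog s y) \<and> (\<forall>s\<le>l. hyperlog s y \<le> hyperlog s x) \<longrightarrow> y \<in> V"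
    by auto
  show ?case
    by (intro exI[of _ "F \<union> G"] conjI) (use F G in auto)
next
  case (UN K)
  then obtain U where U: "U \<in> K" "x \<in> U" by blast
  from UN.IH[OF U] show ?case
  proof (elim exE conjE)
    fix F
    assume F: "finite F" "\<forall>(s, a)\<in>F. s < l \<and> a < hyperlog s x"
      "\<forall>y<\<Theta>. (\<forall>(s, a)\<in>F. a < hyperlog s y) \<and> (\<forall>s\<le>l. hyperlog s y \<le> hyperlog s x) \<longrightarrow> y \<in> U"
    show ?case
      by (intro exI[of _ F] conjI F allI impI) (use F(3) U(1) in blast)
  qed
next
  case (Basis U)
  then consider s a b where "U = {z. z < \<Theta> \<and> a < hyperlog s z \<and> hyperlog s z \<le> b}" "s < l"
    | s b where "U = {z. z < \<Theta> \<and> hyperlog s z \<le> b}" "s \<le> l"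
    by blast
  then show ?case
  proof cases
    case 1
    moreover have "hyperlog s y \<le> b" if "\<forall>s\<le>l. hyperlog s y \<le> hyperlog s x" for y
      using that 1 Basis.prems by (auto dest!: spec[of _ s])
    ultimately show ?thesis using Basis.prems by (intro exI[of _ "{(s, a)}"]) auto
  next
    case 2
    moreover have "hyperlog s y \<le> b" if "\<forall>s\<le>l. hyperlog s y \<le> hyperlog s x" for y
      using that 2 Basis.prems by (auto dest!: spec[of _ s])
    ultimately show ?thesis using Basis.prems by (intro exI[of _ "{}"]) auto
  qed
qed

text \<open>\<open>hyperlog l\<close> is the Cantor--Bendixson rank of \<open>ord_topology \<Theta> l\<close>; this is one half of that fact.\<close>

lemma ord_topology_rank:
  assumes "x < \<Theta>"
  shows "\<exists>U. openin (ord_topology \<Theta> l) U \<and> x \<in> U \<and> (\<forall>y\<in>U. y = x \<or> hyperlog l y < hyperlog l x)"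
proof (induction l rule: less_induct)
  case (less l)
  show ?case
  proof (cases l rule: ordinal_cases)
    case 1
    then show ?thesis
      using ord_topology_open_le[of 0 l x \<Theta>] assms
      by (intro exI[of _ "{y. y < \<Theta> \<and> hyperlog 0 y \<le> hyperlog 0 x}"]) auto
  next
    case (2 t)
    have "t < l" using 2 by simp
    then obtain U where U: "openin (ord_topology \<Theta> t) U" "x \<in> U" "\<And>y. y \<in> U \<Longrightarrow> y = x \<or> hyperlog t y < hyperlog t x"
      using less[OF \<open>t < l\<close>] by (elim exE conjE) blast
    have Ul: "openin (ord_topology \<Theta> l) U" using ord_topology_mono U(1) \<open>t < l\<close> less_imp_le by blast
    have log: "hyperlog l y = hyperlog 1 (hyperlog t y)" for y
      by (simp add: 2 hyperlog_add flip: ord_add_one)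
    show ?thesis
    proof (cases "hyperlog t x = 0")
      case True
      then have "y = x" if "y \<in> U" for y using U(3)[OF that] by simp
      then show ?thesis using Ul U(2) by blast
    next
      case False
      then have "0 < hyperlog t x" by (simp add: ordinal_pos_iff)
      then obtain b where b: "hyperlog t x = b + wpow (hyperlog l x)"
        using ex_add_wpow_hyperlog[of "hyperlog t x"] log by metis
      have bx: "b < hyperlog t x" using b by (metis ord_add_less_iff ord_add_zero wpow_pos)
      \<comment> \<open>Within \<open>U \<inter> ?V\<close> and away from \<open>x\<close>,
        coordinate \<open>t\<close> is \<open>b + c\<close> with
        \<open>0 < c < wpow (hyperlog l x)\<close>, so the last exponent drops.\<close>
      let ?V = "{y. y < \<Theta> \<and> b < hyperlog t y \<and> hyperlog t y \<le> hyperlog t x}"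
      have "hyperlog l y < hyperlog l x" if y: "y \<in> U \<inter> ?V" "y \<noteq> x" for y
      proof -
        have bt: "b < hyperlog t y" "hyperlog t y < hyperlog t x" using y U(3) by auto
        obtain c where c: "hyperlog t y = b + c" using ord_le_ex_add less_imp_le[OF bt(1)] by blast
        then have "c \<noteq> 0" using bt(1) by auto
        then have c0: "0 < c" by (simp add: ordinal_pos_iff)
        have "c < wpow (hyperlog l x)" using bt(2) b c by simp
        moreover have "wpow (hyperlog 1 c) \<le> c" using wpow_hyperlog_le c0 .
        ultimately have "wpow (hyperlog 1 c) < wpow (hyperlog l x)" by (rule order.strict_trans1[rotated])
        then show ?thesis using log[of y] c c0 by (simp add: hyperlog_add_right)
      qed
      moreover have "openin (ord_topology \<Theta> l) (U \<inter> ?V)"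
        using Ul ord_topology_open_greater[OF \<open>t < l\<close> assms bx] by (rule openin_Int)
      ultimately show ?thesis using U(2) assms bx by (intro exI[of _ "U \<inter> ?V"] conjI ballI) (simp, simp, blast)
    qed
  next
    case 3
    \<comment> \<open>From \<open>t\<close> on, \<open>x\<close> has the least values compatible
      with its logarithm at \<open>l\<close>, so the neighbourhood that lowers coordinate
      \<open>t\<close> also lowers coordinate \<open>l\<close>.\<close>
    obtain t where t: "t < l" "\<And>e. t \<le> e \<Longrightarrow> e < l \<Longrightarrow> hyperlog e x = hyperexp (osub e l) (hyperlog l x)"
      using hyperlog_eventually_hyperexp[OF 3] by blast
    obtain U where U: "openin (ord_topology \<Theta> t) U" "x \<in> U" "\<And>y. y \<in> U \<Longrightarrow> y = x \<or> hyperlog t y < hyperlog t x"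
      using less[OF t(1)] by (elim exE conjE) blast
    have Ul: "openin (ord_topology \<Theta> l) U" using ord_topology_mono U(1) t(1) less_imp_le by blast
    have "hyperlog l y < hyperlog l x" if y: "y \<in> U" "y \<noteq> x" for y
    proof (rule ccontr)
      assume "\<not> ?thesis"
      then have "hyperlog l x \<le> hyperlog (osub t l) (hyperlog t y)"
        using hyperlog_osub[of t l y] t(1) by simp
      then have "hyperlog t x \<le> hyperlog t y" using le_hyperlogD t by simp
      then show False using U(3) y by force
    qed
    then show ?thesis using Ul U(2) by blast
  qed
qed

text \<open>Equality of \<open>c\<close> and \<open>x\<close> at some \<open>t < l\<close> would
  carry over to \<open>l\<close>, so \<open>c\<close> is strictly below \<open>x\<close> before
  \<open>l\<close>; this supplies the open set at successor stages. At a limit, the values of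
  \<open>c\<close> near \<open>l\<close> are hyperexponentials of the one at \<open>l\<close>, so
  domination at \<open>l\<close> pulls back to them.\<close>

lemma ord_topology_raise:
  assumes "x < \<Theta>" "\<forall>z<l. hyperlog z c \<le> hyperlog z x" "hyperlog l c < hyperlog l x"
  shows "\<exists>U. openin (ord_topology \<Theta> l) U \<and> x \<in> U \<and>
    (\<forall>y\<in>U. hyperlog l c \<le> hyperlog l y \<longrightarrow> (\<forall>z\<le>l. hyperlog z c \<le> hyperlog z y))"
  using assms(2,3)
proof (induction l rule: less_induct)
  case (less l)
  have strict: "hyperlog t c < hyperlog t x" if "t < l" for t
  proof -
    have "hyperlog t c \<noteq> hyperlog t x"
      using less.prems(2) hyperlog_osub[of t l] that by (metis less_imp_le order_less_irrefl)
    moreover have "hyperlog t c \<le> hyperlog t x" using less.prems(1) that by blast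
    ultimately show ?thesis by simp
  qed
  have IH: "\<exists>U. openin (ord_topology \<Theta> l) U \<and> x \<in> U \<and>
      (\<forall>y\<in>U. hyperlog t c \<le> hyperlog t y \<longrightarrow> (\<forall>z\<le>t. hyperlog z c \<le> hyperlog z y))" if "t < l" for t
    using less.IH[OF that _ strict[OF that]] less.prems(1) that ord_topology_mono[of t l \<Theta>]
    by (meson less_imp_le order.strict_trans)
  show ?case
  proof (cases l rule: ordinal_cases)
    case 1
    then show ?thesis
      using assms(1) openin_topspace[of "ord_topology \<Theta> l"]
      by (intro exI[of _ "{..<\<Theta>}"]) (simp add: topspace_ord_topology)
  next
    case (2 t)
    have "t < l" using 2 by simp
    then obtain U where U: "openin (ord_topology \<Theta> l) U" "x \<in> U"
      "\<And>y z. y \<in> U \<Longrightarrow> hyperlog t c \<le> hyperlog t y \<Longrightarrow> z \<le> t \<Longrightarrow> hyperlog z c \<le> hyperlog z y"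
      using IH[OF \<open>t < l\<close>] by (elim exE conjE) blast
    let ?V = "{y. y < \<Theta> \<and> hyperlog t c < hyperlog t y \<and> hyperlog t y \<le> hyperlog t x}"
    have "openin (ord_topology \<Theta> l) (U \<inter> ?V)"
      using U(1) ord_topology_open_greater[OF \<open>t < l\<close> assms(1) strict[OF \<open>t < l\<close>]] by (rule openin_Int)
    moreover have "x \<in> U \<inter> ?V" using U(2) assms(1) strict[OF \<open>t < l\<close>] by simp
    moreover have "hyperlog z c \<le> hyperlog z y"
      if y: "y \<in> U \<inter> ?V" "hyperlog l c \<le> hyperlog l y" and z: "z \<le> l" for y z
    proof -
      have "z \<le> t \<or> z = l" using z 2 by (auto simp: le_less less_osuc_iff)
      moreover have "hyperlog t c \<le> hyperlog t y" using y(1) by auto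
      ultimately show ?thesis using U(3)[of y z] y by auto
    qed
    ultimately show ?thesis by blast
  next
    case 3
    obtain t where t: "t < l" "\<And>e. t \<le> e \<Longrightarrow> e < l \<Longrightarrow> hyperlog e c = hyperexp (osub e l) (hyperlog l c)"
      using hyperlog_eventually_hyperexp[OF 3] by blast
    obtain U where U: "openin (ord_topology \<Theta> l) U" "x \<in> U"
      "\<And>y z. y \<in> U \<Longrightarrow> hyperlog t c \<le> hyperlog t y \<Longrightarrow> z \<le> t \<Longrightarrow> hyperlog z c \<le> hyperlog z y"
      using IH[OF t(1)] by (elim exE conjE) blast
    have "hyperlog z c \<le> hyperlog z y" if y: "y \<in> U" "hyperlog l c \<le> hyperlog l y" and z: "z \<le> l" for y z
    proof -
      have tail: "hyperlog e c \<le> hyperlog e y" if "t \<le> e" "e < l" for e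
      proof -
        have "hyperlog l c \<le> hyperlog (osub e l) (hyperlog e y)" using y(2) that by (simp add: hyperlog_osub)
        then show ?thesis using le_hyperlogD t(2) that by simp
      qed
      show ?thesis
      proof (cases "z < t")
        case True
        then show ?thesis using U(3)[OF y(1) tail[OF order_refl t(1)]] by simp
      next
        case False
        then have "t \<le> z" by simp
        then show ?thesis using tail[of z] y(2) z by (cases "z = l") auto
      qed
    qed
    then show ?thesis using U(1,2) by blast
  qed
qed

section \<open>Limit points as successors of axis points\<close>

lemma finite_nbhd:
  assumes "finite I" "x \<in> topspace T" "\<And>i. i \<in> I \<Longrightarrow> \<exists>U. openin T U \<and> x \<in> U \<and> (\<forall>y\<in>U. P i y)"
  shows "\<exists>U. openin T U \<and> x \<in> U \<and> (\<forall>y\<in>U. \<forall>i\<in>I. P i y)"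
  using assms(1,3)
proof induction
  case empty
  show ?case using assms(2) by (intro exI[of _ "topspace T"]) simp
next
  case (insert i I)
  then obtain U V where "openin T U" "x \<in> U" "\<forall>y\<in>U. P i y" "openin T V" "x \<in> V" "\<forall>y\<in>V. \<forall>i\<in>I. P i y"
    by (metis insertCI)
  then show ?case by (intro exI[of _ "U \<inter> V"]) auto
qed

text \<open>Encodes the lower bound \<open>a < f s\<close> as a test ordinal: before
  \<open>s\<close> its demands are met by \<open>lseq_hyperexp_le\<close>, after \<open>s\<close> it
  makes none. So the lower bounds of a basic neighbourhood become finite tests.\<close>

lemma up_hyperexp_osuc:
  assumes "lseq \<Lambda> f" "s < \<Lambda>" "a < f s"
  shows "up \<Lambda> (hyperexp s (osuc a)) f"
  unfolding up_def
proof (intro allI impI)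
  fix z assume z: "z < \<Lambda>"
  show "hyperlog z (hyperexp s (osuc a)) \<le> f z"
  proof (cases "z \<le> s")
    case True
    have "hyperexp s (osuc a) = hyperexp z (hyperexp (osub z s) (osuc a))"
      using True by (simp add: ord_add_osub flip: hyperexp_add)
    then have "hyperlog z (hyperexp s (osuc a)) = hyperexp (osub z s) (osuc a)" by simp
    also have "\<dots> \<le> hyperexp (osub z s) (f s)" using assms(3) by (simp add: osuc_le_iff)
    also have "\<dots> \<le> f z" using lseq_hyperexp_le[OF assms(1) True assms(2)] .
    finally show ?thesis .
  next
    case False
    then have "hyperlog z (hyperexp s (osuc a)) = hyperlog (osub s z) (osuc a)"
      using hyperlog_osub[of s z "hyperexp s (osuc a)"] by simp
    then show ?thesis using False by (simp add: hyperlog_osuc_right osub_pos_iff less_imp_le)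
  qed
qed

text \<open>Both directions use \<open>lower_part\<close>: a successor \<open>g\<close> is
  approximated by a point inside the given neighbourhood, and a nearby point \<open>y\<close> is
  approximated from below and glued to \<open>x\<close> at \<open>l\<close>.\<close>

lemma derived_set_axis_iff:
  assumes l: "l < \<Lambda>" and x: "x < \<Theta>" and S: "finite S"
    and Q: "invariant \<Theta> \<Lambda> S Q"
  shows "(\<forall>U. openin (ord_topology \<Theta> l) U \<and> x \<in> U \<longrightarrow> (\<exists>y\<in>U. y \<noteq> x \<and> Q (axis \<Lambda> y))) \<longleftrightarrow>
    (\<exists>g\<in>ell_sequences \<Theta> \<Lambda>. seq_less l g (axis \<Lambda> x) \<and> Q g)"
proof
  assume "\<exists>g\<in>ell_sequences \<Theta> \<Lambda>. seq_less l g (axis \<Lambda> x) \<and> Q g"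
  then obtain g where g: "g \<in> ell_sequences \<Theta> \<Lambda>" "seq_less l g (axis \<Lambda> x)" "Q g" by blast
  note lg = ell_sequences_lseq[OF g(1)]
  have gl: "g z = hyperlog z x" if "z < l" for z
    using g(2) that l by (simp add: seq_less_def)
  have gx: "g l < hyperlog l x" using g(2) l by (simp add: seq_less_def)
  show "\<forall>U. openin (ord_topology \<Theta> l) U \<and> x \<in> U \<longrightarrow> (\<exists>y\<in>U. y \<noteq> x \<and> Q (axis \<Lambda> y))"
  proof (intro allI impI)
    fix U assume U: "openin (ord_topology \<Theta> l) U \<and> x \<in> U"
    then obtain F where F: "finite F" "\<And>s a. (s, a) \<in> F \<Longrightarrow> s < l \<and> a < hyperlog s x"
      "\<And>y. y < \<Theta> \<Longrightarrow> (\<forall>(s, a)\<in>F. a < hyperlog s y) \<Longrightarrow> \<forall>s\<le>l. hyperlog s y \<le> hyperlog s x \<Longrightarrow> y \<in> U"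
      using ord_topology_basic_nbhd[of \<Theta> l U x] by fast
    \<comment> \<open>The lower bounds of the neighbourhood are added to the tests, so that
      \<open>y\<close> inherits them from \<open>g\<close>.\<close>
    define S' where "S' = S \<union> (\<lambda>(s, a). hyperexp s (osuc a)) ` F"
    have S': "finite S'" using S F(1) by (simp add: S'_def)
    define y where "y = lower_part \<Lambda> S' g"
    have yg: "hyperlog z y \<le> g z" if "z < \<Lambda>" for z
      using up_lower_part[OF S' lg] that by (simp add: up_def y_def)
    have "0 < \<Lambda>" using l ordinal_zero_le order.strict_trans1 by blast
    then have y: "y < \<Theta>"
      using yg[of 0] ell_sequences_less[OF g(1), of 0] by simp
    have "a < hyperlog s y" if sa: "(s, a) \<in> F" for s a
    proof -
      have s: "s < \<Lambda>" "a < g s" using F(2)[OF sa] l gl by auto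
      have "hyperexp s (osuc a) \<in> S'" using sa by (force simp: S'_def)
      then have "up \<Lambda> (hyperexp s (osuc a)) (\<lambda>z. hyperlog z y)"
        unfolding y_def using up_lower_part_iff[OF S' lg] up_hyperexp_osuc[OF lg s] by blast
      then show ?thesis using s(1) by (auto simp: up_def osuc_le_iff dest: spec[of _ s])
    qed
    moreover have "hyperlog s y \<le> hyperlog s x" if "s \<le> l" for s
      using yg[of s] gl[of s] gx that l by (cases "s = l") (auto simp: le_less)
    ultimately have "y \<in> U" using F(3) y by blast
    moreover have "y \<noteq> x" using yg[OF l] gx by auto
    moreover have "agree \<Lambda> S g (axis \<Lambda> y)"
      unfolding agree_def y_def using up_lower_part_iff[OF S' lg] by (simp add: up_axis_iff S'_def)
    then have "Q (axis \<Lambda> y)" using invariantD[OF Q g(1) axis_in_ell_sequences[OF y]] g(3) by blast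
    ultimately show "\<exists>y\<in>U. y \<noteq> x \<and> Q (axis \<Lambda> y)" by blast
  qed
next
  assume nb: "\<forall>U. openin (ord_topology \<Theta> l) U \<and> x \<in> U \<longrightarrow> (\<exists>y\<in>U. y \<noteq> x \<and> Q (axis \<Lambda> y))"
  have xt: "x \<in> topspace (ord_topology \<Theta> l)" using x by (simp add: topspace_ord_topology)
  \<comment> \<open>Ensures that every test passed by the glued sequence is also passed by
    \<open>y\<close> up to coordinate \<open>l\<close>.\<close>
  have "\<exists>U. openin (ord_topology \<Theta> l) U \<and> x \<in> U \<and> (\<forall>y\<in>U. \<forall>c\<in>S.
      (\<forall>z<l. hyperlog z c \<le> hyperlog z x) \<and> hyperlog l c < hyperlog l x \<and> hyperlog l c \<le> hyperlog l y \<longrightarrow>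
      (\<forall>z\<le>l. hyperlog z c \<le> hyperlog z y))"
  proof (rule finite_nbhd[OF S xt])
    fix c
    show "\<exists>U. openin (ord_topology \<Theta> l) U \<and> x \<in> U \<and> (\<forall>y\<in>U.
      (\<forall>z<l. hyperlog z c \<le> hyperlog z x) \<and> hyperlog l c < hyperlog l x \<and> hyperlog l c \<le> hyperlog l y \<longrightarrow>
      (\<forall>z\<le>l. hyperlog z c \<le> hyperlog z y))"
      using ord_topology_raise[OF x, of l c] openin_topspace[of "ord_topology \<Theta> l"] xt by blast
  qed
  then obtain U1 where U1: "openin (ord_topology \<Theta> l) U1" "x \<in> U1"
    "\<And>y c z. y \<in> U1 \<Longrightarrow> c \<in> S \<Longrightarrow> \<forall>z<l. hyperlog z c \<le> hyperlog z x \<Longrightarrow> hyperlog l c < hyperlog l x \<Longrightarrow>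
      hyperlog l c \<le> hyperlog l y \<Longrightarrow> z \<le> l \<Longrightarrow> hyperlog z c \<le> hyperlog z y"
    by blast
  \<comment> \<open>The approximation of \<open>y\<close> will be one of finitely many joins; this
    neighbourhood rules out those not dominated by \<open>x\<close> before \<open>l\<close>.\<close>
  have "\<exists>U. openin (ord_topology \<Theta> l) U \<and> x \<in> U \<and> (\<forall>y\<in>U. \<forall>v\<in>join \<Lambda> ` Pow S.
      (\<forall>z<l. hyperlog z v \<le> hyperlog z y) \<longrightarrow> (\<forall>z<l. hyperlog z v \<le> hyperlog z x))"
  proof (rule finite_nbhd[OF _ xt])
    fix v
    show "\<exists>U. openin (ord_topology \<Theta> l) U \<and> x \<in> U \<and>
      (\<forall>y\<in>U. (\<forall>z<l. hyperlog z v \<le> hyperlog z y) \<longrightarrow> (\<forall>z<l. hyperlog z v \<le> hyperlog z x))"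
    proof (cases "\<forall>z<l. hyperlog z v \<le> hyperlog z x")
      case True
      then show ?thesis using openin_topspace xt by blast
    next
      case False
      then obtain z where z: "z < l" "hyperlog z x < hyperlog z v" by (auto simp: linorder_not_le)
      have "openin (ord_topology \<Theta> l) {y. y < \<Theta> \<and> hyperlog z y \<le> hyperlog z x}"
        using z(1) x by (intro ord_topology_open_le) auto
      moreover have "\<not> (\<forall>u<l. hyperlog u v \<le> hyperlog u y)" if "hyperlog z y \<le> hyperlog z x" for y
        using z that by (meson linorder_not_le order_trans)
      ultimately show ?thesis using x
        by (intro exI[of _ "{y. y < \<Theta> \<and> hyperlog z y \<le> hyperlog z x}"]) auto
    qed
  qed (use S in simp)
  then obtain U2 where U2: "openin (ord_topology \<Theta> l) U2" "x \<in> U2"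
    "\<forall>y\<in>U2. \<forall>v\<in>join \<Lambda> ` Pow S. (\<forall>z<l. hyperlog z v \<le> hyperlog z y) \<longrightarrow> (\<forall>z<l. hyperlog z v \<le> hyperlog z x)"
    by (elim exE conjE) (rule that)
  \<comment> \<open>Leaves room at coordinate \<open>l\<close>: there \<open>y\<close> is strictly
    below \<open>x\<close>, hence so is its approximation.\<close>
  obtain U0 where U0: "openin (ord_topology \<Theta> l) U0" "x \<in> U0" "\<And>y. y \<in> U0 \<Longrightarrow> y = x \<or> hyperlog l y < hyperlog l x"
    using ord_topology_rank[OF x, of l] by (elim exE conjE) blast
  have "openin (ord_topology \<Theta> l) (U0 \<inter> U1 \<inter> U2) \<and> x \<in> U0 \<inter> U1 \<inter> U2"
    using U0(1,2) U1(1,2) U2(1,2) by (simp add: openin_Int)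
  with nb have "\<exists>y\<in>U0 \<inter> U1 \<inter> U2. y \<noteq> x \<and> Q (axis \<Lambda> y)" by (elim allE impE) (assumption | blast)+
  then obtain y where y: "y \<in> U0" "y \<in> U1" "y \<in> U2" "y \<noteq> x" "Q (axis \<Lambda> y)" by blast
  have yT: "y < \<Theta>" using openin_subset[OF U0(1)] y(1) by (auto simp: topspace_ord_topology)
  have yx: "hyperlog l y < hyperlog l x" using U0(3) y(1,4) by blast
  note ay = axis_in_ell_sequences[OF yT, of \<Lambda>]
  define v where "v = lower_part \<Lambda> S (axis \<Lambda> y)"
  have vy: "hyperlog z v \<le> hyperlog z y" if "z < \<Lambda>" for z
    using up_lower_part[OF S ell_sequences_lseq[OF ay]] that by (auto simp: up_def v_def)
  have vj: "v \<in> join \<Lambda> ` Pow S" by (auto simp: v_def lower_part_def)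
  have "\<forall>z<l. hyperlog z v \<le> hyperlog z y" using vy order.strict_trans[OF _ l] by blast
  then have "\<forall>z<l. hyperlog z v \<le> hyperlog z x"
    by (rule U2(3)[THEN bspec, OF y(3), THEN bspec, OF vj, THEN mp])
  then have vx: "hyperlog z v \<le> hyperlog z x" if "z < l" for z using that by blast
  have vl: "hyperlog l v < hyperlog l x" using vy[OF l] yx by simp
  let ?g = "glue \<Lambda> l v (axis \<Lambda> x)"
  have ge: "?g \<in> ell_sequences \<Theta> \<Lambda>"
    using axis_in_ell_sequences[OF x] l vl by (intro glue_in_ell_sequences) auto
  have "seq_less l ?g (axis \<Lambda> x)" using l vl by (intro seq_less_glue) auto
  moreover have "agree \<Lambda> S (axis \<Lambda> y) ?g"
    unfolding agree_def
  proof (intro ballI iffI)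
    fix c assume c: "c \<in> S" and "up \<Lambda> c (axis \<Lambda> y)"
    then have "up \<Lambda> c (\<lambda>z. hyperlog z v)"
      unfolding v_def using up_lower_part_iff[OF S ell_sequences_lseq[OF ay]] by blast
    moreover have "up \<Lambda> v ?g" using vx l by (intro up_glueI) auto
    ultimately show "up \<Lambda> c ?g" by (rule up_trans)
  next
    fix c assume c: "c \<in> S" and cg: "up \<Lambda> c ?g"
    have cx: "\<forall>z<l. hyperlog z c \<le> hyperlog z x" using up_glueD(1)[OF cg] l by fastforce
    have cv: "hyperlog z c \<le> hyperlog z v" if "l \<le> z" "z < \<Lambda>" for z using up_glueD(2)[OF cg that] .
    have "hyperlog l c < hyperlog l x" "hyperlog l c \<le> hyperlog l y"
      using cv[OF order_refl l] vl vy[OF l] by auto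
    then have "hyperlog z c \<le> hyperlog z y" if "z \<le> l" for z using U1(3)[OF y(2) c cx] that by blast
    moreover have "hyperlog z c \<le> hyperlog z y" if "l \<le> z" "z < \<Lambda>" for z
      using cv[OF that] vy[OF that(2)] by simp
    ultimately show "up \<Lambda> c (axis \<Lambda> y)" unfolding up_def by (metis axis_apply linorder_linear)
  qed
  ultimately show "\<exists>g\<in>ell_sequences \<Theta> \<Lambda>. seq_less l g (axis \<Lambda> x) \<and> Q g"
    using ge invariantD[OF Q ay ge] y(5) by blast
qed

lemma top_sat_iff_ksat:
  assumes "in_lang \<Lambda> p" "x < \<Theta>"
  shows "top_sat (ord_topology \<Theta>) p x \<longleftrightarrow> ksat \<Theta> \<Lambda> p (axis \<Lambda> x)"
  using assms
proof (induction p arbitrary: x)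
  case (Box l p)
  then have l: "l < \<Lambda>" and p: "in_lang \<Lambda> p" by auto
  obtain S where S: "finite S" "invariant \<Theta> \<Lambda> S (ksat \<Theta> \<Lambda> p)" using ex_invariant[OF p] by blast
  have sub: "y < \<Theta>" if "openin (ord_topology \<Theta> l) U" "y \<in> U" for U y
    using openin_subset[OF that(1)] that(2) by (auto simp: topspace_ord_topology)
  have "\<not> top_sat (ord_topology \<Theta>) (Box l p) x \<longleftrightarrow>
      (\<forall>U. openin (ord_topology \<Theta> l) U \<and> x \<in> U \<longrightarrow> (\<exists>y\<in>U. y \<noteq> x \<and> \<not> top_sat (ord_topology \<Theta>) p y))"
    using Box.prems(2) by (auto simp: in_derived_set_of topspace_ord_topology)
  also have "\<dots> \<longleftrightarrow> (\<forall>U. openin (ord_topology \<Theta> l) U \<and> x \<in> U \<longrightarrow>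
      (\<exists>y\<in>U. y \<noteq> x \<and> \<not> ksat \<Theta> \<Lambda> p (axis \<Lambda> y)))"
    using Box.IH[OF p] sub by (intro all_cong bex_cong conj_cong refl) auto
  also have "\<dots> \<longleftrightarrow> (\<exists>g\<in>ell_sequences \<Theta> \<Lambda>. seq_less l g (axis \<Lambda> x) \<and> \<not> ksat \<Theta> \<Lambda> p g)"
    by (rule derived_set_axis_iff[OF l Box.prems(2) S(1)]) (use S(2) in \<open>simp add: invariant_def\<close>)
  finally show ?case by auto
qed auto

theorem theorem8p3:
  fixes \<Theta> \<Lambda> :: "'a ordinal"
  assumes "\<Lambda> > 0"
  shows "(kripke_complete \<Theta> \<Lambda> \<longleftrightarrow> top_complete \<Theta> \<Lambda>) \<and>
    (top_complete \<Theta> \<Lambda> \<longleftrightarrow> \<Theta> \<ge> hyperexp \<Lambda> 1)"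
proof -
  have "top_complete \<Theta> \<Lambda>" if "hyperexp \<Lambda> 1 \<le> \<Theta>"
    unfolding top_complete_def using complete_axis[OF that] top_sat_iff_ksat by blast
  \<comment> \<open>Truth at all points of the frame includes truth at the axis points, that is,
    truth throughout the space.\<close>
  moreover have "kripke_complete \<Theta> \<Lambda>" if "top_complete \<Theta> \<Lambda>"
    using that top_sat_iff_ksat axis_in_ell_sequences
    unfolding top_complete_def kripke_complete_def by blast
  ultimately show ?thesis using kripke_complete_imp_ge[OF assms] by blast
qed

end
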